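(* Let $\alpha>0$ and let $\mu$ be a positive Borel measure on $\mathbb{C}$. For a weight $w$ put $\widehat{\mu}_{w}(z):=\frac{\mu(D(z,1))}{w(D(z,1))}$, $z\in\mathbb{C}$, and let $I_d:F^p_{\alpha,w}\to L^p_{\alpha}(\mu)$, $f\mapsto f$, be the natural embedding. (1) Let $1<p<2$ and $w\in A^{\mathrm{restricted}}_p$. Then for any $r\geq1$, $I_d:F^p_{\alpha,w}\to L^p_{\alpha}(\mu)$ is $r$-summing if and only if $\widehat{\mu}_w\in L^{2/p}(\mathbb{C},dA)$. Moreover, $$\pi_r(I_d)\asymp\pi_2(I_d)\asymp\left(\int_{\mathbb{C}}\widehat{\mu}_w(z)^{2/p}dA(z)\right)^{1/2}.$$ (2) Let $p\geq2$ and $w\in A^{\mathrm{restricted}}_{\infty}$. Then (i) for $1\leq r\leq p'$, $I_d:F^p_{\alpha,w}\to L^p_{\alpha}(\mu)$ is $r$-summing if and only if $\widehat{\mu}_w\in L^{p'/p}(\mathbb{C},dA)$. Moreover, $$\pi_r(I_d)\asymp\pi_1(I_d)\asymp\left(\int_{\mathbb{C}}\widehat{\mu}_w(z)^{p'/p}dA(z)\right)^{1/p'}.$$ (ii) for $p'\leq r\leq p$, $I_d:F^p_{\alpha,w}\to L^p_{\alpha}(\mu)$ is $r$-summing if and only if $\widehat{\mu}_w\in L^{r/p}(\mathbb{C},dA)$. Moreover, $$\pi_r(I_d)\asymp\left(\int_{\mathbb{C}}\widehat{\mu}_w(z)^{r/p}dA(z)\right)^{1/r}.$$ (iii) for $r\geq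 p$, $I_d:F^p_{\alpha,w}\to L^p_{\alpha}(\mu)$ is $r$-summing if and only if $\widehat{\mu}_w\in L^1(\mathbb{C},dA)$. Moreover, $$\pi_r(I_d)\asymp\pi_p(I_d)\asymp\left(\int_{\mathbb{C}}\widehat{\mu}_w(z)dA(z)\right)^{1/p}.$$
   Context: $dA$ is Lebesgue measure on $\mathbb{C}$, $D(z,t)$ is the disk centered at $z$ of radius $t$, $A(E)$ is the area of $E$, $w(E):=\int_E w\,dA$, and $p'$ is the conjugate exponent of $p$ ($1/p+1/p'=1$). A weight is a nonnegative locally integrable function $w$ on $\mathbb{C}$. $L^p_{\alpha,w}$ is the space of measurable $f$ on $\mathbb{C}$ with $\|f\|^p_{L^p_{\alpha,w}}:=\int_{\mathbb{C}}|f(z)|^pe^{-\frac{p\alpha}{2}|z|^2}w(z)dA(z)<\infty$; $F^p_{\alpha,w}$ is the subspace of entire functions in $L^p_{\alpha,w}$, with the inherited norm. $L^p_\alpha(\mu)$ is the space of measurable $f$ with $\|f\|^p_{L^p_{\alpha}(\mu)}:=\int_{\mathbb{C}}|f(z)|^pe^{-\frac{p\alpha}{2}|z|^2}d\mu(z)<\infty$. $Q_t(z)$ is the square centered at $z$ with side length $t$ and sides parallel to the axes. For $1<p<\infty$, $w\in A^{\mathrm{restricted}}_p$ means: $w>0$ a.e. and for some $t>0$, $$\sup_{z\in\mathbb{C}}\left(\frac{1}{A(Q_t(z))}\int_{Q_t(z)}w\,dA\right)\left(\frac{1}{A(Q_t(z))}\int_{Q_t(z)}w^{-p'/p}dA\right)^{p/p'}<\infty$$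 (this is independent of $t$). $w\in A^{\mathrm{restricted}}_1$ means: $w>0$ a.e. and for some $t>0$, $\sup_{z\in\mathbb{C}}\frac{\int_{Q_t(z)}w\,dA}{A(Q_t(z))\,\mathrm{ess\,inf}_{u\in Q_t(z)}w(u)}<\infty$. $A^{\mathrm{restricted}}_\infty:=\bigcup_{1\le p<\infty}A^{\mathrm{restricted}}_p$. For $r\ge1$, a linear operator $T:X\to Y$ between Banach spaces is $r$-summing if there is $C\ge0$ such that $\left(\sum_{j=1}^n\|Tx_j\|_Y^r\right)^{1/r}\le C\sup_{x^*\in B_{X^*}}\left(\sum_{j=1}^n|x^*(x_j)|^r\right)^{1/r}$ for every finite sequence $x_1,\dots,x_n\in X$; the least such $C$ is $\pi_r(T)$. $B_{X}$ is the unit ball of $X$. Saying that $I_d$ is $r$-summing includes that it maps into the target space. $A\asymp B$ means $c^{-1}A\le B\le cA$ with a constant $c>0$ not depending on $\mu$ (it may depend on $\alpha,p,r,w$); norm equivalences are understood when the operator is $r$-summing. *)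

theory Defs
  imports "HOL-Analysis.Analysis"
begin

text \<open>
  Area measure \<open>dA\<close> is \<^term>\<open>lebesgue :: complex measure\<close>, the completed Lebesgue measure, so that
  measurability with respect to \<open>dA\<close> is Lebesgue measurability.
\<close>

definition conj_exp :: "real \<Rightarrow> real" where
  "conj_exp p = p / (p - 1)"

text \<open>Powers with exponent \<open>s > 0\<close> on \<open>[0,\<infinity>]\<close>; the library only has real powers.\<close>

definition epowr :: "ennreal \<Rightarrow> real \<Rightarrow> ennreal" where
  "epowr x s = (if x = top then top else ennreal (enn2real x powr s))"

section \<open>Weights\<close>

definition weight :: "(complex \<Rightarrow> real) \<Rightarrow> bool" where
  "weight w \<longleftrightarrow> (\<forall>z. 0 \<le> w z) \<and> (\<forall>K. compact K \<longrightarrow> w absolutely_integrable_on K)"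

definition wmass :: "(complex \<Rightarrow> real) \<Rightarrow> complex set \<Rightarrow> ennreal" where
  "wmass w E = (\<integral>\<^sup>+u\<in>E. ennreal (w u) \<partial>lebesgue)"

definition square :: "real \<Rightarrow> complex \<Rightarrow> complex set" where
  "square t z = {u. \<bar>Re u - Re z\<bar> \<le> t / 2 \<and> \<bar>Im u - Im z\<bar> \<le> t / 2}"

definition area :: "complex set \<Rightarrow> ennreal" where
  "area E = emeasure lebesgue E"

definition ess_inf_on :: "complex set \<Rightarrow> (complex \<Rightarrow> real) \<Rightarrow> ennreal" where
  "ess_inf_on S w = Sup {m. AE u in lebesgue. u \<in> S \<longrightarrow> m \<le> ennreal (w u)}"

text \<open>
  The suprema are taken in \<open>[0,\<infinity>]\<close>. Since \<open>w > 0\<close> almost everywhere, the average of \<open>w\<close> over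
  a square is positive, so neither \<open>0 \<cdot> \<infinity>\<close> (below) nor \<open>0 / 0\<close> (for \<open>p = 1\<close>) occurs.
\<close>

definition A_restricted_gt1 :: "real \<Rightarrow> (complex \<Rightarrow> real) set" where
  "A_restricted_gt1 p = {w. weight w \<and> (AE z in lebesgue. 0 < w z) \<and>
     (\<exists>t>0. (SUP z.
        (1 / area (square t z) * wmass w (square t z)) *
        epowr (1 / area (square t z) *
                wmass (\<lambda>u. w u powr (- (conj_exp p / p))) (square t z))
              (p / conj_exp p)) < top)}"

definition A_restricted_1 :: "(complex \<Rightarrow> real) set" where
  "A_restricted_1 = {w. weight w \<and> (AE z in lebesgue. 0 < w z) \<and>
     (\<exists>t>0. (SUP z. wmass w (square t z) /
        (area (square t z) * ess_inf_on (square t z) w)) < top)}"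

definition A_restricted_infty :: "(complex \<Rightarrow> real) set" where
  "A_restricted_infty = A_restricted_1 \<union> (\<Union>p\<in>{1<..}. A_restricted_gt1 p)"

section \<open>Function spaces\<close>

definition integral_Lw ::
  "real \<Rightarrow> real \<Rightarrow> (complex \<Rightarrow> real) \<Rightarrow> (complex \<Rightarrow> complex) \<Rightarrow> ennreal" where
  "integral_Lw \<alpha> p w f =
     (\<integral>\<^sup>+z. ennreal (cmod (f z) powr p * exp (- (p * \<alpha> / 2) * (cmod z)\<^sup>2) * w z) \<partial>lebesgue)"

definition Lw_space ::
  "real \<Rightarrow> real \<Rightarrow> (complex \<Rightarrow> real) \<Rightarrow> (complex \<Rightarrow> complex) set" where
  "Lw_space \<alpha> p w = {f \<in> borel_measurable lebesgue. integral_Lw \<alpha> p w f < top}"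

definition Lw_norm ::
  "real \<Rightarrow> real \<Rightarrow> (complex \<Rightarrow> real) \<Rightarrow> (complex \<Rightarrow> complex) \<Rightarrow> real" where
  "Lw_norm \<alpha> p w f = enn2real (integral_Lw \<alpha> p w f) powr (1 / p)"

definition Fock_space ::
  "real \<Rightarrow> real \<Rightarrow> (complex \<Rightarrow> real) \<Rightarrow> (complex \<Rightarrow> complex) set" where
  "Fock_space \<alpha> p w = {f \<in> Lw_space \<alpha> p w. f holomorphic_on UNIV}"

text \<open>
  The space \<open>L\<^sup>p\<^sub>\<alpha>(\<mu>)\<close> is represented by functions rather than by classes modulo \<open>\<mu>\<close>-null sets, with
  the corresponding seminorm.
\<close>

definition integral_Lmu ::
  "real \<Rightarrow> real \<Rightarrow> complex measure \<Rightarrow> (complex \<Rightarrow> complex) \<Rightarrow> ennreal" where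
  "integral_Lmu \<alpha> p \<mu> f =
     (\<integral>\<^sup>+z. ennreal (cmod (f z) powr p * exp (- (p * \<alpha> / 2) * (cmod z)\<^sup>2)) \<partial>\<mu>)"

definition Lmu_space ::
  "real \<Rightarrow> real \<Rightarrow> complex measure \<Rightarrow> (complex \<Rightarrow> complex) set" where
  "Lmu_space \<alpha> p \<mu> = {f \<in> borel_measurable \<mu>. integral_Lmu \<alpha> p \<mu> f < top}"

definition Lmu_norm ::
  "real \<Rightarrow> real \<Rightarrow> complex measure \<Rightarrow> (complex \<Rightarrow> complex) \<Rightarrow> real" where
  "Lmu_norm \<alpha> p \<mu> f = enn2real (integral_Lmu \<alpha> p \<mu> f) powr (1 / p)"

section \<open>Summing operators\<close>

text \<open>
  A (semi)normed space of complex-valued functions is given by its carrier and its norm, with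
  pointwise operations. Elements of the dual ball are functions on the whole type; only their
  restriction to the carrier matters.
\<close>

definition linear_map_on ::
  "('s \<Rightarrow> complex) set \<Rightarrow> ('t \<Rightarrow> complex) set \<Rightarrow> (('s \<Rightarrow> complex) \<Rightarrow> ('t \<Rightarrow> complex)) \<Rightarrow> bool" where
  "linear_map_on X Y T \<longleftrightarrow>
     (\<forall>f\<in>X. T f \<in> Y) \<and>
     (\<forall>f\<in>X. \<forall>g\<in>X. T (\<lambda>s. f s + g s) = (\<lambda>t. T f t + T g t)) \<and>
     (\<forall>c. \<forall>f\<in>X. T (\<lambda>s. c * f s) = (\<lambda>t. c * T f t))"

definition dual_ball ::
  "('s \<Rightarrow> complex) set \<Rightarrow> (('s \<Rightarrow> complex) \<Rightarrow> real) \<Rightarrow> (('s \<Rightarrow> complex) \<Rightarrow> complex) set" where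
  "dual_ball X nX = {\<phi>.
     (\<forall>f\<in>X. \<forall>g\<in>X. \<phi> (\<lambda>s. f s + g s) = \<phi> f + \<phi> g) \<and>
     (\<forall>c. \<forall>f\<in>X. \<phi> (\<lambda>s. c * f s) = c * \<phi> f) \<and>
     (\<forall>f\<in>X. cmod (\<phi> f) \<le> nX f)}"

text \<open>
  The real supremum is over a nonempty set bounded by \<open>(\<Sum>j<n. nX (x j) powr r) powr (1 / r)\<close>.
\<close>

definition summing_const ::
  "real \<Rightarrow> ('s \<Rightarrow> complex) set \<Rightarrow> (('s \<Rightarrow> complex) \<Rightarrow> real) \<Rightarrow> (('t \<Rightarrow> complex) \<Rightarrow> real) \<Rightarrow>
   (('s \<Rightarrow> complex) \<Rightarrow> ('t \<Rightarrow> complex)) \<Rightarrow> real \<Rightarrow> bool" where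
  "summing_const r X nX nY T C \<longleftrightarrow> 0 \<le> C \<and>
     (\<forall>n::nat. \<forall>x. (\<forall>j<n. x j \<in> X) \<longrightarrow>
        (\<Sum>j<n. nY (T (x j)) powr r) powr (1 / r) \<le>
        C * (SUP \<phi>\<in>dual_ball X nX. (\<Sum>j<n. cmod (\<phi> (x j)) powr r) powr (1 / r)))"

definition summing ::
  "real \<Rightarrow> ('s \<Rightarrow> complex) set \<Rightarrow> (('s \<Rightarrow> complex) \<Rightarrow> real) \<Rightarrow>
   ('t \<Rightarrow> complex) set \<Rightarrow> (('t \<Rightarrow> complex) \<Rightarrow> real) \<Rightarrow>
   (('s \<Rightarrow> complex) \<Rightarrow> ('t \<Rightarrow> complex)) \<Rightarrow> bool" where
  "summing r X nX Y nY T \<longleftrightarrow> linear_map_on X Y T \<and> (\<exists>C. summing_const r X nX nY T C)"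

definition summing_norm ::
  "real \<Rightarrow> ('s \<Rightarrow> complex) set \<Rightarrow> (('s \<Rightarrow> complex) \<Rightarrow> real) \<Rightarrow> (('t \<Rightarrow> complex) \<Rightarrow> real) \<Rightarrow>
   (('s \<Rightarrow> complex) \<Rightarrow> ('t \<Rightarrow> complex)) \<Rightarrow> real" where
  "summing_norm r X nX nY T = Inf {C. summing_const r X nX nY T C}"

section \<open>The embedding and the averaging function\<close>

definition Id_summing ::
  "real \<Rightarrow> real \<Rightarrow> real \<Rightarrow> (complex \<Rightarrow> real) \<Rightarrow> complex measure \<Rightarrow> bool" where
  "Id_summing r \<alpha> p w \<mu> \<longleftrightarrow>
     summing r (Fock_space \<alpha> p w) (Lw_norm \<alpha> p w) (Lmu_space \<alpha> p \<mu>) (Lmu_norm \<alpha> p \<mu>) (\<lambda>f. f)"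

definition pi_Id ::
  "real \<Rightarrow> real \<Rightarrow> real \<Rightarrow> (complex \<Rightarrow> real) \<Rightarrow> complex measure \<Rightarrow> real" where
  "pi_Id r \<alpha> p w \<mu> =
     summing_norm r (Fock_space \<alpha> p w) (Lw_norm \<alpha> p w) (Lmu_norm \<alpha> p \<mu>) (\<lambda>f. f)"

text \<open>The measure \<open>\<mu>\<close> need not be locally finite, so its averages may be infinite.\<close>

definition mu_hat :: "complex measure \<Rightarrow> (complex \<Rightarrow> real) \<Rightarrow> complex \<Rightarrow> ennreal" where
  "mu_hat \<mu> w z = emeasure \<mu> (ball z 1) / wmass w (ball z 1)"

definition integral_powr :: "real \<Rightarrow> (complex \<Rightarrow> ennreal) \<Rightarrow> ennreal" where
  "integral_powr s g = (\<integral>\<^sup>+z. epowr (g z) s \<partial>lebesgue)"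

definition in_L :: "real \<Rightarrow> (complex \<Rightarrow> ennreal) \<Rightarrow> bool" where
  "in_L s g \<longleftrightarrow> g \<in> borel_measurable lebesgue \<and> integral_powr s g < top"

definition comparable :: "real \<Rightarrow> real \<Rightarrow> real \<Rightarrow> bool" where
  "comparable c A B \<longleftrightarrow> inverse c * A \<le> B \<and> B \<le> c * A"

end

theory Submission
  imports Defs "HOL-Complex_Analysis.Complex_Analysis"
begin

text \<open>
  On a fine square lattice with cells \<open>Q\<^sub>\<nu>\<close> the embedding behaves like the diagonal operator on
  \<open>\<ell>\<^sup>p\<close> with entries \<open>a\<^sub>\<nu> = (\<mu>(Q\<^sub>\<nu>) / w(Q\<^sub>\<nu>))\<^bsup>1/p\<^esup>\<close>: point evaluations near the
  cells map the Fock space boundedly into \<open>\<ell>\<^sup>p\<close>, and combinations of normalised kernels map \<open>\<ell>\<^sup>p\<close>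
  boundedly back. Of the weight only a lower bound \<open>w(D) \<ge> c \<bar>D\<bar>\<^sup>q w(Q)\<close> for small discs \<open>D\<close> in a
  square \<open>Q\<close> is used, which every restricted Muckenhoupt class provides.

  The upper bounds come from explicit Pietsch measures for the diagonal operator: coordinate
  functionals, weighted by \<open>a\<^sub>\<nu>\<^sup>r\<close>, if \<open>r \<le> p\<close>, and random signs together with Khintchine's
  inequality if \<open>r = 1\<close>. They are transferred to the Fock space by averaging over simultaneous
  translations of all sampling points. For the lower bounds the embedding is tested on the
  normalised kernels themselves, whose images under any functional of norm one lie in the unit ball
  of \<open>\<ell>\<^bsup>p'\<^esup>\<close> up to a constant, and on random sign combinations of them.
\<close>

section \<open>Finite inequalities\<close>

text \<open>Three obstacles shape the argument. The weight may be tiny on parts of a cell, so an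
  area mean of |f|^p does not control f at a point in the weighted norm. Instead a disc of some
  radius rho is found on which f is at least a multiple of rho^(-k) times its value at the point,
  and k is tuned so that this gain pays for the factor rho^theta lost in the mass of a small disc.
  Next, the supremum of |f| over a cell is not linear in f and is attained at a point depending on
  f, so it cannot be fed into a Pietsch measure; a mean over shifts common to all cells replaces it,
  each shift giving linear functionals. Finally, kernels at neighbouring cells overlap and could
  cancel in a sum; with random signs the mean modulus dominates the square function, of which a
  single term may be kept. The ranges of r are joined by monotonicity of summing constants in the
  exponent: sufficiency is shown at an exponent not above r, necessity at one not below r, both with
  the same power of the averaging function.\<close>

lemma Holder_sum:
  fixes x y :: "'i \<Rightarrow> real"
  assumes "p > 1" "1 / p + 1 / q = 1" and fin: "finite N"
    and x: "\<And>i. i \<in> N \<Longrightarrow> 0 \<le> x i" and y: "\<And>i. i \<in> N \<Longrightarrow> 0 \<le> y i"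
  shows "(\<Sum>i\<in>N. x i * y i) \<le> (\<Sum>i\<in>N. x i powr p) powr (1/p) * (\<Sum>i\<in>N. y i powr q) powr (1/q)"
proof -
  have q: "q > 1"
  proof -
    have "1/q = 1 - 1/p" using assms by simp
    moreover have "0 < 1 - 1/p" "1 - 1/p < 1" using \<open>p > 1\<close> by auto
    ultimately have "0 < 1/q" "1/q < 1" by auto
    then show ?thesis by (simp add: divide_less_eq split: if_splits)
  qed
  define A where "A = (\<Sum>i\<in>N. x i powr p)"
  define B where "B = (\<Sum>i\<in>N. y i powr q)"
  have A0: "A \<ge> 0" and B0: "B \<ge> 0" unfolding A_def B_def by (auto intro: sum_nonneg)
  show ?thesis
  proof (cases "A = 0 \<or> B = 0")
    case True
    then have "\<forall>i\<in>N. x i = 0 \<or> y i = 0"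
      unfolding A_def B_def using fin by (auto simp: sum_nonneg_eq_0_iff)
    then have "(\<Sum>i\<in>N. x i * y i) = 0" by (auto intro!: sum.neutral)
    then show ?thesis by simp
  next
    case False
    with A0 B0 have A: "A > 0" and B: "B > 0" by auto
    define a where "a = A powr (1/p)"
    define b where "b = B powr (1/q)"
    have ab: "a > 0" "b > 0" unfolding a_def b_def using A B by auto
    have ap: "a powr p = A" "b powr q = B"
      unfolding a_def b_def using \<open>p > 1\<close> q A B by (auto simp: powr_powr)
    have "x i * y i \<le> a * b * ((x i powr p / A) / p + (y i powr q / B) / q)" if "i \<in> N" for i
    proof -
      have "(x i / a) * (y i / b) \<le> (x i / a) powr p / p + (y i / b) powr q / q"
        using \<open>p > 1\<close> q assms(2) ab x[OF that] y[OF that] by (intro Youngs_inequality) auto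
      also have "\<dots> = (x i powr p / A) / p + (y i powr q / B) / q"
        using ab x[OF that] y[OF that] ap by (simp add: powr_divide)
      finally show ?thesis using ab by (simp add: field_simps)
    qed
    then have "(\<Sum>i\<in>N. x i * y i) \<le> (\<Sum>i\<in>N. a * b * ((x i powr p / A) / p + (y i powr q / B) / q))"
      by (rule sum_mono)
    also have "\<dots> = a * b * ((A / A) / p + (B / B) / q)"
      unfolding A_def B_def by (simp add: sum_distrib_left[symmetric] sum.distrib sum_divide_distrib[symmetric])
    also have "\<dots> = a * b" using A B assms(2) by simp
    finally show ?thesis unfolding a_def b_def A_def B_def .
  qed
qed

text \<open>Hoelder's inequality for the splitting of l i * x i into l i^(1/p) x i and l i^(1/q).
  The weights are not normalised: in the applications they are values of Gaussians at a point, or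
  the uniform probability on sign patterns.\<close>

lemma power_mean_sum:
  fixes x l :: "'i \<Rightarrow> real"
  assumes "p \<ge> 1" and fin: "finite N"
    and l: "\<And>i. i \<in> N \<Longrightarrow> 0 \<le> l i" and x: "\<And>i. i \<in> N \<Longrightarrow> 0 \<le> x i"
  shows "(\<Sum>i\<in>N. l i * x i) powr p \<le> (\<Sum>i\<in>N. l i) powr (p - 1) * (\<Sum>i\<in>N. l i * x i powr p)"
proof (cases "p = 1")
  case True
  have "(\<Sum>i\<in>N. l i * x i powr 1) = (\<Sum>i\<in>N. l i * x i)"
    using x by (intro sum.cong) auto
  \<comment> \<open>As \<open>0 powr 0\<close> is 0, the right-hand side vanishes for total weight
    zero, so the left one has to vanish too.\<close>
  moreover have "(\<Sum>i\<in>N. l i * x i) = 0" if "sum l N = 0"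
    using that l fin by (auto simp: sum_nonneg_eq_0_iff intro!: sum.neutral)
  moreover have "0 \<le> (\<Sum>i\<in>N. l i * x i)" using l x by (auto intro: sum_nonneg)
  ultimately show ?thesis using True by (cases "sum l N = 0") auto
next
  case False
  with assms have p: "p > 1" by auto
  define q where "q = p / (p - 1)"
  have pq: "1/p + 1/q = 1" using p by (simp add: q_def field_simps)
  have qp: "q > 0" using p by (simp add: q_def)
  have "(\<Sum>i\<in>N. l i * x i) = (\<Sum>i\<in>N. (l i powr (1/p) * x i) * l i powr (1/q))"
  proof (rule sum.cong)
    fix i assume "i \<in> N"
    have "l i = l i powr (1/p + 1/q)" using l[OF \<open>i \<in> N\<close>] pq by simp
    also have "\<dots> = l i powr (1/p) * l i powr (1/q)" by (simp add: powr_add)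
    finally show "l i * x i = (l i powr (1/p) * x i) * l i powr (1/q)" by (simp add: mult_ac)
  qed simp
  also have "\<dots> \<le> (\<Sum>i\<in>N. (l i powr (1/p) * x i) powr p) powr (1/p)
                  * (\<Sum>i\<in>N. (l i powr (1/q)) powr q) powr (1/q)"
    using p pq fin x by (intro Holder_sum) auto
  also have "(\<Sum>i\<in>N. (l i powr (1/p) * x i) powr p) = (\<Sum>i\<in>N. l i * x i powr p)"
    using p l x by (intro sum.cong) (auto simp: powr_mult powr_powr)
  also have "(\<Sum>i\<in>N. (l i powr (1/q)) powr q) = (\<Sum>i\<in>N. l i)"
    using qp l by (intro sum.cong) (auto simp: powr_powr)
  finally have "(\<Sum>i\<in>N. l i * x i) powr p
      \<le> ((\<Sum>i\<in>N. l i * x i powr p) powr (1/p) * (\<Sum>i\<in>N. l i) powr (1/q)) powr p"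
    using p l x by (intro powr_mono2) (auto intro: sum_nonneg)
  also have "\<dots> = (\<Sum>i\<in>N. l i * x i powr p) * (\<Sum>i\<in>N. l i) powr (p - 1)"
  proof -
    have "0 \<le> (\<Sum>i\<in>N. l i * x i powr p)" "0 \<le> sum l N" using l by (auto intro!: sum_nonneg)
    then show ?thesis using p by (simp add: powr_mult powr_powr q_def)
  qed
  finally show ?thesis by (simp add: mult.commute)
qed

lemma sum_powr_le_powr_sum:
  fixes x :: "'i \<Rightarrow> real"
  assumes "0 < r" "r \<le> p" "finite N" and x: "\<And>i. i \<in> N \<Longrightarrow> 0 \<le> x i"
  shows "(\<Sum>i\<in>N. x i powr p) \<le> (\<Sum>i\<in>N. x i powr r) powr (p / r)"
proof -
  define S where "S = (\<Sum>i\<in>N. x i powr r)"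
  have S0: "S \<ge> 0" unfolding S_def by (auto intro: sum_nonneg)
  have "x i powr p \<le> x i powr r * S powr ((p - r) / r)" if "i \<in> N" for i
  proof -
    have "x i powr r \<le> S" unfolding S_def using that assms by (intro member_le_sum) auto
    then have "(x i powr r) powr ((p - r) / r) \<le> S powr ((p - r) / r)"
      using assms by (intro powr_mono2) auto
    then have "x i powr (p - r) \<le> S powr ((p - r) / r)"
      using assms by (simp add: powr_powr)
    then have "x i powr r * x i powr (p - r) \<le> x i powr r * S powr ((p - r) / r)"
      by (intro mult_left_mono) auto
    then show ?thesis by (simp add: powr_add[symmetric])
  qed
  then have "(\<Sum>i\<in>N. x i powr p) \<le> (\<Sum>i\<in>N. x i powr r * S powr ((p - r) / r))" by (rule sum_mono)
  also have "\<dots> = S * S powr ((p - r) / r)" by (simp add: sum_distrib_right[symmetric] S_def)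
  also have "\<dots> = S powr (1 + (p - r) / r)" using S0 by (simp add: powr_add)
  also have "1 + (p - r) / r = p / r" using assms by (simp add: field_simps)
  finally show ?thesis unfolding S_def .
qed

text \<open>The duality proof: of V i^P one factor V i is opened as an integral, Hoelder's
  inequality under the integral sign gives S <= S^(1 - 1/P) * R with R the right-hand side, and S^(1
  - 1/P) is divided out. It serves to take an average over shifts out of a norm on the
  lattice.\<close>

lemma Minkowski_integral:
  fixes g :: "'i \<Rightarrow> 'a::euclidean_space \<Rightarrow> real"
  assumes "P \<ge> 1" and fin: "finite N"
    and al: "\<And>i. i \<in> N \<Longrightarrow> 0 \<le> al i"
    and cont: "\<And>i. i \<in> N \<Longrightarrow> continuous_on (cbox a b) (g i)"
    and g0: "\<And>i s. i \<in> N \<Longrightarrow> s \<in> cbox a b \<Longrightarrow> 0 \<le> g i s"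
  shows "(\<Sum>i\<in>N. al i * integral (cbox a b) (g i) powr P) powr (1/P)
       \<le> integral (cbox a b) (\<lambda>s. (\<Sum>i\<in>N. al i * g i s powr P) powr (1/P))" (is "?L \<le> ?R")
proof -
  define V where "V i = integral (cbox a b) (g i)" for i
  have V0: "V i \<ge> 0" if "i \<in> N" for i
    unfolding V_def using g0[OF that] by (auto intro: integral_nonneg integrable_continuous cont that)
  define S where "S = (\<Sum>i\<in>N. al i * V i powr P)"
  have S0: "S \<ge> 0" unfolding S_def using al by (auto intro: sum_nonneg)
  have contR: "continuous_on (cbox a b) (\<lambda>s. (\<Sum>i\<in>N. al i * g i s powr P) powr (1/P))"
    using \<open>P \<ge> 1\<close> al g0
    by (intro continuous_on_powr' continuous_on_sum continuous_on_mult continuous_on_const cont)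
       (auto intro: sum_nonneg)
  have R0: "?R \<ge> 0" by (intro integral_nonneg integrable_continuous contR) auto
  have Seq: "S = (\<Sum>i\<in>N. al i * V i powr (P - 1) * V i)"
    unfolding S_def using V0 by (intro sum.cong) (auto simp: powr_mult_base mult_ac)
  also have "\<dots> = (\<Sum>i\<in>N. integral (cbox a b) (\<lambda>s. al i * V i powr (P - 1) * g i s))"
    unfolding V_def by simp
  also have "\<dots> = integral (cbox a b) (\<lambda>s. \<Sum>i\<in>N. al i * V i powr (P - 1) * g i s)"
    using fin cont by (intro integral_sum[symmetric] integrable_continuous continuous_intros) auto
  also have "\<dots> \<le> integral (cbox a b) (\<lambda>s. S powr (1 - 1/P) * (\<Sum>i\<in>N. al i * g i s powr P) powr (1/P))"
  proof (rule integral_le)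
    show "(\<lambda>s. \<Sum>i\<in>N. al i * V i powr (P - 1) * g i s) integrable_on cbox a b"
      using cont by (intro integrable_continuous continuous_intros) auto
    show "(\<lambda>s. S powr (1 - 1/P) * (\<Sum>i\<in>N. al i * g i s powr P) powr (1/P)) integrable_on cbox a b"
      by (intro integrable_continuous continuous_intros contR)
    fix s assume s: "s \<in> cbox a b"
    show "(\<Sum>i\<in>N. al i * V i powr (P - 1) * g i s)
        \<le> S powr (1 - 1/P) * (\<Sum>i\<in>N. al i * g i s powr P) powr (1/P)"
    \<comment> \<open>For P = 1 the conjugate exponent is infinite, and a factor with exponent 0 is
      1 or 0 according as its base is positive or 0; when S vanishes, so does every term on the
      left.\<close>
    proof (cases "P = 1")
      case True
      have eq: "(\<Sum>i\<in>N. al i * V i powr (P - 1) * g i s) \<le> (\<Sum>i\<in>N. al i * g i s)"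
        using al g0[OF _ s] True by (intro sum_mono mult_right_mono) (auto simp: mult_left_le)
      show ?thesis
      proof (cases "S = 0")
        case False
        have "(\<Sum>i\<in>N. al i * g i s powr P) = (\<Sum>i\<in>N. al i * g i s)"
          using True g0[OF _ s] by (intro sum.cong) auto
        moreover have "0 \<le> (\<Sum>i\<in>N. al i * g i s)" using al g0[OF _ s] by (auto intro: sum_nonneg)
        ultimately show ?thesis using eq True False S0 by simp
      next
        case S: True
        have "al i * V i powr (P - 1) * g i s = 0" if "i \<in> N" for i
        proof -
          have "al i * V i powr P = 0"
            using S fin al that unfolding S_def by (subst (asm) sum_nonneg_eq_0_iff) auto
          then show ?thesis using True V0[OF that] by auto
        qed
        then have "(\<Sum>i\<in>N. al i * V i powr (P - 1) * g i s) = 0" by (rule sum.neutral[OF ballI])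
        then show ?thesis by simp
      qed
    next
      case False
      with \<open>P \<ge> 1\<close> have P: "P > 1" by auto
      define Q where "Q = P / (P - 1)"
      have PQ: "1/P + 1/Q = 1" using P by (simp add: Q_def field_simps)
      have Q0: "Q > 0" using P by (simp add: Q_def)
      have "(\<Sum>i\<in>N. al i * V i powr (P - 1) * g i s)
          = (\<Sum>i\<in>N. (al i powr (1/P) * g i s) * (al i powr (1/Q) * V i powr (P - 1)))"
      proof (rule sum.cong)
        fix i assume "i \<in> N"
        have "al i = al i powr (1/P + 1/Q)" using al[OF \<open>i \<in> N\<close>] PQ by simp
        also have "\<dots> = al i powr (1/P) * al i powr (1/Q)" by (simp add: powr_add)
        finally show "al i * V i powr (P - 1) * g i s
           = (al i powr (1/P) * g i s) * (al i powr (1/Q) * V i powr (P - 1))" by (simp add: mult_ac)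
      qed simp
      also have "\<dots> \<le> (\<Sum>i\<in>N. (al i powr (1/P) * g i s) powr P) powr (1/P)
                    * (\<Sum>i\<in>N. (al i powr (1/Q) * V i powr (P - 1)) powr Q) powr (1/Q)"
        using P PQ fin g0[OF _ s] by (intro Holder_sum) auto
      also have "(\<Sum>i\<in>N. (al i powr (1/P) * g i s) powr P) = (\<Sum>i\<in>N. al i * g i s powr P)"
        using P al g0[OF _ s] by (intro sum.cong) (auto simp: powr_mult powr_powr)
      also have "(\<Sum>i\<in>N. (al i powr (1/Q) * V i powr (P - 1)) powr Q) = S"
        unfolding S_def using P Q0 al by (intro sum.cong) (auto simp: powr_mult powr_powr Q_def)
      also have "1/Q = 1 - 1/P" using PQ by simp
      finally show ?thesis by (simp add: mult.commute)
    qed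
  qed
  also have "\<dots> = S powr (1 - 1/P) * ?R" by simp
  finally have main: "S \<le> S powr (1 - 1/P) * ?R" .
  show ?thesis
  proof (cases "S = 0")
    case True
    then show ?thesis using R0 by (simp add: S_def V_def)
  next
    case False
    with S0 have Sp: "S > 0" by simp
    have "S = S powr (1 - 1/P) * S powr (1/P)" using Sp by (simp add: powr_add[symmetric])
    with main have "S powr (1 - 1/P) * S powr (1/P) \<le> S powr (1 - 1/P) * ?R" by simp
    then have "S powr (1/P) \<le> ?R" using Sp by simp
    then show ?thesis by (simp add: S_def V_def)
  qed
qed

section \<open>Random signs and Khintchine's inequality\<close>

text \<open>A sign pattern is coded by the set A of indices with sign +1, so that the expectation
  over independent signs on N is the sum over \<open>Pow N\<close> divided by 2^card N.\<close>

definition rsign :: "'i set \<Rightarrow> 'i \<Rightarrow> real" where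
  "rsign A i = (if i \<in> A then 1 else -1)"

lemma sum_Pow_insert:
  fixes f :: "'i set \<Rightarrow> 'b::comm_monoid_add"
  assumes "finite N" "a \<notin> N"
  shows "(\<Sum>A\<in>Pow (insert a N). f A) = (\<Sum>A\<in>Pow N. f A + f (insert a A))"
proof -
  have "inj_on (insert a) (Pow N)" using assms(2) by (intro inj_onI) (metis PowD insert_ident subsetD)
  then have "(\<Sum>A\<in>insert a ` Pow N. f A) = (\<Sum>A\<in>Pow N. f (insert a A))"
    by (simp add: sum.reindex)
  moreover have "(\<Sum>A\<in>Pow (insert a N). f A) = (\<Sum>A\<in>Pow N. f A) + (\<Sum>A\<in>insert a ` Pow N. f A)"
    unfolding Pow_insert using assms by (intro sum.union_disjoint) auto
  ultimately show ?thesis by (simp add: sum.distrib)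
qed

lemma rsign_sum_insert:
  fixes x :: "'i \<Rightarrow> 'b::real_vector"
  assumes "finite N" "a \<notin> N" "A \<subseteq> N"
  shows "(\<Sum>i\<in>insert a N. rsign A i *\<^sub>R x i) = (\<Sum>i\<in>N. rsign A i *\<^sub>R x i) - x a"
    and "(\<Sum>i\<in>insert a N. rsign (insert a A) i *\<^sub>R x i) = (\<Sum>i\<in>N. rsign A i *\<^sub>R x i) + x a"
proof -
  have "(\<Sum>i\<in>N. rsign (insert a A) i *\<^sub>R x i) = (\<Sum>i\<in>N. rsign A i *\<^sub>R x i)"
    using assms by (intro sum.cong) (auto simp: rsign_def)
  moreover have "rsign A a = -1" "rsign (insert a A) a = 1" using assms by (auto simp: rsign_def)
  ultimately show "(\<Sum>i\<in>insert a N. rsign A i *\<^sub>R x i) = (\<Sum>i\<in>N. rsign A i *\<^sub>R x i) - x a"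
    "(\<Sum>i\<in>insert a N. rsign (insert a A) i *\<^sub>R x i) = (\<Sum>i\<in>N. rsign A i *\<^sub>R x i) + x a"
    using assms(1,2) by auto
qed

text \<open>Orthogonality of independent signs: each new index pairs the patterns with and without
  it, and the parallelogram law removes the cross terms.\<close>

lemma rsign_second_moment:
  fixes x :: "'i \<Rightarrow> complex"
  assumes "finite N"
  shows "(\<Sum>A\<in>Pow N. (cmod (\<Sum>i\<in>N. rsign A i *\<^sub>R x i))\<^sup>2) = 2 ^ card N * (\<Sum>i\<in>N. (cmod (x i))\<^sup>2)"
  using assms
proof (induction N rule: finite_induct)
  case (insert a N)
  have "(\<Sum>A\<in>Pow (insert a N). (cmod (\<Sum>i\<in>insert a N. rsign A i *\<^sub>R x i))\<^sup>2)
      = (\<Sum>A\<in>Pow N. 2 * (cmod (\<Sum>i\<in>N. rsign A i *\<^sub>R x i))\<^sup>2 + 2 * (cmod (x a))\<^sup>2)"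
    unfolding sum_Pow_insert[OF insert.hyps]
  proof (rule sum.cong)
    fix A assume "A \<in> Pow N"
    have par: "(cmod (u - v))\<^sup>2 + (cmod (u + v))\<^sup>2 = 2 * (cmod u)\<^sup>2 + 2 * (cmod v)\<^sup>2" for u v
      unfolding cmod_power2 by (simp add: algebra_simps power2_eq_square)
    from \<open>A \<in> Pow N\<close> have "A \<subseteq> N" by simp
    then show "(cmod (\<Sum>i\<in>insert a N. rsign A i *\<^sub>R x i))\<^sup>2
        + (cmod (\<Sum>i\<in>insert a N. rsign (insert a A) i *\<^sub>R x i))\<^sup>2
        = 2 * (cmod (\<Sum>i\<in>N. rsign A i *\<^sub>R x i))\<^sup>2 + 2 * (cmod (x a))\<^sup>2"
      by (simp only: rsign_sum_insert[OF insert.hyps] par)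
  qed simp
  also have "\<dots> = 2 * (2 ^ card N * (\<Sum>i\<in>N. (cmod (x i))\<^sup>2)) + 2 ^ card N * (2 * (cmod (x a))\<^sup>2)"
    using insert by (simp add: sum.distrib sum_distrib_left[symmetric] card_Pow)
  finally show ?case using insert by (simp add: algebra_simps)
qed simp

text \<open>The bound on cosh behind subgaussian moments. With y^2 rather than y^2/2 in the exponent
  the estimates exp y <= 1 + y + y^2 and exp (- y) <= 1 - y + y^2 on [0, 1] are enough.\<close>

lemma exp_sum_neg_le:
  fixes y :: real
  assumes "\<bar>y\<bar> \<le> 1"
  shows "exp y + exp (- y) \<le> 2 * exp (y\<^sup>2)"
proof -
  have *: "exp y + exp (- y) \<le> 2 * exp (y\<^sup>2)" if "0 \<le> y" "y \<le> 1" for y :: real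
  proof -
    have "exp y \<le> 1 + y + y\<^sup>2" using that by (intro exp_bound) auto
    moreover have "exp (- y) \<le> 1 - y + y\<^sup>2"
    proof -
      \<comment> \<open>The product is 1 + y^3.\<close>
      have "1 \<le> (1 - y + y\<^sup>2) * (1 + y)" using that by (simp add: algebra_simps power2_eq_square)
      also have "\<dots> \<le> (1 - y + y\<^sup>2) * exp y"
        using that by (intro mult_left_mono) (auto simp: power2_eq_square)
      finally show ?thesis by (simp add: exp_minus field_simps)
    qed
    moreover have "1 + y\<^sup>2 \<le> exp (y\<^sup>2)" by simp
    ultimately show ?thesis by linarith
  qed
  show ?thesis using *[of y] *[of "- y"] assms by (cases "y \<ge> 0") auto
qed

text \<open>The exponential moment of a signed sum factors over the indices: a new index a
  multiplies it by exp (y a) + exp (- y a).\<close>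

lemma rsign_exp_moment:
  fixes y :: "'i \<Rightarrow> real"
  assumes "finite N" "\<And>i. i \<in> N \<Longrightarrow> \<bar>y i\<bar> \<le> 1"
  shows "(\<Sum>A\<in>Pow N. exp (\<Sum>i\<in>N. rsign A i *\<^sub>R y i)) \<le> 2 ^ card N * exp (\<Sum>i\<in>N. (y i)\<^sup>2)"
  using assms
proof (induction N rule: finite_induct)
  case (insert a N)
  have "(\<Sum>A\<in>Pow (insert a N). exp (\<Sum>i\<in>insert a N. rsign A i *\<^sub>R y i))
      = (\<Sum>A\<in>Pow N. exp (\<Sum>i\<in>N. rsign A i *\<^sub>R y i) * (exp (y a) + exp (- y a)))"
    unfolding sum_Pow_insert[OF insert.hyps(1,2)]
  proof (rule sum.cong)
    fix A assume "A \<in> Pow N"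
    then have "A \<subseteq> N" by simp
    then show "exp (\<Sum>i\<in>insert a N. rsign A i *\<^sub>R y i) + exp (\<Sum>i\<in>insert a N. rsign (insert a A) i *\<^sub>R y i)
        = exp (\<Sum>i\<in>N. rsign A i *\<^sub>R y i) * (exp (y a) + exp (- y a))"
      by (simp only: rsign_sum_insert[OF insert.hyps(1,2)] exp_add exp_diff)
         (simp add: exp_minus field_simps)
  qed simp
  also have "\<dots> = (\<Sum>A\<in>Pow N. exp (\<Sum>i\<in>N. rsign A i *\<^sub>R y i)) * (exp (y a) + exp (- y a))"
    by (simp add: sum_distrib_right)
  also have "\<dots> \<le> (2 ^ card N * exp (\<Sum>i\<in>N. (y i)\<^sup>2)) * (2 * exp ((y a)\<^sup>2))"
    using insert by (intro mult_mono insert.IH exp_sum_neg_le) auto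
  finally show ?case using insert by (simp add: exp_add mult_ac)
qed simp

lemma powr_le_exp:
  fixes x :: real
  assumes "r > 0" "x \<ge> 0"
  shows "x powr r \<le> r powr r * exp x"
proof -
  have "x / r \<le> exp (x / r)" using exp_ge_add_one_self[of "x/r"] by linarith
  then have "(x / r) powr r \<le> exp (x / r) powr r" using assms by (intro powr_mono2) auto
  then show ?thesis using assms by (simp add: powr_divide exp_powr_real field_simps)
qed

text \<open>Origin of the factors: 4 for the real exponentials that replace the exponential of a
  complex modulus, exp 1 for the bound on their moments, r^r for passing from a power to an
  exponential, and 2^r for the normalisation to norm 1/2.\<close>

definition Khintchine_const :: "real \<Rightarrow> real" where
  "Khintchine_const r = 4 * exp 1 * (2 * r) powr r"

lemma Khintchine_const_pos: "r > 0 \<Longrightarrow> Khintchine_const r > 0"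
  by (simp add: Khintchine_const_def)

text \<open>Power moments from exponential moments, by x^r <= r^r exp x. The exponential of the
  modulus of a complex sum is split, via |X| <= |Re X| + |Im X|, into four exponentials of real
  signed sums.\<close>

lemma Khintchine_upper:
  fixes x :: "'i \<Rightarrow> complex"
  assumes fin: "finite N" and r: "r > 0"
  shows "(\<Sum>A\<in>Pow N. cmod (\<Sum>i\<in>N. rsign A i *\<^sub>R x i) powr r)
      \<le> 2 ^ card N * Khintchine_const r * (\<Sum>i\<in>N. (cmod (x i))\<^sup>2) powr (r/2)"
proof (cases "(\<Sum>i\<in>N. (cmod (x i))\<^sup>2) = 0")
  case True
  then have "x i = 0" if "i \<in> N" for i using that fin by (subst (asm) sum_nonneg_eq_0_iff) auto
  then show ?thesis using True by simp
next
  case False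
  define s where "s = sqrt (\<Sum>i\<in>N. (cmod (x i))\<^sup>2)"
  have s2: "s\<^sup>2 = (\<Sum>i\<in>N. (cmod (x i))\<^sup>2)" unfolding s_def by (simp add: sum_nonneg)
  have s: "s > 0" unfolding s_def using False
    by (metis (mono_tags, lifting) real_sqrt_gt_zero antisym_conv2 sum_nonneg zero_le_power2)
  \<comment> \<open>Norm 1/2 rather than 1: the doubled real and imaginary parts are then at most 1
    in modulus, as the exponential moment bound demands, and their squares have sum at most
    1.\<close>
  define y where "y i = x i /\<^sub>R (2 * s)" for i
  have y2: "(\<Sum>i\<in>N. (cmod (y i))\<^sup>2) = 1/4"
  proof -
    have "(\<Sum>i\<in>N. (cmod (y i))\<^sup>2) = (\<Sum>i\<in>N. (cmod (x i))\<^sup>2) / (2 * s)\<^sup>2"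
    proof -
      have "cmod (y i) = cmod (x i) / (2 * s)" for i
        using s by (simp add: y_def field_simps)
      then have "(cmod (y i))\<^sup>2 = (cmod (x i))\<^sup>2 / (2 * s)\<^sup>2" for i by (simp only: power_divide)
      then show ?thesis by (simp only: sum_divide_distrib)
    qed
    also have "\<dots> = 1/4" using s by (simp add: s2[symmetric] power_mult_distrib)
    finally show ?thesis .
  qed
  have yb: "cmod (y i) \<le> 1/2" if "i \<in> N" for i
  proof -
    have "(cmod (y i))\<^sup>2 \<le> (\<Sum>i\<in>N. (cmod (y i))\<^sup>2)" using that fin by (intro member_le_sum) auto
    then have "(cmod (y i))\<^sup>2 \<le> (1/2)\<^sup>2" unfolding y2 by (simp add: power_divide)
    then show ?thesis by (rule power2_le_imp_le) simp
  qed
  have E: "(\<Sum>A\<in>Pow N. exp (\<Sum>i\<in>N. rsign A i *\<^sub>R z i)) \<le> 2 ^ card N * exp 1"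
    if z: "\<And>i. i \<in> N \<Longrightarrow> \<bar>z i\<bar> \<le> 2 * cmod (y i)" for z
  proof -
    have "(\<Sum>A\<in>Pow N. exp (\<Sum>i\<in>N. rsign A i *\<^sub>R z i)) \<le> 2 ^ card N * exp (\<Sum>i\<in>N. (z i)\<^sup>2)"
      using z yb by (intro rsign_exp_moment fin) fastforce
    moreover have "(\<Sum>i\<in>N. (z i)\<^sup>2) \<le> (\<Sum>i\<in>N. 4 * (cmod (y i))\<^sup>2)"
    proof (rule sum_mono)
      fix i assume "i \<in> N"
      from z[OF this] have "\<bar>z i\<bar>\<^sup>2 \<le> (2 * cmod (y i))\<^sup>2" by (intro power_mono) auto
      then show "(z i)\<^sup>2 \<le> 4 * (cmod (y i))\<^sup>2" by (simp add: power_mult_distrib)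
    qed
    then have "(\<Sum>i\<in>N. (z i)\<^sup>2) \<le> 1" using y2 by (simp add: sum_distrib_left[symmetric])
    then have "2 ^ card N * exp (\<Sum>i\<in>N. (z i)\<^sup>2) \<le> 2 ^ card N * exp (1::real)" by simp
    ultimately show ?thesis by linarith
  qed
  define X where "X A = (\<Sum>i\<in>N. rsign A i *\<^sub>R y i)" for A
  have pw: "cmod (X A) powr r \<le> r powr r * (exp (\<Sum>i\<in>N. rsign A i *\<^sub>R (2 * Re (y i)))
      + exp (\<Sum>i\<in>N. rsign A i *\<^sub>R (- 2 * Re (y i))) + exp (\<Sum>i\<in>N. rsign A i *\<^sub>R (2 * Im (y i)))
      + exp (\<Sum>i\<in>N. rsign A i *\<^sub>R (- 2 * Im (y i))))" for A
  proof -
    have 1: "(\<Sum>i\<in>N. rsign A i *\<^sub>R (2 * Re (y i))) = 2 * Re (X A)"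
      "(\<Sum>i\<in>N. rsign A i *\<^sub>R (- 2 * Re (y i))) = - 2 * Re (X A)"
      "(\<Sum>i\<in>N. rsign A i *\<^sub>R (2 * Im (y i))) = 2 * Im (X A)"
      "(\<Sum>i\<in>N. rsign A i *\<^sub>R (- 2 * Im (y i))) = - 2 * Im (X A)"
      unfolding X_def by (simp_all add: sum_distrib_left mult_ac sum_negf)
    \<comment> \<open>The sum is at most twice the larger of |u| and |v|, whose exponential is one
      of the four positive terms on the right.\<close>
    have ab: "exp (\<bar>u\<bar> + \<bar>v\<bar>) \<le> exp (2 * u) + exp (-2 * u) + exp (2 * v) + exp (-2 * v)" for u v :: real
    proof -
      have "2 * max \<bar>u\<bar> \<bar>v\<bar> \<in> {2 * u, -2 * u, 2 * v, -2 * v}"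
        by (auto simp: max_def abs_if)
      then have "exp (2 * max \<bar>u\<bar> \<bar>v\<bar>) \<in> {exp (2 * u), exp (-2 * u), exp (2 * v), exp (-2 * v)}" by blast
      moreover have "e \<le> a + b + c + d" if "e \<in> {a, b, c, d}" "a > 0" "b > 0" "c > 0" "d > 0"
        for a b c d e :: real using that by auto
      ultimately have "exp (2 * max \<bar>u\<bar> \<bar>v\<bar>) \<le> exp (2 * u) + exp (-2 * u) + exp (2 * v) + exp (-2 * v)"
        using exp_gt_zero by blast
      moreover have "exp (\<bar>u\<bar> + \<bar>v\<bar>) \<le> exp (2 * max \<bar>u\<bar> \<bar>v\<bar>)" by simp
      ultimately show ?thesis by linarith
    qed
    have "cmod (X A) powr r \<le> r powr r * exp (cmod (X A))" using r by (intro powr_le_exp) auto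
    also have "\<dots> \<le> r powr r * exp (\<bar>Re (X A)\<bar> + \<bar>Im (X A)\<bar>)"
      using cmod_le[of "X A"] by (intro mult_left_mono) auto
    also have "\<dots> \<le> r powr r * (exp (2 * Re (X A)) + exp (- 2 * Re (X A)) + exp (2 * Im (X A)) + exp (- 2 * Im (X A)))"
      using ab by (intro mult_left_mono) auto
    finally show ?thesis unfolding 1 .
  qed
  have le: "\<bar>2 * Re (y i)\<bar> \<le> 2 * cmod (y i)" "\<bar>2 * Im (y i)\<bar> \<le> 2 * cmod (y i)" for i
    using abs_Re_le_cmod[of "y i"] abs_Im_le_cmod[of "y i"] by linarith+
  have "(\<Sum>A\<in>Pow N. cmod (X A) powr r) \<le> (\<Sum>A\<in>Pow N. r powr r * (exp (\<Sum>i\<in>N. rsign A i *\<^sub>R (2 * Re (y i)))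
      + exp (\<Sum>i\<in>N. rsign A i *\<^sub>R (- 2 * Re (y i))) + exp (\<Sum>i\<in>N. rsign A i *\<^sub>R (2 * Im (y i)))
      + exp (\<Sum>i\<in>N. rsign A i *\<^sub>R (- 2 * Im (y i)))))"
    by (rule sum_mono) (rule pw)
  also have "\<dots> \<le> r powr r * (2 ^ card N * exp 1 + 2 ^ card N * exp 1 + 2 ^ card N * exp 1 + 2 ^ card N * exp 1)"
    unfolding sum_distrib_left[symmetric] sum.distrib
    using le by (intro mult_left_mono add_mono E) auto
  finally have XX: "(\<Sum>A\<in>Pow N. cmod (X A) powr r) \<le> 2 ^ card N * 4 * exp 1 * r powr r"
    by (simp add: mult_ac)
  have "cmod (\<Sum>i\<in>N. rsign A i *\<^sub>R x i) = 2 * s * cmod (X A)" for A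
  proof -
    have "(\<Sum>i\<in>N. rsign A i *\<^sub>R x i) = (2 * s) *\<^sub>R X A"
      unfolding X_def y_def scaleR_sum_right using s by (intro sum.cong) auto
    then show ?thesis using s by simp
  qed
  then have "(\<Sum>A\<in>Pow N. cmod (\<Sum>i\<in>N. rsign A i *\<^sub>R x i) powr r)
      = (2 * s) powr r * (\<Sum>A\<in>Pow N. cmod (X A) powr r)"
    using s by (simp add: powr_mult sum_distrib_left)
  also have "\<dots> \<le> (2 * s) powr r * (2 ^ card N * 4 * exp 1 * r powr r)"
    using XX by (intro mult_left_mono) auto
  also have "\<dots> = 2 ^ card N * Khintchine_const r * s powr r"
    using s r by (simp add: Khintchine_const_def powr_mult mult_ac)
  also have "s powr r = (\<Sum>i\<in>N. (cmod (x i))\<^sup>2) powr (r/2)"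
    unfolding s2[symmetric] using s by (simp add: powr_powr flip: powr_numeral)
  finally show ?thesis .
qed

definition Khintchine_lower_const :: real where
  "Khintchine_lower_const = 1 / (2 * sqrt (2 * Khintchine_const 4))"

lemma Khintchine_lower_const_pos: "Khintchine_lower_const > 0"
  using Khintchine_const_pos[of 4] by (simp add: Khintchine_lower_const_def)

text \<open>The second moment is known exactly and the fourth is bounded above by Khintchine's
  inequality with exponent 4; together they prevent the first moment from being small.\<close>

lemma Khintchine_lower:
  fixes x :: "'i \<Rightarrow> complex"
  assumes fin: "finite N"
  shows "Khintchine_lower_const * sqrt (\<Sum>i\<in>N. (cmod (x i))\<^sup>2)
      \<le> (\<Sum>A\<in>Pow N. cmod (\<Sum>i\<in>N. rsign A i *\<^sub>R x i)) / 2 ^ card N"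
proof (cases "(\<Sum>i\<in>N. (cmod (x i))\<^sup>2) = 0")
  case True
  then show ?thesis by (simp add: sum_nonneg)
next
  case False
  define K where "K = Khintchine_const 4"
  have K: "K > 0" unfolding K_def by (rule Khintchine_const_pos) simp
  define s where "s = sqrt (\<Sum>i\<in>N. (cmod (x i))\<^sup>2)"
  have s2: "s\<^sup>2 = (\<Sum>i\<in>N. (cmod (x i))\<^sup>2)" unfolding s_def by (simp add: sum_nonneg)
  have s: "s > 0" unfolding s_def using False
    by (metis (mono_tags, lifting) real_sqrt_gt_zero antisym_conv2 sum_nonneg zero_le_power2)
  \<comment> \<open>With t^2 = 2 K s^2 the fourth moment contributes K s^4 / t^2 = s^2 / 2 per
    pattern, half of the second moment; the other half is left for the first moment.\<close>
  define t where "t = sqrt (2 * K) * s"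
  have t: "t > 0" unfolding t_def using s K by simp
  have t2: "t\<^sup>2 = 2 * K * s\<^sup>2" unfolding t_def using K by (simp add: power_mult_distrib)
  define X where "X A = cmod (\<Sum>i\<in>N. rsign A i *\<^sub>R x i)" for A
  have X0: "X A \<ge> 0" for A by (simp add: X_def)
  have X2: "(\<Sum>A\<in>Pow N. (X A)\<^sup>2) = 2 ^ card N * s\<^sup>2"
    unfolding X_def s2 by (rule rsign_second_moment[OF fin])
  have "(\<Sum>A\<in>Pow N. X A powr 4) \<le> 2 ^ card N * K * (s\<^sup>2) powr (4/2)"
    unfolding X_def s2 K_def by (rule Khintchine_upper[OF fin]) simp
  also have "(s\<^sup>2) powr (4/2) = s ^ 4" using s by simp
  finally have X4: "(\<Sum>A\<in>Pow N. (X A) ^ 4) \<le> 2 ^ card N * K * s ^ 4"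
    using X0 by simp
  \<comment> \<open>replaces the interpolation of the second moment between the first and the fourth\<close>
  have pw: "(X A)\<^sup>2 \<le> t * X A + (X A) ^ 4 / t\<^sup>2" for A
  proof (cases "X A \<le> t")
    case True
    then have "(X A)\<^sup>2 \<le> t * X A" using X0[of A] by (simp add: power2_eq_square mult_right_mono)
    then show ?thesis using t by (simp add: add_increasing2)
  next
    case False
    then have "(X A)\<^sup>2 * t\<^sup>2 \<le> (X A)\<^sup>2 * (X A)\<^sup>2" using t by (intro mult_left_mono power_mono) auto
    then have "(X A)\<^sup>2 \<le> (X A) ^ 4 / t\<^sup>2" using t by (simp add: field_simps flip: power_add)
    then show ?thesis using t X0[of A] by (simp add: add_increasing)
  qed
  have "2 ^ card N * s\<^sup>2 \<le> (\<Sum>A\<in>Pow N. t * X A + (X A) ^ 4 / t\<^sup>2)"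
    unfolding X2[symmetric] by (rule sum_mono) (rule pw)
  also have "\<dots> = t * (\<Sum>A\<in>Pow N. X A) + (\<Sum>A\<in>Pow N. (X A) ^ 4) / t\<^sup>2"
    by (simp add: sum.distrib sum_distrib_left sum_divide_distrib)
  also have "\<dots> \<le> t * (\<Sum>A\<in>Pow N. X A) + (2 ^ card N * K * s ^ 4) / t\<^sup>2"
    using X4 by (intro add_left_mono divide_right_mono) auto
  also have "(2 ^ card N * K * s ^ 4) / t\<^sup>2 = 2 ^ card N * s\<^sup>2 / 2"
    unfolding t2 using K s by (simp add: field_simps power2_eq_square power4_eq_xxxx)
  finally have "2 ^ card N * s\<^sup>2 / 2 \<le> sqrt (2 * K) * s * (\<Sum>A\<in>Pow N. X A)" unfolding t_def by simp
  then have "s * (2 ^ card N * s / 2) \<le> s * (sqrt (2 * K) * (\<Sum>A\<in>Pow N. X A))"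
    by (simp add: power2_eq_square mult_ac)
  then have "2 ^ card N * s / 2 \<le> sqrt (2 * K) * (\<Sum>A\<in>Pow N. X A)" using s by simp
  then show ?thesis using K unfolding Khintchine_lower_const_def s_def X_def K_def by (simp add: field_simps)
qed

section \<open>Local estimates for entire functions\<close>

text \<open>
  The ball is found around a maximum of \<open>\<bar>g u\<bar> d(u)\<^sup>\<kappa>\<close>, \<open>d\<close> being the distance to the boundary:
  near such a point \<open>g\<close> is at most \<open>2\<^sup>\<kappa>\<close> times its value there, so Cauchy's estimate keeps it
  away from zero on a ball of radius proportional to \<open>d\<close>.
\<close>

lemma holomorphic_large_on_ball:
  fixes h k :: real
  assumes h: "h > 0" and k: "k > 0"
  obtains c where "c > 0"
    "\<And>g z. g holomorphic_on UNIV \<Longrightarrow>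
       \<exists>u \<rho>. 0 < \<rho> \<and> ball u \<rho> \<subseteq> ball z h \<and> (\<forall>v\<in>ball u \<rho>. c * cmod (g z) \<le> cmod (g v) * \<rho> powr k)"
proof -
  define L :: real where "L = 2 powr k"
  have L: "L \<ge> 1" unfolding L_def using k by (intro ge_one_powr_ge_zero) auto
  define c where "c = (h / (8 * L)) powr k / 2"
  have c: "c > 0" unfolding c_def using h L by simp
  have "\<exists>u \<rho>. 0 < \<rho> \<and> ball u \<rho> \<subseteq> ball z h \<and> (\<forall>v\<in>ball u \<rho>. c * cmod (g z) \<le> cmod (g v) * \<rho> powr k)"
    if g: "g holomorphic_on UNIV" for g z
  proof (cases "g z = 0")
    case True
    then show ?thesis using h by (intro exI[of _ z] exI[of _ h]) auto
  next
    case False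
    have contg: "continuous_on A g" for A
      using g holomorphic_on_imp_continuous_on continuous_on_subset by blast
    define q where "q u = cmod (g u) * (h - dist z u) powr k" for u
    have "continuous_on (cball z h) q"
      unfolding q_def using k by (intro continuous_intros continuous_on_powr' contg) auto
    then obtain u where u: "u \<in> cball z h" and umax: "\<And>v. v \<in> cball z h \<Longrightarrow> q v \<le> q u"
      using continuous_attains_sup[of "cball z h" q] h by auto
    have qz: "q z = cmod (g z) * h powr k" by (simp add: q_def)
    have "q u > 0" using umax[of z] False h by (simp add: qz less_le_trans[rotated])
    then have d0: "h - dist z u > 0" and gu: "cmod (g u) > 0"
      using u unfolding q_def by (auto simp: zero_less_mult_iff order_le_less)
    define d where "d = h - dist z u"
    have d: "d > 0" using d0 by (simp add: d_def)
    have bound: "cmod (g v) \<le> L * cmod (g u)" if v: "v \<in> ball u (d/2)" for v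
    proof -
      have dv: "d / 2 \<le> h - dist z v"
        using v dist_triangle[of z v u] by (auto simp: d_def)
      then have "v \<in> cball z h" using d by auto
      from umax[OF this] have "cmod (g v) * (h - dist z v) powr k \<le> cmod (g u) * d powr k"
        by (simp add: q_def d_def)
      moreover have "cmod (g v) * (d/2) powr k \<le> cmod (g v) * (h - dist z v) powr k"
        using dv d k by (intro mult_left_mono powr_mono2) auto
      ultimately have "cmod (g v) * (d/2) powr k \<le> cmod (g u) * d powr k" by linarith
      then show ?thesis using d by (simp add: powr_divide L_def field_simps)
    qed
    have deriv: "cmod (deriv g x) \<le> L * cmod (g u) / (d/4)" if x: "x \<in> ball u (d/4)" for x
    proof -
      have "cmod ((deriv ^^ 1) g x) \<le> fact 1 * (L * cmod (g u)) / (d/4) ^ 1"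
      proof (rule Cauchy_inequality)
        show "g holomorphic_on ball x (d/4)" using g holomorphic_on_subset by blast
        show "continuous_on (cball x (d/4)) g" by (rule contg)
        show "0 < d/4" using d by simp
        fix y assume "cmod (x - y) = d/4"
        then have "dist x y = d/4" by (simp add: dist_norm)
        then have "y \<in> ball u (d/2)" using x dist_triangle[of u y x] by auto
        then show "cmod (g y) \<le> L * cmod (g u)" by (rule bound)
      qed
      then show ?thesis by simp
    qed
    \<comment> \<open>The derivative is at most 4 L |g u| / d on the ball of radius d/4, so over a
      distance d / (8 L) the value of g moves by at most |g u| / 2.\<close>
    define \<rho> where "\<rho> = d / (8 * L)"
    have \<rho>: "\<rho> > 0" using d L by (simp add: \<rho>_def)
    have \<rho>d: "\<rho> \<le> d/4" unfolding \<rho>_def using d L by (simp add: field_simps)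
    have half: "cmod (g u) / 2 \<le> cmod (g v)" if v: "v \<in> ball u \<rho>" for v
    proof -
      have "cmod (g v - g u) \<le> L * cmod (g u) / (d/4) * cmod (v - u)"
      proof (rule field_differentiable_bound[where S = "ball u (d/4)"])
        show "(g has_field_derivative deriv g x) (at x within ball u (d/4))" if "x \<in> ball u (d/4)" for x
          using g by (meson UNIV_I has_field_derivative_at_within holomorphic_derivI open_UNIV)
      qed (use deriv v \<rho>d d in auto)
      also have "\<dots> \<le> L * cmod (g u) / (d/4) * \<rho>"
        using v L d by (intro mult_left_mono) (auto simp: dist_norm norm_minus_commute)
      also have "\<dots> = cmod (g u) / 2" unfolding \<rho>_def using d L by (simp add: field_simps)
      finally show ?thesis using norm_triangle_ineq2[of "g u" "g v"] by (simp add: norm_minus_commute)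
    qed
    have sub: "ball u \<rho> \<subseteq> ball z h"
    proof
      fix v assume "v \<in> ball u \<rho>"
      then have "dist u v < d/4" using \<rho>d by auto
      then show "v \<in> ball z h" using dist_triangle[of z v u] d by (auto simp: d_def)
    qed
    have "c * cmod (g z) \<le> cmod (g v) * \<rho> powr k" if v: "v \<in> ball u \<rho>" for v
    proof -
      have "c * cmod (g z) = cmod (g z) * h powr k / (8 * L) powr k / 2"
        unfolding c_def using h L by (simp add: powr_divide)
      also have "\<dots> \<le> cmod (g u) * d powr k / (8 * L) powr k / 2"
        using umax[of z] h unfolding qz by (intro divide_right_mono) (auto simp: q_def d_def)
      also have "\<dots> = (cmod (g u) / 2) * \<rho> powr k"
        unfolding \<rho>_def using d L by (simp add: powr_divide)
      also have "\<dots> \<le> cmod (g v) * \<rho> powr k" using half[OF v] by (intro mult_right_mono) auto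
      finally show ?thesis .
    qed
    then show ?thesis using sub \<rho> by blast
  qed
  then show ?thesis using c that by blast
qed

section \<open>Local bounds with respect to a general measure\<close>

definition gauss_mod :: "real \<Rightarrow> (complex \<Rightarrow> complex) \<Rightarrow> complex \<Rightarrow> real" where
  "gauss_mod \<alpha> f z = cmod (f z) * exp (- (\<alpha> / 2) * (cmod z)\<^sup>2)"

lemma gauss_mod_nonneg [simp]: "0 \<le> gauss_mod \<alpha> f z"
  by (simp add: gauss_mod_def)

lemma gauss_mod_powr: "p > 0 \<Longrightarrow> cmod (f z) powr p * exp (- (p * \<alpha> / 2) * (cmod z)\<^sup>2) = gauss_mod \<alpha> f z powr p"
  by (simp add: gauss_mod_def powr_mult exp_powr_real mult_ac)

lemma continuous_on_gauss_mod:
  assumes "f holomorphic_on UNIV"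
  shows "continuous_on A (gauss_mod \<alpha> f)"
  unfolding gauss_mod_def using assms
  by (intro continuous_intros continuous_on_subset[OF holomorphic_on_imp_continuous_on]) auto

text \<open>For the weighted measure V is the mass of the cell containing z. Lebesgue measure
  satisfies the condition with c0 = 1, \<theta> = 2 and V = 1, so one local bound serves
  both.\<close>

definition ball_lower :: "complex measure \<Rightarrow> real \<Rightarrow> real \<Rightarrow> real \<Rightarrow> complex \<Rightarrow> real \<Rightarrow> bool" where
  "ball_lower m c0 \<theta> h z V \<longleftrightarrow>
     (\<forall>u \<rho>. 0 < \<rho> \<longrightarrow> ball u \<rho> \<subseteq> ball z h \<longrightarrow> ennreal (c0 * \<rho> powr \<theta> * V) \<le> emeasure m (ball u \<rho>))"

text \<open>The integral is taken over the disc on which f is large, not over the whole of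
  \<open>ball z h\<close>. That disc has mass at least c0 \<rho>^\<theta> V, and with k = \<theta> /
  s the s-th power of |f| on it exceeds a multiple of \<rho>^(-\<theta>) times the value at z, so
  the unknown radius drops out. The constant depends neither on the measure nor on the
  point.\<close>

lemma gauss_mod_local_bound:
  fixes \<alpha> h s \<theta> c0 :: real
  assumes "\<alpha> \<ge> 0" and h: "h > 0" and s: "s > 0" and \<theta>: "\<theta> > 0" and c0: "c0 > 0"
  shows "\<exists>C>0. \<forall>f z m V. f holomorphic_on UNIV \<longrightarrow> sets m = sets lebesgue \<longrightarrow> V \<ge> 0 \<longrightarrow>
       ball_lower m c0 \<theta> h z V \<longrightarrow>
       ennreal (gauss_mod \<alpha> f z powr s * V) \<le> ennreal C * (\<integral>\<^sup>+v\<in>ball z h. ennreal (gauss_mod \<alpha> f v powr s) \<partial>m)"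
proof -
  obtain c where c: "c > 0" and core: "\<And>g z. g holomorphic_on UNIV \<Longrightarrow>
       \<exists>u \<rho>. 0 < \<rho> \<and> ball u \<rho> \<subseteq> ball z h \<and>
         (\<forall>v\<in>ball u \<rho>. c * cmod (g z) \<le> cmod (g v) * \<rho> powr (\<theta> / s))"
    using holomorphic_large_on_ball[OF h, of "\<theta> / s"] \<theta> s by auto
  define E where "E = exp (\<alpha> * h\<^sup>2 / 2)"
  have E: "E > 0" by (simp add: E_def)
  define C where "C = 1 / (c0 * (c / E) powr s)"
  have C: "C > 0" unfolding C_def using c0 c E by simp
  have "ennreal (gauss_mod \<alpha> f z powr s * V) \<le> ennreal C * (\<integral>\<^sup>+v\<in>ball z h. ennreal (gauss_mod \<alpha> f v powr s) \<partial>m)"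
    if f: "f holomorphic_on UNIV" and m: "sets m = sets lebesgue" and V: "V \<ge> 0"
      and bl: "ball_lower m c0 \<theta> h z V"
    for f z m V
  proof -
    \<comment> \<open>A zero-free entire factor recentres the Gaussian at z: |g v| is
      \<open>gauss_mod \<alpha> f v\<close> times exp (\<alpha>/2 |v - z|^2), hence equal to
      \<open>gauss_mod \<alpha> f z\<close> at z and at most E times the Gaussian modulus on
      \<open>ball z h\<close>.\<close>
    define g :: "complex \<Rightarrow> complex" where "g u = f u * exp (- of_real \<alpha> * u * cnj z + of_real (\<alpha> * (cmod z)\<^sup>2 / 2))" for u
    have "g holomorphic_on UNIV" unfolding g_def using f by (intro holomorphic_intros)
    from core[OF this, of z] obtain u \<rho> where \<rho>: "0 < \<rho>" and sub: "ball u \<rho> \<subseteq> ball z h"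
      and lg: "\<And>v. v \<in> ball u \<rho> \<Longrightarrow> c * cmod (g z) \<le> cmod (g v) * \<rho> powr (\<theta> / s)" by blast
    have mg: "cmod (g v) = gauss_mod \<alpha> f v * exp (\<alpha> / 2 * (cmod (v - z))\<^sup>2)" for v
    proof -
      have "(cmod (v - z))\<^sup>2 = (cmod v)\<^sup>2 - 2 * Re (v * cnj z) + (cmod z)\<^sup>2"
        unfolding cmod_power2 by (simp add: power2_eq_square algebra_simps)
      then have "- \<alpha> * Re (v * cnj z) + \<alpha> * (cmod z)\<^sup>2 / 2 = - (\<alpha> / 2) * (cmod v)\<^sup>2 + \<alpha> / 2 * (cmod (v - z))\<^sup>2"
      proof -
        have "- \<alpha> * x + \<alpha> * c / 2 = - (\<alpha> / 2) * b + \<alpha> / 2 * d" if "d = b - 2 * x + c" for b c d x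
          unfolding that by (simp add: algebra_simps)
        then show ?thesis using \<open>(cmod (v - z))\<^sup>2 = _\<close> by blast
      qed
      moreover have "cmod (g v) = cmod (f v) * exp (- \<alpha> * Re (v * cnj z) + \<alpha> * (cmod z)\<^sup>2 / 2)"
        by (simp add: g_def norm_mult mult.assoc)
      ultimately show ?thesis
        by (simp only: gauss_mod_def exp_add mult.assoc)
    qed
    have pt: "c / E * gauss_mod \<alpha> f z \<le> gauss_mod \<alpha> f v * \<rho> powr (\<theta> / s)" if v: "v \<in> ball u \<rho>" for v
    proof -
      have "cmod (v - z) \<le> h" using v sub by (auto simp: dist_norm norm_minus_commute subset_iff)
      then have "(cmod (v - z))\<^sup>2 \<le> h\<^sup>2" by (intro power_mono) auto
      then have "\<alpha> / 2 * (cmod (v - z))\<^sup>2 \<le> \<alpha> / 2 * h\<^sup>2" using \<open>\<alpha> \<ge> 0\<close> by (intro mult_left_mono) auto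
      then have "cmod (g v) \<le> gauss_mod \<alpha> f v * E"
        unfolding mg E_def by (intro mult_left_mono) auto
      then have "cmod (g v) * \<rho> powr (\<theta> / s) \<le> gauss_mod \<alpha> f v * E * \<rho> powr (\<theta> / s)"
        by (intro mult_right_mono) auto
      moreover have "c * gauss_mod \<alpha> f z \<le> cmod (g v) * \<rho> powr (\<theta> / s)"
        using lg[OF v] by (simp add: mg[of z])
      ultimately have "c * gauss_mod \<alpha> f z \<le> gauss_mod \<alpha> f v * E * \<rho> powr (\<theta> / s)" by linarith
      then show ?thesis using E by (simp add: field_simps)
    qed
    have pw: "(c / E) powr s * gauss_mod \<alpha> f z powr s * \<rho> powr (- \<theta>) \<le> gauss_mod \<alpha> f v powr s" if "v \<in> ball u \<rho>" for v
    proof -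
      have "(c / E) powr s * gauss_mod \<alpha> f z powr s = (c / E * gauss_mod \<alpha> f z) powr s"
        using c E by (simp only: powr_mult)
      also have "\<dots> \<le> (gauss_mod \<alpha> f v * \<rho> powr (\<theta> / s)) powr s"
        using pt[OF that] c E s by (intro powr_mono2) auto
      also have "\<dots> = gauss_mod \<alpha> f v powr s * \<rho> powr \<theta>" using s \<rho> by (simp add: powr_mult powr_powr)
      finally show ?thesis using \<rho> by (simp add: powr_minus divide_inverse[symmetric] pos_divide_le_eq)
    qed
    have "ennreal (gauss_mod \<alpha> f z powr s * V)
        = ennreal C * (ennreal ((c / E) powr s * gauss_mod \<alpha> f z powr s * \<rho> powr (- \<theta>)) * ennreal (c0 * \<rho> powr \<theta> * V))"
      using c E c0 C \<rho> V by (simp add: ennreal_mult[symmetric] C_def powr_minus field_simps)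
    also have "\<dots> \<le> ennreal C * (ennreal ((c / E) powr s * gauss_mod \<alpha> f z powr s * \<rho> powr (- \<theta>)) * emeasure m (ball u \<rho>))"
      using bl \<rho> sub unfolding ball_lower_def by (intro mult_left_mono) auto
    also have "\<dots> = ennreal C * (\<integral>\<^sup>+v. ennreal ((c / E) powr s * gauss_mod \<alpha> f z powr s * \<rho> powr (- \<theta>)) * indicator (ball u \<rho>) v \<partial>m)"
      using m by (subst nn_integral_cmult_indicator) auto
    also have "\<dots> \<le> ennreal C * (\<integral>\<^sup>+v\<in>ball z h. ennreal (gauss_mod \<alpha> f v powr s) \<partial>m)"
      using pw sub by (intro mult_left_mono nn_integral_mono) (auto simp: indicator_def intro!: ennreal_leI)
    finally show ?thesis .
  qed
  with C show ?thesis by blast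
qed

section \<open>The square lattice\<close>

text \<open>Floors make the cells half-open, so that they partition the plane and each point has
  exactly one index.\<close>

definition cell_index :: "real \<Rightarrow> complex \<Rightarrow> int \<times> int" where
  "cell_index h u = (\<lfloor>Re u / h\<rfloor>, \<lfloor>Im u / h\<rfloor>)"

definition cell :: "real \<Rightarrow> int \<times> int \<Rightarrow> complex set" where
  "cell h \<nu> = {u. cell_index h u = \<nu>}"

definition cell_center :: "real \<Rightarrow> int \<times> int \<Rightarrow> complex" where
  "cell_center h \<nu> = Complex (h * (of_int (fst \<nu>) + 1/2)) (h * (of_int (snd \<nu>) + 1/2))"

definition cell_block :: "nat \<Rightarrow> int \<times> int \<Rightarrow> (int \<times> int) set" where
  "cell_block R \<nu> = {fst \<nu> - int R..fst \<nu> + int R} \<times> {snd \<nu> - int R..snd \<nu> + int R}"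

lemma finite_cell_block [simp]: "finite (cell_block R \<nu>)"
  by (simp add: cell_block_def)

lemma card_cell_block: "card (cell_block R \<nu>) = (2 * R + 1)\<^sup>2"
proof -
  have "nat (2 * int R + 1) = 2 * R + 1" by simp
  then show ?thesis by (simp add: cell_block_def power2_eq_square algebra_simps)
qed

lemma cell_block_sym: "\<kappa> \<in> cell_block R \<nu> \<longleftrightarrow> \<nu> \<in> cell_block R \<kappa>"
  by (cases \<kappa>; cases \<nu>) (auto simp: cell_block_def)

lemma cell_sets [measurable, simp]: "cell h \<nu> \<in> sets borel"
proof -
  have "cell h \<nu> = {u. of_int (fst \<nu>) \<le> Re u / h \<and> Re u / h < of_int (fst \<nu>) + 1 \<and>
                       of_int (snd \<nu>) \<le> Im u / h \<and> Im u / h < of_int (snd \<nu>) + 1}"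
    unfolding cell_def cell_index_def by (cases \<nu>) (auto simp: floor_eq_iff)
  also have "\<dots> \<in> sets borel" by measurable
  finally show ?thesis .
qed

lemma cell_index_cell_center: "h > 0 \<Longrightarrow> cell_index h (cell_center h \<nu>) = \<nu>"
  unfolding cell_index_def cell_center_def by (cases \<nu>) (simp add: floor_eq_iff)

text \<open>The position inside the cell shifts the integer difference k by at most 1/2, which is at
  most |k|/2 unless k = 0. Having no additive loss, the bound lets a Gaussian about a cell centre be
  dominated by a Gaussian in the index difference.\<close>

lemma floor_half_dist:
  fixes x :: real and m :: int
  shows "(of_int (\<lfloor>x\<rfloor> - m))\<^sup>2 / 4 \<le> (x - (of_int m + 1/2))\<^sup>2"
proof -
  define k where "k = \<lfloor>x\<rfloor> - m"
  define t where "t = x - of_int \<lfloor>x\<rfloor>"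
  have t: "0 \<le> t" "t < 1" unfolding t_def by linarith+
  have x: "x - (of_int m + 1/2) = of_int k + (t - 1/2)" by (simp add: k_def t_def)
  have "\<bar>of_int k\<bar> / 2 \<le> \<bar>of_int k + (t - 1/2)\<bar>"
  proof (cases "k = 0")
    case False
    then have "k \<ge> 1 \<or> k \<le> -1" by linarith
    then have "real_of_int k \<ge> 1 \<or> real_of_int k \<le> -1"
      by (metis of_int_le_iff of_int_1 of_int_minus)
    then show ?thesis using t by (auto simp: abs_if)
  qed simp
  then have "(\<bar>of_int k\<bar> / 2)\<^sup>2 \<le> (\<bar>of_int k + (t - 1/2)\<bar>)\<^sup>2" by (intro power_mono) auto
  then show ?thesis unfolding x by (simp add: k_def power_divide)
qed

lemma cell_center_dist_lower:
  assumes h: "h > 0"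
  shows "h\<^sup>2 / 4 * ((of_int (fst (cell_index h u) - fst \<nu>))\<^sup>2 + (of_int (snd (cell_index h u) - snd \<nu>))\<^sup>2)
     \<le> (cmod (u - cell_center h \<nu>))\<^sup>2"
proof -
  have *: "h\<^sup>2 / 4 * (of_int (\<lfloor>x / h\<rfloor> - m))\<^sup>2 \<le> (x - h * (of_int m + 1/2))\<^sup>2" for x :: real and m :: int
  proof -
    have "h\<^sup>2 * ((of_int (\<lfloor>x / h\<rfloor> - m))\<^sup>2 / 4) \<le> h\<^sup>2 * (x / h - (of_int m + 1/2))\<^sup>2"
      by (intro mult_left_mono floor_half_dist) auto
    also have "\<dots> = (x - h * (of_int m + 1/2))\<^sup>2"
      using h by (simp add: power_mult_distrib[symmetric] right_diff_distrib)
    finally show ?thesis by (simp add: mult_ac)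
  qed
  show ?thesis
    using add_mono[OF *[of "Re u" "fst \<nu>"] *[of "Im u" "snd \<nu>"]]
    unfolding cmod_power2 cell_center_def cell_index_def by (simp add: distrib_left)
qed

lemma cell_center_dist_upper:
  assumes h: "h > 0" and u: "u \<in> cell h \<nu>"
  shows "cmod (u - cell_center h \<nu>) \<le> h"
proof -
  have *: "\<bar>x - h * (of_int \<lfloor>x / h\<rfloor> + 1/2)\<bar> \<le> h / 2" for x :: real
  proof -
    have "\<bar>x / h - (of_int \<lfloor>x / h\<rfloor> + 1/2)\<bar> \<le> 1/2" by linarith
    then have "h * \<bar>x / h - (of_int \<lfloor>x / h\<rfloor> + 1/2)\<bar> \<le> h * (1/2)" using h by (intro mult_left_mono) auto
    also have "h * \<bar>x / h - (of_int \<lfloor>x / h\<rfloor> + 1/2)\<bar> = \<bar>h * (x / h - (of_int \<lfloor>x / h\<rfloor> + 1/2))\<bar>"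
      using h by (simp add: abs_mult)
    also have "h * (x / h - (of_int \<lfloor>x / h\<rfloor> + 1/2)) = x - h * (of_int \<lfloor>x / h\<rfloor> + 1/2)"
      using h by (simp add: right_diff_distrib)
    finally show ?thesis by simp
  qed
  have "\<nu> = (\<lfloor>Re u / h\<rfloor>, \<lfloor>Im u / h\<rfloor>)" using u by (simp add: cell_def cell_index_def)
  then show ?thesis
    using cmod_le[of "u - cell_center h \<nu>"] *[of "Re u"] *[of "Im u"] by (simp add: cell_center_def)
qed

lemma ball_subset_cell:
  assumes h: "h > 0"
  shows "ball (cell_center h \<nu>) (h / 2) \<subseteq> cell h \<nu>"
proof
  fix u assume "u \<in> ball (cell_center h \<nu>) (h / 2)"
  then have "cmod (u - cell_center h \<nu>) < h / 2" by (simp add: dist_norm norm_minus_commute)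
  then have "\<bar>Re u - h * (of_int (fst \<nu>) + 1/2)\<bar> < h / 2" "\<bar>Im u - h * (of_int (snd \<nu>) + 1/2)\<bar> < h / 2"
    using abs_Re_le_cmod[of "u - cell_center h \<nu>"] abs_Im_le_cmod[of "u - cell_center h \<nu>"] by (auto simp: cell_center_def)
  moreover have "\<lfloor>x / h\<rfloor> = k" if "\<bar>x - h * (of_int k + 1/2)\<bar> < h / 2" for x k
  proof -
    have "h * of_int k < x" "x < h * (of_int k + 1)" using that unfolding distrib_left by linarith+
    then have "of_int k < x / h" "x / h < of_int k + 1" using h by (auto simp: field_simps)
    then show ?thesis by (simp add: floor_eq_iff)
  qed
  ultimately show "u \<in> cell h \<nu>" by (simp add: cell_def cell_index_def prod_eq_iff)
qed

lemma floor_diff_le: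
  fixes x y :: real
  assumes "\<bar>x - y\<bar> \<le> real R"
  shows "\<bar>\<lfloor>x\<rfloor> - \<lfloor>y\<rfloor>\<bar> \<le> int R"
  using assms by linarith

lemma cell_index_near:
  assumes h: "h > 0" and d: "cmod (u - v) \<le> real R * h"
  shows "cell_index h u \<in> cell_block R (cell_index h v)"
proof -
  have "\<bar>Re u / h - Re v / h\<bar> \<le> real R" "\<bar>Im u / h - Im v / h\<bar> \<le> real R"
    using abs_Re_le_cmod[of "u - v"] abs_Im_le_cmod[of "u - v"] d h
    by (simp_all add: diff_divide_distrib[symmetric] abs_divide divide_le_eq)
  from this[THEN floor_diff_le] show ?thesis unfolding cell_index_def cell_block_def by auto
qed

section \<open>Gaussian sums against exponential growth\<close>

text \<open>M^|k - m| stands for the possible growth of the weight from cell to cell. Completing the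
  square bounds (2 M)^n exp (- g n^2) by C, so the terms are at most C 2^(-n); splitting at m makes
  |k - m| injective on each part, whence two geometric sums.\<close>

lemma Gaussian_sum_bound_int:
  fixes M g :: real
  assumes M: "M \<ge> 1" and g: "g > 0"
  obtains S where "S > 0"
    "\<And>A m. finite A \<Longrightarrow> (\<Sum>k\<in>A. M ^ nat \<bar>k - m\<bar> * exp (- g * (of_int (k - m))\<^sup>2)) \<le> S"
proof -
  define C where "C = exp ((ln (2 * M))\<^sup>2 / (4 * g))"
  have C: "C > 0" by (simp add: C_def)
  have b: "M ^ n * exp (- g * (real n)\<^sup>2) \<le> C * (1/2) ^ n" for n
  proof -
    have "(2 * M) ^ n = exp (real n * ln (2 * M))" using M by (simp add: exp_of_nat_mult)
    then have "(2 * M) ^ n * exp (- g * (real n)\<^sup>2) = exp (real n * ln (2 * M) - g * (real n)\<^sup>2)"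
      by (simp add: exp_add[symmetric])
    also have "real n * ln (2 * M) - g * (real n)\<^sup>2 \<le> (ln (2 * M))\<^sup>2 / (4 * g)"
    proof -
      have "0 \<le> (ln (2 * M) - 2 * g * real n)\<^sup>2" by simp
      then have "4 * g * (real n * ln (2 * M) - g * (real n)\<^sup>2) \<le> (ln (2 * M))\<^sup>2"
        by (simp add: power2_eq_square algebra_simps)
      then show ?thesis using g by (simp add: field_simps)
    qed
    finally have "(2 * M) ^ n * exp (- g * (real n)\<^sup>2) \<le> C" by (simp add: C_def)
    then show ?thesis by (simp add: power_mult_distrib field_simps power_one_over)
  qed
  have half: "(\<Sum>n\<in>B. (1/2::real) ^ n) \<le> 2" if "finite B" for B :: "nat set"
  proof -
    have "(\<Sum>n\<in>B. (1/2::real) ^ n) \<le> (\<Sum>n. (1/2::real) ^ n)"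
      using that by (intro sum_le_suminf) auto
    then show ?thesis by (simp add: suminf_geometric)
  qed
  have part: "(\<Sum>k\<in>A. (1/2::real) ^ nat \<bar>k - m\<bar>) \<le> 2"
    if "finite A" "inj_on (\<lambda>k. nat \<bar>k - m\<bar>) A" for A m
    using half[of "(\<lambda>k. nat \<bar>k - m\<bar>) ` A"] that by (simp add: sum.reindex)
  have "(\<Sum>k\<in>A. M ^ nat \<bar>k - m\<bar> * exp (- g * (of_int (k - m))\<^sup>2)) \<le> 4 * C" if A: "finite A" for A m
  proof -
    have "(\<Sum>k\<in>A. M ^ nat \<bar>k - m\<bar> * exp (- g * (of_int (k - m))\<^sup>2)) \<le> (\<Sum>k\<in>A. C * (1/2) ^ nat \<bar>k - m\<bar>)"
    proof (rule sum_mono)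
      fix k assume "k \<in> A"
      have "(of_int (k - m))\<^sup>2 = (real (nat \<bar>k - m\<bar>))\<^sup>2" by simp
      then show "M ^ nat \<bar>k - m\<bar> * exp (- g * (of_int (k - m))\<^sup>2) \<le> C * (1/2) ^ nat \<bar>k - m\<bar>"
        using b[of "nat \<bar>k - m\<bar>"] by simp
    qed
    also have "\<dots> = C * ((\<Sum>k\<in>A \<inter> {m..}. (1/2) ^ nat \<bar>k - m\<bar>) + (\<Sum>k\<in>A \<inter> {..<m}. (1/2) ^ nat \<bar>k - m\<bar>))"
      using A by (subst sum.union_disjoint[symmetric]) (auto simp: sum_distrib_left intro!: sum.cong)
    also have "\<dots> \<le> C * (2 + 2)"
      using A C by (intro mult_left_mono add_mono part) (auto simp: inj_on_def)
    finally show ?thesis by simp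
  qed
  then show ?thesis using C that[of "4 * C"] by simp
qed

text \<open>Enlarging N to the product of its two projections turns the sum into a product of
  one-dimensional ones.\<close>

lemma Gaussian_sum_bound:
  fixes M g :: real
  assumes M: "M \<ge> 1" and g: "g > 0"
  obtains S where "S > 0"
    "\<And>N \<nu>. finite N \<Longrightarrow> (\<Sum>\<kappa>\<in>N. M ^ nat \<bar>fst \<kappa> - fst \<nu>\<bar> * M ^ nat \<bar>snd \<kappa> - snd \<nu>\<bar>
        * exp (- g * ((of_int (fst \<kappa> - fst \<nu>))\<^sup>2 + (of_int (snd \<kappa> - snd \<nu>))\<^sup>2))) \<le> S"
proof -
  obtain S where S: "S > 0" and
    bd: "\<And>A m. finite A \<Longrightarrow> (\<Sum>k\<in>A. M ^ nat \<bar>k - m\<bar> * exp (- g * (of_int (k - m))\<^sup>2)) \<le> S"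
    using Gaussian_sum_bound_int[OF M g] by blast
  define G where "G k m = M ^ nat \<bar>k - m\<bar> * exp (- g * (of_int (k - m))\<^sup>2)" for k m
  have G0: "G k m \<ge> 0" for k m unfolding G_def using M by simp
  have "(\<Sum>\<kappa>\<in>N. M ^ nat \<bar>fst \<kappa> - fst \<nu>\<bar> * M ^ nat \<bar>snd \<kappa> - snd \<nu>\<bar>
        * exp (- g * ((of_int (fst \<kappa> - fst \<nu>))\<^sup>2 + (of_int (snd \<kappa> - snd \<nu>))\<^sup>2))) \<le> S * S"
    if N: "finite N" for N \<nu>
  proof -
    have "(\<Sum>\<kappa>\<in>N. M ^ nat \<bar>fst \<kappa> - fst \<nu>\<bar> * M ^ nat \<bar>snd \<kappa> - snd \<nu>\<bar>
        * exp (- g * ((of_int (fst \<kappa> - fst \<nu>))\<^sup>2 + (of_int (snd \<kappa> - snd \<nu>))\<^sup>2)))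
        = (\<Sum>\<kappa>\<in>N. G (fst \<kappa>) (fst \<nu>) * G (snd \<kappa>) (snd \<nu>))"
      unfolding G_def by (intro sum.cong) (simp_all add: distrib_left exp_add exp_diff exp_minus field_simps)
    also have "\<dots> \<le> (\<Sum>\<kappa>\<in>fst ` N \<times> snd ` N. G (fst \<kappa>) (fst \<nu>) * G (snd \<kappa>) (snd \<nu>))"
      using N G0 subset_fst_snd[of N] by (intro sum_mono2) auto
    also have "\<dots> = (\<Sum>k\<in>fst ` N. G k (fst \<nu>)) * (\<Sum>l\<in>snd ` N. G l (snd \<nu>))"
      by (simp add: sum_product sum.cartesian_product case_prod_beta)
    also have "\<dots> \<le> S * S"
      using N S bd G0 unfolding G_def by (intro mult_mono) (auto intro!: sum_nonneg)
    finally show ?thesis .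
  qed
  then show ?thesis using S that[of "S * S"] by simp
qed

section \<open>Summing operators\<close>

lemma dual_ball_zero:
  assumes "\<And>f. f \<in> X \<Longrightarrow> 0 \<le> nX f"
  shows "(\<lambda>_. 0) \<in> dual_ball X nX"
  using assms by (simp add: dual_ball_def)

text \<open>Removes the roots and the real supremum from the definition: r-th powers are compared,
  and V may be any common bound over the dual ball.\<close>

lemma summing_constI:
  assumes r: "r > 0" and C: "C \<ge> 0" and nX: "\<And>f. f \<in> X \<Longrightarrow> 0 \<le> nX f"
    and *: "\<And>(n::nat) x V. (\<And>j. j < n \<Longrightarrow> x j \<in> X) \<Longrightarrow> V \<ge> 0 \<Longrightarrow>
      (\<And>\<phi>. \<phi> \<in> dual_ball X nX \<Longrightarrow> (\<Sum>j<n. cmod (\<phi> (x j)) powr r) \<le> V) \<Longrightarrow>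
      (\<Sum>j<n. nY (T (x j)) powr r) \<le> C powr r * V"
  shows "summing_const r X nX nY T C"
  unfolding summing_const_def
proof (intro conjI C allI impI)
  fix n :: nat and x :: "nat \<Rightarrow> 'a \<Rightarrow> complex"
  assume x: "\<forall>j<n. x j \<in> X"
  define F where "F \<phi> = (\<Sum>j<n. cmod (\<phi> (x j)) powr r) powr (1 / r)" for \<phi> :: "('a \<Rightarrow> complex) \<Rightarrow> complex"
  \<comment> \<open>Without this the real supremum would be an unspecified number.\<close>
  have bdd: "bdd_above (F ` dual_ball X nX)"
  proof (rule bdd_aboveI2)
    fix \<phi> assume "\<phi> \<in> dual_ball X nX"
    then show "F \<phi> \<le> (\<Sum>j<n. nX (x j) powr r) powr (1 / r)"
      unfolding F_def using x r by (intro powr_mono2 sum_mono) (auto simp: dual_ball_def intro: sum_nonneg)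
  qed
  define s where "s = Sup (F ` dual_ball X nX)"
  have s: "F \<phi> \<le> s" if "\<phi> \<in> dual_ball X nX" for \<phi>
    unfolding s_def using bdd that by (intro cSup_upper) auto
  have "F (\<lambda>_. 0) \<ge> 0" by (simp add: F_def)
  then have s0: "s \<ge> 0" using s[OF dual_ball_zero[of X nX]] nX by fastforce
  have "(\<Sum>j<n. nY (T (x j)) powr r) \<le> C powr r * s powr r"
  proof (rule *[of n x])
    fix \<phi> assume "\<phi> \<in> dual_ball X nX"
    from s[OF this] have "F \<phi> powr r \<le> s powr r" using r by (intro powr_mono2) (auto simp: F_def)
    then show "(\<Sum>j<n. cmod (\<phi> (x j)) powr r) \<le> s powr r"
      using r by (simp add: F_def powr_powr sum_nonneg)
  qed (use x in auto)
  also have "\<dots> = (C * s) powr r" using C s0 by (simp add: powr_mult)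
  finally have "(\<Sum>j<n. nY (T (x j)) powr r) powr (1/r) \<le> ((C * s) powr r) powr (1/r)"
    using r by (intro powr_mono2) (auto intro: sum_nonneg)
  also have "\<dots> = C * s" using r C s0 by (simp add: powr_powr)
  finally show "(\<Sum>j<n. nY (T (x j)) powr r) powr (1/r)
     \<le> C * (SUP \<phi>\<in>dual_ball X nX. (\<Sum>j<n. cmod (\<phi> (x j)) powr r) powr (1 / r))"
    by (simp add: s_def F_def)
qed

text \<open>Counterpart of the introduction rule, with the family indexed by any finite set; cells
  and sign patterns are used below.\<close>

lemma summing_constD:
  assumes sc: "summing_const r X nX nY T C" and r: "r > 0" and nX: "\<And>f. f \<in> X \<Longrightarrow> 0 \<le> nX f"
    and J: "finite J" and x: "\<And>j. j \<in> J \<Longrightarrow> x j \<in> X"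
    and V: "\<And>\<phi>. \<phi> \<in> dual_ball X nX \<Longrightarrow> (\<Sum>j\<in>J. cmod (\<phi> (x j)) powr r) \<le> V"
  shows "(\<Sum>j\<in>J. nY (T (x j)) powr r) \<le> C powr r * V"
proof -
  have C: "C \<ge> 0" using sc by (simp add: summing_const_def)
  have V0: "V \<ge> 0" using V[OF dual_ball_zero[of X nX]] nX r by simp
  obtain e where e: "bij_betw e {0..<card J} J" using ex_bij_betw_nat_finite[OF J] by blast
  then have e': "bij_betw e {..<card J} J" by (simp add: lessThan_atLeast0)
  have re: "(\<Sum>j\<in>J. F j) = (\<Sum>j<card J. F (e j))" for F :: "_ \<Rightarrow> real"
    by (rule sum.reindex_bij_betw[OF e', symmetric])
  have ex: "\<forall>j<card J. x (e j) \<in> X" using x bij_betwE[OF e'] by auto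
  have "(\<Sum>j<card J. nY (T (x (e j))) powr r) powr (1 / r)
     \<le> C * (SUP \<phi>\<in>dual_ball X nX. (\<Sum>j<card J. cmod (\<phi> (x (e j))) powr r) powr (1 / r))"
    using sc[unfolded summing_const_def, THEN conjunct2, rule_format, of "card J" "\<lambda>j. x (e j)"] ex by auto
  also have "\<dots> \<le> C * V powr (1 / r)"
  proof (intro mult_left_mono C cSUP_least)
    show "dual_ball X nX \<noteq> {}" using dual_ball_zero[of X nX] nX by auto
    fix \<phi> assume "\<phi> \<in> dual_ball X nX"
    from V[OF this] show "(\<Sum>j<card J. cmod (\<phi> (x (e j))) powr r) powr (1 / r) \<le> V powr (1 / r)"
      unfolding re using r by (intro powr_mono2) (auto intro: sum_nonneg)
  qed
  finally have "((\<Sum>j<card J. nY (T (x (e j))) powr r) powr (1 / r)) powr r \<le> (C * V powr (1 / r)) powr r"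
    using r by (intro powr_mono2) auto
  then show ?thesis unfolding re using r C V0 by (simp add: powr_powr powr_mult sum_nonneg)
qed

text \<open>The inclusion theorem for summing operators, with the same constant. The vectors are
  rescaled by powers of the norms of their images, and Hoelder's inequality with exponents s/r and
  s/(s - r) turns the bound on s-th powers of functionals into one on r-th powers.\<close>

lemma summing_const_mono_exponent:
  assumes sc: "summing_const r X nX nY T C" and r: "0 < r" "r \<le> s"
    and nX: "\<And>f. f \<in> X \<Longrightarrow> 0 \<le> nX f"
    and nY: "\<And>f. f \<in> X \<Longrightarrow> 0 \<le> nY (T f)"
    and scale: "\<And>c f. f \<in> X \<Longrightarrow> (\<lambda>t. of_real c * f t) \<in> X"
    and hom: "\<And>c f. f \<in> X \<Longrightarrow> c \<ge> 0 \<Longrightarrow> nY (T (\<lambda>t. of_real c * f t)) = c * nY (T f)"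
  shows "summing_const s X nX nY T C"
proof (cases "r = s")
  case True
  then show ?thesis using sc by simp
next
  case False
  with r have rs: "r < s" by simp
  have C: "C \<ge> 0" using sc by (simp add: summing_const_def)
  show ?thesis
  proof (rule summing_constI)
    fix n :: nat and x V
    assume x: "\<And>j. j < n \<Longrightarrow> x j \<in> X" and V0: "(V::real) \<ge> 0"
      and V: "\<And>\<phi>. \<phi> \<in> dual_ball X nX \<Longrightarrow> (\<Sum>j<n. cmod (\<phi> (x j)) powr s) \<le> V"
    define t where "t j = nY (T (x j))" for j
    have t0: "t j \<ge> 0" if "j < n" for j using nY x that by (simp add: t_def)
    \<comment> \<open>Chosen so that the rescaled image has norm t j^(s/r), whose r-th power is t
      j^s.\<close>
    define l where "l j = t j powr (s / r - 1)" for j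
    define S where "S = (\<Sum>j<n. t j powr s)"
    have S0: "S \<ge> 0" by (simp add: S_def sum_nonneg)
    have "(\<Sum>j<n. nY (T (\<lambda>u. of_real (l j) * x j u)) powr r) \<le> C powr r * (V powr (r/s) * S powr (1 - r/s))"
    proof (rule summing_constD[OF sc r(1) nX])
      fix \<phi> assume \<phi>: "\<phi> \<in> dual_ball X nX"
      have "(\<Sum>j<n. cmod (\<phi> (\<lambda>u. of_real (l j) * x j u)) powr r)
          = (\<Sum>j<n. cmod (\<phi> (x j)) powr r * l j powr r)"
        using \<phi> x by (intro sum.cong) (auto simp: dual_ball_def norm_mult powr_mult l_def)
      also have "\<dots> \<le> (\<Sum>j<n. (cmod (\<phi> (x j)) powr r) powr (s/r)) powr (1/(s/r))
                     * (\<Sum>j<n. (l j powr r) powr (s/(s-r))) powr (1/(s/(s-r)))"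
        using r rs by (intro Holder_sum) (simp_all, simp add: field_simps)
      also have "(\<Sum>j<n. (cmod (\<phi> (x j)) powr r) powr (s/r)) = (\<Sum>j<n. cmod (\<phi> (x j)) powr s)"
        using r by (simp add: powr_powr)
      also have "(\<Sum>j<n. (l j powr r) powr (s/(s-r))) = S"
      proof -
        have "(s / r - 1) * r = s - r" using r by (simp add: left_diff_distrib)
        then have eq: "(s / r - 1) * r * (s / (s - r)) = s" using rs by simp
        show ?thesis by (simp only: S_def l_def powr_powr eq)
      qed
      also have "1/(s/r) = r/s" by simp
      also have "1/(s/(s-r)) = 1 - r/s" using r rs by (simp add: field_simps)
      also have "(\<Sum>j<n. cmod (\<phi> (x j)) powr s) powr (r/s) * S powr (1 - r/s) \<le> V powr (r/s) * S powr (1 - r/s)"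
        using V[OF \<phi>] r by (intro mult_right_mono powr_mono2) (auto intro: sum_nonneg)
      finally show "(\<Sum>j<n. cmod (\<phi> (\<lambda>u. of_real (l j) * x j u)) powr r) \<le> V powr (r/s) * S powr (1 - r/s)" .
    qed (use x scale in auto)
    also have "(\<Sum>j<n. nY (T (\<lambda>u. of_real (l j) * x j u)) powr r) = S"
      unfolding S_def
    proof (rule sum.cong)
      fix j assume "j \<in> {..<n}"
      then have "nY (T (\<lambda>u. of_real (l j) * x j u)) = t j powr (s / r - 1) * t j powr 1"
        using hom[OF x, of j "l j"] t0[of j] by (simp add: l_def t_def)
      also have "\<dots> = t j powr (s / r)" by (simp only: powr_add[symmetric]) simp
      finally show "nY (T (\<lambda>u. of_real (l j) * x j u)) powr r = t j powr s" using r by (simp add: powr_powr)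
    qed simp
    finally have main: "S \<le> (C powr r * V powr (r/s)) * S powr (1 - r/s)" by (simp add: mult.assoc)
    show "(\<Sum>j<n. nY (T (x j)) powr s) \<le> C powr s * V"
    proof (cases "S = 0")
      case True
      then show ?thesis using V0 by (simp add: S_def t_def)
    next
      case False
      with S0 have S: "S > 0" by simp
      have "S = S powr (r/s) * S powr (1 - r/s)" using S by (simp add: powr_add[symmetric])
      with main have "S powr (r/s) * S powr (1 - r/s) \<le> (C powr r * V powr (r/s)) * S powr (1 - r/s)" by simp
      then have "S powr (r/s) \<le> C powr r * V powr (r/s)" using S by simp
      then have "(S powr (r/s)) powr (s/r) \<le> (C powr r * V powr (r/s)) powr (s/r)"
        using r rs by (intro powr_mono2) auto
      then have "S \<le> C powr s * V" using r rs S V0 by (simp add: powr_powr powr_mult)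
      then show ?thesis by (simp add: S_def t_def)
    qed
  qed (use r C nX in auto)
qed

lemma summing_norm_le:
  assumes "summing_const r X nX nY T C"
  shows "summing_norm r X nX nY T \<le> C"
  unfolding summing_norm_def using assms
  by (intro cInf_lower bdd_belowI[of _ 0]) (auto simp: summing_const_def)

text \<open>The witness C0 keeps the set of constants nonempty; the infimum of the empty set of
  reals carries no information.\<close>

lemma le_summing_norm:
  assumes "summing_const r X nX nY T C0" "\<And>C. summing_const r X nX nY T C \<Longrightarrow> B \<le> C"
  shows "B \<le> summing_norm r X nX nY T"
  unfolding summing_norm_def using assms by (intro cInf_greatest) auto

section \<open>Weighted Fock norms on the lattice\<close>

text \<open>One functional for both sides of the embedding: m is w dA for the Fock space and the
  given measure for the target.\<close>

definition fock_mass :: "real \<Rightarrow> real \<Rightarrow> complex measure \<Rightarrow> (complex \<Rightarrow> complex) \<Rightarrow> ennreal" where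
  "fock_mass \<alpha> p m f = (\<integral>\<^sup>+u. ennreal (gauss_mod \<alpha> f u powr p) \<partial>m)"

text \<open>The reproducing kernel exp (\<alpha> u cnj z), normalised so that its Gaussian modulus
  is exactly a Gaussian about z with value 1 at z.\<close>

definition fock_kernel :: "real \<Rightarrow> complex \<Rightarrow> complex \<Rightarrow> complex" where
  "fock_kernel \<alpha> z u = exp (of_real \<alpha> * u * cnj z - of_real (\<alpha> / 2 * (cmod z)\<^sup>2))"

lemma fock_kernel_holomorphic: "fock_kernel \<alpha> z holomorphic_on A"
  unfolding fock_kernel_def by (intro holomorphic_intros)

lemma gauss_mod_kern: "gauss_mod \<alpha> (fock_kernel \<alpha> z) u = exp (- (\<alpha> / 2) * (cmod (u - z))\<^sup>2)"
proof -
  have "(cmod (u - z))\<^sup>2 = (cmod u)\<^sup>2 - 2 * Re (u * cnj z) + (cmod z)\<^sup>2"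
    unfolding cmod_power2 by (simp add: power2_eq_square algebra_simps)
  then have "- (\<alpha> / 2) * (cmod (u - z))\<^sup>2
      = (\<alpha> * Re (u * cnj z) - \<alpha> / 2 * (cmod z)\<^sup>2) + - (\<alpha> / 2) * (cmod u)\<^sup>2"
  proof -
    have "- (\<alpha> / 2) * d = (\<alpha> * x - \<alpha> / 2 * c) + - (\<alpha> / 2) * b" if "d = b - 2 * x + c" for b c d x
      unfolding that by (simp add: algebra_simps)
    then show ?thesis using \<open>(cmod (u - z))\<^sup>2 = _\<close> by blast
  qed
  moreover have "cmod (fock_kernel \<alpha> z u) = exp (\<alpha> * Re (u * cnj z) - \<alpha> / 2 * (cmod z)\<^sup>2)"
    by (simp add: fock_kernel_def mult.assoc)
  ultimately show ?thesis by (simp only: gauss_mod_def exp_add)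
qed

lemma borel_measurable_finer:
  fixes f :: "'a::topological_space \<Rightarrow> 'b::topological_space"
  assumes "f \<in> borel_measurable borel" "sets borel \<subseteq> sets m"
  shows "f \<in> borel_measurable m"
proof -
  have "UNIV \<in> sets m" using assms(2) by auto
  then have "space m = UNIV" using sets.sets_into_space by blast
  then show ?thesis using assms by (auto simp: measurable_def)
qed

text \<open>The interchange is with a countable sum, which is valid for measures that are not
  sigma-finite, as the target measure may be.\<close>

lemma nn_integral_cells:
  assumes m: "sets borel \<subseteq> sets m" and f: "f \<in> borel_measurable m"
  shows "(\<integral>\<^sup>+u. f u \<partial>m) = (\<integral>\<^sup>+\<nu>. (\<integral>\<^sup>+u\<in>cell h \<nu>. f u \<partial>m) \<partial>count_space UNIV)"
proof -
  have "(\<integral>\<^sup>+u. f u \<partial>m) = (\<integral>\<^sup>+u. (\<integral>\<^sup>+\<nu>. f u * indicator (cell h \<nu>) u \<partial>count_space UNIV) \<partial>m)"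
  proof (rule nn_integral_cong)
    fix u
    have "(\<integral>\<^sup>+\<nu>. f u * indicator (cell h \<nu>) u \<partial>count_space UNIV)
        = (\<integral>\<^sup>+\<nu>. f u * indicator {cell_index h u} \<nu> \<partial>count_space UNIV)"
      by (intro nn_integral_cong) (auto simp: indicator_def cell_def)
    also have "\<dots> = f u" by (simp add: nn_integral_cmult_indicator)
    finally show "f u = (\<integral>\<^sup>+\<nu>. f u * indicator (cell h \<nu>) u \<partial>count_space UNIV)" ..
  qed
  also have "\<dots> = (\<integral>\<^sup>+\<nu>. (\<integral>\<^sup>+u\<in>cell h \<nu>. f u \<partial>m) \<partial>count_space UNIV)"
    using m f cell_sets by (intro nn_integral_count_space_nn_integral) (auto intro!: borel_measurable_times_ennreal borel_measurable_indicator)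
  finally show ?thesis .
qed

lemma nn_integral_count_space_le:
  fixes f :: "'i \<Rightarrow> ennreal"
  assumes "countable (UNIV :: 'i set)" "\<And>N. finite N \<Longrightarrow> sum f N \<le> B"
  shows "(\<integral>\<^sup>+i. f i \<partial>count_space UNIV) \<le> B"
proof (cases "finite (UNIV :: 'i set)")
  case True
  then show ?thesis using assms(2)[OF True] by (simp add: nn_integral_count_space_finite)
next
  case False
  then have b: "bij_betw (from_nat_into UNIV) (UNIV :: nat set) (UNIV :: 'i set)"
    using assms(1) by (intro bij_betw_from_nat_into) auto
  have "(\<integral>\<^sup>+i. f i \<partial>count_space UNIV) = (\<integral>\<^sup>+n. f (from_nat_into UNIV n) \<partial>count_space UNIV)"
    by (rule nn_integral_bij_count_space[OF b, symmetric])
  also have "\<dots> = (\<Sum>n. f (from_nat_into UNIV n))" by (simp add: nn_integral_count_space_nat)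
  also have "\<dots> \<le> B"
  proof (rule suminf_le_const)
    fix n
    have "(\<Sum>i<n. f (from_nat_into UNIV i)) = sum f (from_nat_into UNIV ` {..<n})"
      using b by (subst sum.reindex) (auto simp: bij_betw_def intro: inj_on_subset)
    also have "\<dots> \<le> B" by (rule assms(2)) simp
    finally show "(\<Sum>i<n. f (from_nat_into UNIV i)) \<le> B" .
  qed simp
  finally show ?thesis .
qed

section \<open>Lattices adapted to a weight: sampling, synthesis, averages\<close>

text \<open>All that the weight contributes, in terms of wm = w dA and the cell masses W: adjacent
  cells have comparable mass, and small discs near a cell carry a power of their radius times its
  mass. The bound 1/4 on h places a cell inside the unit disc about each of its points.\<close>

locale fock_lattice =
  fixes \<alpha> p h M c0 \<theta> :: real and wm :: "complex measure" and W :: "int \<times> int \<Rightarrow> real"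
  assumes \<alpha>: "\<alpha> > 0" and p: "p > 1" and h: "0 < h" "h \<le> 1/4"
    and sets_wm [measurable_cong]: "sets wm = sets lebesgue"
    and M: "M \<ge> 1" and W: "\<And>\<nu>. W \<nu> > 0"
    and emeasure_cell: "\<And>\<nu>. emeasure wm (cell h \<nu>) = ennreal (W \<nu>)"
    and W_adj: "\<And>\<kappa> \<nu>. \<kappa> \<in> cell_block 1 \<nu> \<Longrightarrow> W \<kappa> \<le> M * W \<nu>"
    and c0: "c0 > 0" and \<theta>: "\<theta> > 0"
    and ball_lower: "\<And>z. ball_lower wm c0 \<theta> h z (W (cell_index h z))"
begin

text \<open>A walk through adjacent cells, first along one axis and then along the other, each step
  costing a factor M.\<close>

lemma W_le: "W \<kappa> \<le> M ^ nat \<bar>fst \<kappa> - fst \<nu>\<bar> * M ^ nat \<bar>snd \<kappa> - snd \<nu>\<bar> * W \<nu>"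
proof -
  have 1: "W (a + s * int n, b) \<le> M ^ n * W (a, b)" if "s = 1 \<or> s = -1" for a b s n
  proof (induction n)
    case (Suc n)
    have "W (a + s * int (Suc n), b) \<le> M * W (a + s * int n, b)"
      using that by (intro W_adj) (auto simp: cell_block_def algebra_simps)
    also have "\<dots> \<le> M * (M ^ n * W (a, b))" using Suc M by (intro mult_left_mono) auto
    finally show ?case by (simp add: mult_ac)
  qed simp
  have 2: "W (a, b + s * int n) \<le> M ^ n * W (a, b)" if "s = 1 \<or> s = -1" for a b s n
  proof (induction n)
    case (Suc n)
    have "W (a, b + s * int (Suc n)) \<le> M * W (a, b + s * int n)"
      using that by (intro W_adj) (auto simp: cell_block_def algebra_simps)
    also have "\<dots> \<le> M * (M ^ n * W (a, b))" using Suc M by (intro mult_left_mono) auto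
    finally show ?case by (simp add: mult_ac)
  qed simp
  have dec: "\<exists>s. (s = 1 \<or> s = -1) \<and> k = l + s * int (nat \<bar>k - l\<bar>)" for k l :: int
    by (cases "k \<ge> l") (auto intro: exI[of _ 1] exI[of _ "-1"])
  obtain a b a' b' where ab: "\<kappa> = (a, b)" "\<nu> = (a', b')" by (cases \<kappa>, cases \<nu>) auto
  obtain s where s: "s = 1 \<or> s = -1" "a = a' + s * int (nat \<bar>a - a'\<bar>)" using dec by blast
  obtain t where t: "t = 1 \<or> t = -1" "b = b' + t * int (nat \<bar>b - b'\<bar>)" using dec by blast
  have "W (a, b) \<le> M ^ nat \<bar>a - a'\<bar> * W (a', b)" using 1[OF s(1), of a' "nat \<bar>a - a'\<bar>" b] s(2) by simp
  also have "\<dots> \<le> M ^ nat \<bar>a - a'\<bar> * (M ^ nat \<bar>b - b'\<bar> * W (a', b'))"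
    using 2[OF t(1), of a' b' "nat \<bar>b - b'\<bar>"] t(2) M by (intro mult_left_mono) auto
  finally show ?thesis using ab by (simp add: mult_ac)
qed

lemma W_cell_block: "\<kappa> \<in> cell_block R \<nu> \<Longrightarrow> W \<kappa> \<le> M ^ (2 * R) * W \<nu>"
proof -
  assume \<kappa>: "\<kappa> \<in> cell_block R \<nu>"
  have "W \<kappa> \<le> M ^ nat \<bar>fst \<kappa> - fst \<nu>\<bar> * M ^ nat \<bar>snd \<kappa> - snd \<nu>\<bar> * W \<nu>" by (rule W_le)
  also have "\<dots> \<le> M ^ R * M ^ R * W \<nu>"
    using \<kappa> M W[of \<nu>] by (intro mult_right_mono mult_mono power_increasing) (auto simp: cell_block_def)
  finally show ?thesis by (simp add: power_add[symmetric] mult_2)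
qed

lemma gauss_mod_measurable: "f holomorphic_on UNIV \<Longrightarrow> sets borel \<subseteq> sets m \<Longrightarrow> (\<lambda>u. ennreal (gauss_mod \<alpha> f u powr s)) \<in> borel_measurable m"
proof -
  assume f: "f holomorphic_on UNIV" and m: "sets borel \<subseteq> sets m"
  have "gauss_mod \<alpha> f \<in> borel_measurable borel"
    by (intro borel_measurable_continuous_onI continuous_on_gauss_mod f)
  then have "(\<lambda>u. ennreal (gauss_mod \<alpha> f u powr s)) \<in> borel_measurable borel" by measurable
  then show ?thesis using m by (rule borel_measurable_finer)
qed

text \<open>The local bound at the points \<zeta> \<nu>, summed over the cells. The points may stray
  from the centres, so W \<nu> has to be compared with the mass of the cell that \<zeta> \<nu> falls
  into; the discs of integration overlap boundedly often.\<close>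

lemma sampling:
  obtains C where "C > 0"
    "\<And>f N \<zeta>. f holomorphic_on UNIV \<Longrightarrow> finite N \<Longrightarrow> (\<And>\<nu>. \<nu> \<in> N \<Longrightarrow> cmod (\<zeta> \<nu> - cell_center h \<nu>) \<le> 4 * h) \<Longrightarrow>
      ennreal (\<Sum>\<nu>\<in>N. W \<nu> * gauss_mod \<alpha> f (\<zeta> \<nu>) powr p) \<le> ennreal C * fock_mass \<alpha> p wm f"
proof -
  obtain C where C: "C > 0" and local: "\<And>f z m V. f holomorphic_on UNIV \<Longrightarrow> sets m = sets lebesgue \<Longrightarrow> V \<ge> 0 \<Longrightarrow>
       ball_lower m c0 \<theta> h z V \<Longrightarrow>
       ennreal (gauss_mod \<alpha> f z powr p * V) \<le> ennreal C * (\<integral>\<^sup>+v\<in>ball z h. ennreal (gauss_mod \<alpha> f v powr p) \<partial>m)"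
    using gauss_mod_local_bound[OF less_imp_le[OF \<alpha>] h(1) less_trans[OF zero_less_one p] \<theta> c0] by blast
  \<comment> \<open>M^8 covers up to 4 steps between cells along each of the two axes. A block of
    radius 10 has 21^2 = 441 cells, which bounds the number of enlarged discs through one
    point.\<close>
  define K where "K = M ^ 8 * C * 441"
  have K: "K > 0" unfolding K_def using M C by simp
  have "ennreal (\<Sum>\<nu>\<in>N. W \<nu> * gauss_mod \<alpha> f (\<zeta> \<nu>) powr p) \<le> ennreal K * fock_mass \<alpha> p wm f"
    if f: "f holomorphic_on UNIV" and N: "finite N"
      and \<zeta>: "\<And>\<nu>. \<nu> \<in> N \<Longrightarrow> cmod (\<zeta> \<nu> - cell_center h \<nu>) \<le> 4 * h" for f N \<zeta>
  proof -
    have meas: "(\<lambda>u. ennreal (gauss_mod \<alpha> f u powr p)) \<in> borel_measurable wm"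
      by (rule gauss_mod_measurable[OF f]) (auto simp: sets_wm)
    have "ennreal (\<Sum>\<nu>\<in>N. W \<nu> * gauss_mod \<alpha> f (\<zeta> \<nu>) powr p)
       = (\<Sum>\<nu>\<in>N. ennreal (W \<nu> * gauss_mod \<alpha> f (\<zeta> \<nu>) powr p))"
      using W by (subst sum_ennreal) (auto simp: less_imp_le)
    also have "\<dots> \<le> (\<Sum>\<nu>\<in>N. ennreal (M ^ 8 * C) * (\<integral>\<^sup>+v. ennreal (gauss_mod \<alpha> f v powr p) * indicator (ball (cell_center h \<nu>) (5 * h)) v \<partial>wm))"
    proof (rule sum_mono)
      fix \<nu> assume \<nu>: "\<nu> \<in> N"
      define \<kappa> where "\<kappa> = cell_index h (\<zeta> \<nu>)"
      have "cell_index h (\<zeta> \<nu>) \<in> cell_block 4 (cell_index h (cell_center h \<nu>))"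
        using \<zeta>[OF \<nu>] h by (intro cell_index_near) auto
      then have "\<nu> \<in> cell_block 4 \<kappa>" using h by (simp add: cell_index_cell_center \<kappa>_def cell_block_sym)
      then have "W \<nu> \<le> M ^ 8 * W \<kappa>" using W_cell_block[of \<nu> 4 \<kappa>] by simp
      then have "ennreal (W \<nu> * gauss_mod \<alpha> f (\<zeta> \<nu>) powr p) \<le> ennreal (M ^ 8 * (gauss_mod \<alpha> f (\<zeta> \<nu>) powr p * W \<kappa>))"
        by (intro ennreal_leI) (metis mult.assoc mult.commute mult_left_mono powr_ge_zero)
      also have "\<dots> = ennreal (M ^ 8) * ennreal (gauss_mod \<alpha> f (\<zeta> \<nu>) powr p * W \<kappa>)"
        using M W[of \<kappa>] by (intro ennreal_mult) auto
      also have "\<dots> \<le> ennreal (M ^ 8) * (ennreal C * (\<integral>\<^sup>+v\<in>ball (\<zeta> \<nu>) h. ennreal (gauss_mod \<alpha> f v powr p) \<partial>wm))"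
        using W[of \<kappa>] by (intro mult_left_mono local[OF f sets_wm]) (auto simp: \<kappa>_def intro: ball_lower)
      also have "\<dots> \<le> ennreal (M ^ 8) * (ennreal C * (\<integral>\<^sup>+v\<in>ball (cell_center h \<nu>) (5 * h). ennreal (gauss_mod \<alpha> f v powr p) \<partial>wm))"
      proof (rule mult_left_mono, rule mult_left_mono, rule nn_integral_mono)
        fix v
        have "v \<in> ball (cell_center h \<nu>) (5 * h)" if "v \<in> ball (\<zeta> \<nu>) h"
          using that \<zeta>[OF \<nu>] dist_triangle[of "cell_center h \<nu>" v "\<zeta> \<nu>"] by (auto simp: dist_norm norm_minus_commute)
        then show "ennreal (gauss_mod \<alpha> f v powr p) * indicator (ball (\<zeta> \<nu>) h) v
           \<le> ennreal (gauss_mod \<alpha> f v powr p) * indicator (ball (cell_center h \<nu>) (5 * h)) v"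
          by (auto simp: indicator_def)
      qed auto
      finally show "ennreal (W \<nu> * gauss_mod \<alpha> f (\<zeta> \<nu>) powr p)
         \<le> ennreal (M ^ 8 * C) * (\<integral>\<^sup>+v\<in>ball (cell_center h \<nu>) (5 * h). ennreal (gauss_mod \<alpha> f v powr p) \<partial>wm)"
        using M C by (simp add: ennreal_mult mult.assoc)
    qed
    also have "\<dots> = ennreal (M ^ 8 * C) * (\<integral>\<^sup>+v. (\<Sum>\<nu>\<in>N. ennreal (gauss_mod \<alpha> f v powr p) * indicator (ball (cell_center h \<nu>) (5 * h)) v) \<partial>wm)"
      using meas by (subst nn_integral_sum) (auto simp: sum_distrib_left sets_wm intro!: borel_measurable_times_ennreal borel_measurable_indicator)
    also have "\<dots> \<le> ennreal (M ^ 8 * C) * (\<integral>\<^sup>+v. ennreal 441 * ennreal (gauss_mod \<alpha> f v powr p) \<partial>wm)"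
    proof (intro mult_left_mono nn_integral_mono)
      fix v
      have sub: "{\<nu>\<in>N. v \<in> ball (cell_center h \<nu>) (5 * h)} \<subseteq> cell_block 10 (cell_index h v)"
      proof
        fix \<nu> assume "\<nu> \<in> {\<nu>\<in>N. v \<in> ball (cell_center h \<nu>) (5 * h)}"
        then have "cmod (v - cell_center h \<nu>) \<le> real 10 * h" using h by (auto simp: dist_norm norm_minus_commute)
        from cell_index_near[OF h(1) this] show "\<nu> \<in> cell_block 10 (cell_index h v)"
          using h by (simp add: cell_index_cell_center cell_block_sym)
      qed
      have "(\<Sum>\<nu>\<in>N. indicator (ball (cell_center h \<nu>) (5 * h)) v :: real) = card {\<nu>\<in>N. v \<in> ball (cell_center h \<nu>) (5 * h)}"
        using N by (simp add: indicator_def sum.If_cases Int_def)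
      also have "\<dots> \<le> card (cell_block 10 (cell_index h v))" using sub by (intro of_nat_mono card_mono) auto
      also have "\<dots> = 441" by (simp add: card_cell_block)
      finally have b: "(\<Sum>\<nu>\<in>N. indicator (ball (cell_center h \<nu>) (5 * h)) v :: real) \<le> 441" .
      have "(\<Sum>\<nu>\<in>N. ennreal (gauss_mod \<alpha> f v powr p) * indicator (ball (cell_center h \<nu>) (5 * h)) v)
          = ennreal (gauss_mod \<alpha> f v powr p) * ennreal (\<Sum>\<nu>\<in>N. indicator (ball (cell_center h \<nu>) (5 * h)) v)"
        by (subst sum_ennreal[symmetric]) (auto simp: sum_distrib_left ennreal_indicator)
      also have "\<dots> \<le> ennreal (gauss_mod \<alpha> f v powr p) * ennreal 441"
        using b by (intro mult_left_mono ennreal_leI) auto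
      finally show "(\<Sum>\<nu>\<in>N. ennreal (gauss_mod \<alpha> f v powr p) * indicator (ball (cell_center h \<nu>) (5 * h)) v)
          \<le> ennreal 441 * ennreal (gauss_mod \<alpha> f v powr p)" by (simp add: mult.commute)
    qed auto
    also have "\<dots> = ennreal (M ^ 8 * C) * (ennreal 441 * fock_mass \<alpha> p wm f)"
      using meas by (simp add: nn_integral_cmult fock_mass_def)
    also have "\<dots> = ennreal K * fock_mass \<alpha> p wm f"
      using M C by (simp add: K_def ennreal_mult mult.assoc)
    finally show ?thesis .
  qed
  with K that show ?thesis by blast
qed

text \<open>A Schur test. At each point u the Gaussians E \<nu> u have sum at most S, so the power
  mean inequality leaves S^(p - 1) times the sum of E \<nu> u |c \<nu>|^p. Each E \<nu> has weighted
  integral at most S * W \<nu>, because the Gaussian decay outruns the growth of W away from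
  \<nu>.\<close>

lemma synthesis:
  obtains C where "C > 0"
    "\<And>N c. finite N \<Longrightarrow> fock_mass \<alpha> p wm (\<lambda>u. \<Sum>\<nu>\<in>N. c \<nu> * fock_kernel \<alpha> (cell_center h \<nu>) u)
       \<le> ennreal (C * (\<Sum>\<nu>\<in>N. cmod (c \<nu>) powr p * W \<nu>))"
proof -
  \<comment> \<open>The rate \<alpha>/2 of the kernel times the factor h^2/4 that relates squared
    distances to squared index differences.\<close>
  define g where "g = \<alpha> / 2 * (h\<^sup>2 / 4)"
  have g: "g > 0" unfolding g_def using \<alpha> h by simp
  obtain S where S: "S > 0" and
    gs: "\<And>N \<nu>. finite N \<Longrightarrow> (\<Sum>\<kappa>\<in>N. M ^ nat \<bar>fst \<kappa> - fst \<nu>\<bar> * M ^ nat \<bar>snd \<kappa> - snd \<nu>\<bar>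
        * exp (- g * ((of_int (fst \<kappa> - fst \<nu>))\<^sup>2 + (of_int (snd \<kappa> - snd \<nu>))\<^sup>2))) \<le> S"
    using Gaussian_sum_bound[OF M g] by blast
  define E where "E \<nu> u = exp (- (\<alpha> / 2) * (cmod (u - cell_center h \<nu>))\<^sup>2)" for \<nu> u
  define G where "G \<kappa> \<nu> = exp (- g * ((of_int (fst \<kappa> - fst \<nu>))\<^sup>2 + (of_int (snd \<kappa> - snd \<nu>))\<^sup>2))" for \<kappa> \<nu> :: "int \<times> int"
  have Gsym: "G \<kappa> \<nu> = G \<nu> \<kappa>" for \<kappa> \<nu> by (simp add: G_def power2_commute)
  have EG: "E \<nu> u \<le> G (cell_index h u) \<nu>" for \<nu> u
  proof -
    have "\<alpha> / 2 * (h\<^sup>2 / 4 * ((of_int (fst (cell_index h u) - fst \<nu>))\<^sup>2 + (of_int (snd (cell_index h u) - snd \<nu>))\<^sup>2))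
       \<le> \<alpha> / 2 * (cmod (u - cell_center h \<nu>))\<^sup>2"
      using \<alpha> by (intro mult_left_mono cell_center_dist_lower h) auto
    then show ?thesis unfolding E_def G_def g_def by (simp add: mult.assoc)
  qed
  have E0: "E \<nu> u \<ge> 0" for \<nu> u by (simp add: E_def)
  have sumE: "(\<Sum>\<nu>\<in>N. E \<nu> u) \<le> S" if "finite N" for N u
  proof -
    have "(\<Sum>\<nu>\<in>N. E \<nu> u) \<le> (\<Sum>\<nu>\<in>N. 1 * G \<nu> (cell_index h u))"
      using EG Gsym by (intro sum_mono) auto
    also have "\<dots> \<le> (\<Sum>\<nu>\<in>N. (M ^ nat \<bar>fst \<nu> - fst (cell_index h u)\<bar> * M ^ nat \<bar>snd \<nu> - snd (cell_index h u)\<bar>) * G \<nu> (cell_index h u))"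
    proof (intro sum_mono mult_right_mono)
      fix \<nu> :: "int \<times> int"
      have "1 * 1 \<le> M ^ nat \<bar>fst \<nu> - fst (cell_index h u)\<bar> * M ^ nat \<bar>snd \<nu> - snd (cell_index h u)\<bar>"
        using M by (intro mult_mono one_le_power) auto
      then show "1 \<le> M ^ nat \<bar>fst \<nu> - fst (cell_index h u)\<bar> * M ^ nat \<bar>snd \<nu> - snd (cell_index h u)\<bar>" by simp
    qed (simp add: G_def)
    also have "\<dots> \<le> S" unfolding G_def by (rule gs[OF that])
    finally show ?thesis .
  qed
  have mE: "E \<nu> \<in> borel_measurable wm" for \<nu>
  proof -
    have "E \<nu> \<in> borel_measurable borel" unfolding E_def by measurable
    then have "E \<nu> \<in> borel_measurable wm" by (rule borel_measurable_finer) (auto simp: sets_wm)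
    then show ?thesis by measurable
  qed
  have intE: "(\<integral>\<^sup>+u. ennreal (E \<nu> u) \<partial>wm) \<le> ennreal (S * W \<nu>)" for \<nu>
  proof -
    have "(\<integral>\<^sup>+u. ennreal (E \<nu> u) \<partial>wm) = (\<integral>\<^sup>+\<kappa>. (\<integral>\<^sup>+u\<in>cell h \<kappa>. ennreal (E \<nu> u) \<partial>wm) \<partial>count_space UNIV)"
      by (rule nn_integral_cells) (auto simp: sets_wm intro!: measurable_compose[OF mE])
    also have "\<dots> \<le> ennreal (S * W \<nu>)"
    proof (rule nn_integral_count_space_le)
      fix N :: "(int \<times> int) set" assume N: "finite N"
      have "(\<Sum>\<kappa>\<in>N. \<integral>\<^sup>+u\<in>cell h \<kappa>. ennreal (E \<nu> u) \<partial>wm) \<le> (\<Sum>\<kappa>\<in>N. ennreal (M ^ nat \<bar>fst \<kappa> - fst \<nu>\<bar> * M ^ nat \<bar>snd \<kappa> - snd \<nu>\<bar> * G \<kappa> \<nu> * W \<nu>))"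
      proof (rule sum_mono)
        fix \<kappa>
        have "(\<integral>\<^sup>+u\<in>cell h \<kappa>. ennreal (E \<nu> u) \<partial>wm) \<le> (\<integral>\<^sup>+u. ennreal (G \<kappa> \<nu>) * indicator (cell h \<kappa>) u \<partial>wm)"
          using EG[of \<nu>] by (intro nn_integral_mono) (auto simp: indicator_def cell_def intro!: ennreal_leI)
        also have "\<dots> = ennreal (G \<kappa> \<nu>) * ennreal (W \<kappa>)"
          by (subst nn_integral_cmult_indicator) (auto simp: emeasure_cell sets_wm)
        also have "\<dots> = ennreal (G \<kappa> \<nu> * W \<kappa>)" using W[of \<kappa>] by (simp add: ennreal_mult G_def)
        also have "\<dots> \<le> ennreal (G \<kappa> \<nu> * (M ^ nat \<bar>fst \<kappa> - fst \<nu>\<bar> * M ^ nat \<bar>snd \<kappa> - snd \<nu>\<bar> * W \<nu>))"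
          by (intro ennreal_leI mult_left_mono W_le) (simp add: G_def)
        finally show "(\<integral>\<^sup>+u\<in>cell h \<kappa>. ennreal (E \<nu> u) \<partial>wm)
           \<le> ennreal (M ^ nat \<bar>fst \<kappa> - fst \<nu>\<bar> * M ^ nat \<bar>snd \<kappa> - snd \<nu>\<bar> * G \<kappa> \<nu> * W \<nu>)" by (simp add: mult_ac)
      qed
      also have "\<dots> = ennreal ((\<Sum>\<kappa>\<in>N. M ^ nat \<bar>fst \<kappa> - fst \<nu>\<bar> * M ^ nat \<bar>snd \<kappa> - snd \<nu>\<bar> * G \<kappa> \<nu>) * W \<nu>)"
        using M W[of \<nu>] by (subst sum_ennreal) (auto simp: sum_distrib_right G_def)
      also have "\<dots> \<le> ennreal (S * W \<nu>)"
        using gs[OF N] W[of \<nu>] unfolding G_def by (intro ennreal_leI mult_right_mono) auto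
      finally show "(\<Sum>\<kappa>\<in>N. \<integral>\<^sup>+u\<in>cell h \<kappa>. ennreal (E \<nu> u) \<partial>wm) \<le> ennreal (S * W \<nu>)" .
    qed simp
    finally show ?thesis .
  qed
  define C where "C = S powr (p - 1) * S"
  have C: "C > 0" unfolding C_def using S by simp
  have "fock_mass \<alpha> p wm (\<lambda>u. \<Sum>\<nu>\<in>N. c \<nu> * fock_kernel \<alpha> (cell_center h \<nu>) u) \<le> ennreal (C * (\<Sum>\<nu>\<in>N. cmod (c \<nu>) powr p * W \<nu>))"
    if N: "finite N" for N c
  proof -
    have pt: "gauss_mod \<alpha> (\<lambda>u. \<Sum>\<nu>\<in>N. c \<nu> * fock_kernel \<alpha> (cell_center h \<nu>) u) u powr p
        \<le> S powr (p - 1) * (\<Sum>\<nu>\<in>N. E \<nu> u * cmod (c \<nu>) powr p)" for u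
    proof -
      have "gauss_mod \<alpha> (\<lambda>u. \<Sum>\<nu>\<in>N. c \<nu> * fock_kernel \<alpha> (cell_center h \<nu>) u) u
          \<le> (\<Sum>\<nu>\<in>N. cmod (c \<nu> * fock_kernel \<alpha> (cell_center h \<nu>) u)) * exp (- (\<alpha> / 2) * (cmod u)\<^sup>2)"
        unfolding gauss_mod_def by (intro mult_right_mono norm_sum) auto
      also have "\<dots> = (\<Sum>\<nu>\<in>N. E \<nu> u * cmod (c \<nu>))"
        unfolding sum_distrib_right E_def gauss_mod_kern[symmetric] gauss_mod_def
        by (intro sum.cong) (auto simp: norm_mult mult_ac)
      finally have "gauss_mod \<alpha> (\<lambda>u. \<Sum>\<nu>\<in>N. c \<nu> * fock_kernel \<alpha> (cell_center h \<nu>) u) u powr p \<le> (\<Sum>\<nu>\<in>N. E \<nu> u * cmod (c \<nu>)) powr p"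
        using p by (intro powr_mono2) auto
      also have "\<dots> \<le> (\<Sum>\<nu>\<in>N. E \<nu> u) powr (p - 1) * (\<Sum>\<nu>\<in>N. E \<nu> u * cmod (c \<nu>) powr p)"
        using p N E0 by (intro power_mean_sum) auto
      also have "\<dots> \<le> S powr (p - 1) * (\<Sum>\<nu>\<in>N. E \<nu> u * cmod (c \<nu>) powr p)"
        using p E0 sumE[OF N] by (intro mult_right_mono powr_mono2) (auto intro!: sum_nonneg)
      finally show ?thesis .
    qed
    have "fock_mass \<alpha> p wm (\<lambda>u. \<Sum>\<nu>\<in>N. c \<nu> * fock_kernel \<alpha> (cell_center h \<nu>) u)
       \<le> (\<integral>\<^sup>+u. (\<Sum>\<nu>\<in>N. ennreal (S powr (p - 1) * cmod (c \<nu>) powr p) * ennreal (E \<nu> u)) \<partial>wm)"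
      unfolding fock_mass_def
    proof (rule nn_integral_mono)
      fix u
      have "ennreal (S powr (p - 1) * (\<Sum>\<nu>\<in>N. E \<nu> u * cmod (c \<nu>) powr p))
          = (\<Sum>\<nu>\<in>N. ennreal (S powr (p - 1) * cmod (c \<nu>) powr p) * ennreal (E \<nu> u))"
        using E0 by (simp add: ennreal_mult[symmetric] sum_distrib_left mult_ac)
      with ennreal_leI[OF pt[of u]] show "ennreal (gauss_mod \<alpha> (\<lambda>u. \<Sum>\<nu>\<in>N. c \<nu> * fock_kernel \<alpha> (cell_center h \<nu>) u) u powr p)
          \<le> (\<Sum>\<nu>\<in>N. ennreal (S powr (p - 1) * cmod (c \<nu>) powr p) * ennreal (E \<nu> u))"
        by (simp only:)
    qed
    also have "\<dots> = (\<Sum>\<nu>\<in>N. ennreal (S powr (p - 1) * cmod (c \<nu>) powr p) * (\<integral>\<^sup>+u. ennreal (E \<nu> u) \<partial>wm))"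
      using mE by (simp add: nn_integral_sum nn_integral_cmult)
    also have "\<dots> \<le> (\<Sum>\<nu>\<in>N. ennreal (S powr (p - 1) * cmod (c \<nu>) powr p) * ennreal (S * W \<nu>))"
      by (intro sum_mono mult_left_mono intE) auto
    also have "\<dots> = ennreal (C * (\<Sum>\<nu>\<in>N. cmod (c \<nu>) powr p * W \<nu>))"
      using S W by (simp add: ennreal_mult[symmetric] C_def sum_distrib_left mult_ac less_imp_le)
    finally show ?thesis .
  qed
  with C that show ?thesis by blast
qed

text \<open>The local bound for Lebesgue measure. The domain is a box of shifts of the centre, the
  same for all cells and all points u of a cell, so that all cells can be averaged over simultaneous
  shifts. Half side 2 h is enough: u is within h of the centre, and a disc of radius h about u is
  needed.\<close>

lemma cell_average:
  assumes r: "r > 0"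
  obtains C where "C > 0"
    "\<And>f \<nu> u. f holomorphic_on UNIV \<Longrightarrow> u \<in> cell h \<nu> \<Longrightarrow>
      gauss_mod \<alpha> f u powr r \<le> C * integral (cbox (- Complex (2 * h) (2 * h)) (Complex (2 * h) (2 * h)))
         (\<lambda>s. gauss_mod \<alpha> f (cell_center h \<nu> + s) powr r)"
proof -
  obtain C where C: "C > 0" and local: "\<And>f z m V. f holomorphic_on UNIV \<Longrightarrow> sets m = sets lebesgue \<Longrightarrow> V \<ge> 0 \<Longrightarrow>
       ball_lower m 1 2 h z V \<Longrightarrow>
       ennreal (gauss_mod \<alpha> f z powr r * V) \<le> ennreal C * (\<integral>\<^sup>+v\<in>ball z h. ennreal (gauss_mod \<alpha> f v powr r) \<partial>m)"
    using gauss_mod_local_bound[OF less_imp_le[OF \<alpha>] h(1) r, of 2 1] by auto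
  define a where "a = Complex (2 * h) (2 * h)"
  have "gauss_mod \<alpha> f u powr r \<le> C * integral (cbox (- a) a) (\<lambda>s. gauss_mod \<alpha> f (cell_center h \<nu> + s) powr r)"
    if f: "f holomorphic_on UNIV" and u: "u \<in> cell h \<nu>" for f \<nu> u
  proof -
    define F where "F v = gauss_mod \<alpha> f v powr r" for v
    have contF: "continuous_on A F" for A
      unfolding F_def using r by (intro continuous_on_powr' continuous_on_gauss_mod f continuous_intros) auto
    have F0: "F v \<ge> 0" for v by (simp add: F_def)
    define z where "z = cell_center h \<nu>"
    define I where "I = integral (cbox (- a + z) (a + z)) F"
    have I: "(F has_integral I) (cbox (- a + z) (a + z))"
      unfolding I_def by (intro integrable_integral integrable_continuous contF)
    have sub: "ball u h \<subseteq> cbox (- a + z) (a + z)"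
    proof
      fix v assume "v \<in> ball u h"
      then have "cmod (v - z) \<le> 2 * h"
        using cell_center_dist_upper[OF h(1) u] norm_triangle_ineq[of "v - u" "u - z"]
        by (auto simp: z_def dist_norm norm_minus_commute)
      then have "\<bar>Re v - Re z\<bar> \<le> 2 * h" "\<bar>Im v - Im z\<bar> \<le> 2 * h"
        using abs_Re_le_cmod[of "v - z"] abs_Im_le_cmod[of "v - z"] by auto
      then show "v \<in> cbox (- a + z) (a + z)" by (auto simp: in_cbox_complex_iff a_def abs_le_iff)
    qed
    have "ennreal (F u * 1) \<le> ennreal C * (\<integral>\<^sup>+v\<in>ball u h. ennreal (F v) \<partial>lebesgue)"
      unfolding F_def
    proof (rule local[OF f])
      show "ball_lower lebesgue 1 2 h u 1"
        unfolding ball_lower_def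
      proof (intro allI impI)
      fix w :: complex and \<rho> :: real assume "0 < \<rho>"
      have "emeasure lebesgue (ball w \<rho>) = ennreal (pi * \<rho>\<^sup>2)"
        using \<open>0 < \<rho>\<close> by (simp add: emeasure_ball unit_ball_vol_2)
      also have "\<dots> \<ge> ennreal (\<rho>\<^sup>2)"
        using pi_gt3 by (intro ennreal_leI) (simp add: mult_le_cancel_right1)
      finally show "ennreal (1 * \<rho> powr 2 * 1) \<le> emeasure lebesgue (ball w \<rho>)" using \<open>0 < \<rho>\<close> by simp
      qed
    qed auto
    also have "\<dots> \<le> ennreal C * (\<integral>\<^sup>+v. ennreal (F v) * indicator (cbox (- a + z) (a + z)) v \<partial>lebesgue)"
      using sub by (intro mult_left_mono nn_integral_mono) (auto simp: indicator_def)
    also have "\<dots> = ennreal C * (\<integral>\<^sup>+v. ennreal (F v) * indicator (cbox (- a + z) (a + z)) v \<partial>lborel)"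
    proof -
      have "F \<in> borel_measurable borel" using contF by (intro borel_measurable_continuous_onI)
      then show ?thesis by (subst nn_integral_completion) auto
    qed
    also have "\<dots> = ennreal C * ennreal I"
      using nn_integral_has_integral_lebesgue'[OF F0 I] by simp
    also have "\<dots> = ennreal (C * I)" using C I F0 by (simp add: ennreal_mult has_integral_nonneg)
    finally have "F u \<le> C * I"
      using C I F0 by (subst (asm) ennreal_le_iff) (auto simp: has_integral_nonneg)
    also have "I = integral (cbox (- a) a) (F \<circ> (+) z)" unfolding I_def by (rule integral_shift_cbox_plus[symmetric])
    finally show ?thesis by (simp add: F_def z_def o_def)
  qed
  with C that show ?thesis unfolding a_def by blast
qed

end

section \<open>Diagonal operators\<close>

definition fock_set :: "real \<Rightarrow> real \<Rightarrow> complex measure \<Rightarrow> (complex \<Rightarrow> complex) set" where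
  "fock_set \<alpha> p m = {f. f holomorphic_on UNIV \<and> fock_mass \<alpha> p m f < top}"

definition fock_norm :: "real \<Rightarrow> real \<Rightarrow> complex measure \<Rightarrow> (complex \<Rightarrow> complex) \<Rightarrow> real" where
  "fock_norm \<alpha> p m f = enn2real (fock_mass \<alpha> p m f) powr (1 / p)"

lemma fock_norm_nonneg [simp]: "0 \<le> fock_norm \<alpha> p m f"
  by (simp add: fock_norm_def)

lemma fock_norm_powr: "p > 0 \<Longrightarrow> fock_norm \<alpha> p m f powr p = enn2real (fock_mass \<alpha> p m f)"
  by (simp add: fock_norm_def powr_powr)

lemma fock_mass_eq_norm: "p > 0 \<Longrightarrow> fock_mass \<alpha> p m f < top \<Longrightarrow> fock_mass \<alpha> p m f = ennreal (fock_norm \<alpha> p m f powr p)"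
  by (simp add: fock_norm_powr)

lemma fock_norm_leI:
  assumes "p > 0" "B \<ge> 0" "fock_mass \<alpha> p m f \<le> ennreal (B powr p)"
  shows "fock_norm \<alpha> p m f \<le> B"
proof -
  have "enn2real (fock_mass \<alpha> p m f) \<le> B powr p" using assms(3) by (simp add: enn2real_leI)
  then have "enn2real (fock_mass \<alpha> p m f) powr (1/p) \<le> (B powr p) powr (1/p)"
    using assms by (intro powr_mono2) auto
  then show ?thesis using assms by (simp add: fock_norm_def powr_powr)
qed

lemma conj_exp_gt1: "p > 1 \<Longrightarrow> conj_exp p > 1"
  by (simp add: conj_exp_def)

lemma conj_exp_sum: "p > 1 \<Longrightarrow> 1 / p + 1 / conj_exp p = 1"
  by (simp add: conj_exp_def field_simps)

text \<open>
  A finite form of Pietsch domination for the diagonal operator \<open>a\<close> on \<open>\<ell>\<^sup>p\<close>: the functionals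
  \<open>b i\<close> are in the unit ball of the dual and \<open>l\<close> is a measure of mass at most \<open>B\<^sup>r\<close>.
\<close>

definition diag_dom :: "real \<Rightarrow> real \<Rightarrow> 'i set \<Rightarrow> ('i \<Rightarrow> real) \<Rightarrow> real \<Rightarrow> bool" where
  "diag_dom p r N a B \<longleftrightarrow> (\<exists>(I :: 'i set set) l (b :: 'i set \<Rightarrow> 'i \<Rightarrow> complex). finite I \<and> (\<forall>i\<in>I. 0 \<le> l i) \<and>
     (\<forall>i\<in>I. (\<Sum>\<nu>\<in>N. cmod (b i \<nu>) powr conj_exp p) \<le> 1) \<and> sum l I \<le> B powr r \<and>
     (\<forall>x. (\<Sum>\<nu>\<in>N. (a \<nu> * cmod (x \<nu>)) powr p) powr (r / p)
            \<le> (\<Sum>i\<in>I. l i * cmod (\<Sum>\<nu>\<in>N. b i \<nu> * x \<nu>) powr r)))"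

text \<open>As r <= p, the l^p norm of the image sequence is at most its l^r norm, whose r-th power
  is literally the integral of |x \<nu>|^r against masses a \<nu>^r at the coordinate
  functionals.\<close>

lemma diag_dom_coordinates:
  assumes r: "0 < r" "r \<le> p" and N: "finite N" and a: "\<And>\<nu>. \<nu> \<in> N \<Longrightarrow> 0 \<le> a \<nu>"
  shows "diag_dom p r N a ((\<Sum>\<nu>\<in>N. a \<nu> powr r) powr (1 / r))"
proof -
  \<comment> \<open>Singletons, because the definition indexes functionals by sets of indices so as
    to accommodate sign patterns as well.\<close>
  define I where "I = (\<lambda>\<nu>. {\<nu>}) ` N"
  define b :: "'a set \<Rightarrow> 'a \<Rightarrow> complex" where "b i \<nu> = (if \<nu> \<in> i then 1 else 0)" for i \<nu>
  define l where "l i = a (the_elem i) powr r" for i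
  have inj: "inj_on (\<lambda>\<nu>. {\<nu>}) N" by simp
  have pick: "(\<Sum>\<nu>\<in>N. b {\<kappa>} \<nu> * x \<nu>) = x \<kappa>" if "\<kappa> \<in> N" for x :: "'a \<Rightarrow> complex" and \<kappa>
    using N that by (simp add: b_def if_distrib[of "\<lambda>c. c * _"] cong: if_cong)
  have pick1: "(\<Sum>\<nu>\<in>N. cmod (b {\<kappa>} \<nu>) powr conj_exp p) = 1" if "\<kappa> \<in> N" for \<kappa>
  proof -
    have "(\<Sum>\<nu>\<in>N. cmod (b {\<kappa>} \<nu>) powr conj_exp p) = (\<Sum>\<nu>\<in>N. if \<nu> = \<kappa> then 1 else 0)"
      by (intro sum.cong) (auto simp: b_def)
    then show ?thesis using N that by simp
  qed
  have "(\<Sum>\<nu>\<in>N. (a \<nu> * cmod (x \<nu>)) powr p) powr (r / p) \<le> (\<Sum>i\<in>I. l i * cmod (\<Sum>\<nu>\<in>N. b i \<nu> * x \<nu>) powr r)"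
    for x :: "'a \<Rightarrow> complex"
  proof -
    have "(\<Sum>\<nu>\<in>N. (a \<nu> * cmod (x \<nu>)) powr p) \<le> (\<Sum>\<nu>\<in>N. (a \<nu> * cmod (x \<nu>)) powr r) powr (p / r)"
      using r N a by (intro sum_powr_le_powr_sum) auto
    then have "(\<Sum>\<nu>\<in>N. (a \<nu> * cmod (x \<nu>)) powr p) powr (r / p)
        \<le> ((\<Sum>\<nu>\<in>N. (a \<nu> * cmod (x \<nu>)) powr r) powr (p / r)) powr (r / p)"
      using r by (intro powr_mono2) (auto intro: sum_nonneg)
    also have "\<dots> = (\<Sum>\<nu>\<in>N. (a \<nu> * cmod (x \<nu>)) powr r)"
      using r by (simp add: powr_powr sum_nonneg)
    also have "\<dots> = (\<Sum>\<nu>\<in>N. a \<nu> powr r * cmod (\<Sum>\<kappa>\<in>N. b {\<nu>} \<kappa> * x \<kappa>) powr r)"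
      using a pick by (intro sum.cong) (auto simp: powr_mult)
    also have "\<dots> = (\<Sum>i\<in>I. l i * cmod (\<Sum>\<nu>\<in>N. b i \<nu> * x \<nu>) powr r)"
      unfolding I_def by (subst sum.reindex[OF inj]) (simp add: l_def)
    finally show ?thesis .
  qed
  moreover have "sum l I \<le> ((\<Sum>\<nu>\<in>N. a \<nu> powr r) powr (1 / r)) powr r"
    unfolding I_def using r by (subst sum.reindex[OF inj]) (simp add: l_def powr_powr sum_nonneg)
  moreover have "finite I" "\<forall>i\<in>I. 0 \<le> l i" "\<forall>i\<in>I. (\<Sum>\<nu>\<in>N. cmod (b i \<nu>) powr conj_exp p) \<le> 1"
    using N pick1 by (auto simp: I_def l_def)
  ultimately show ?thesis unfolding diag_dom_def by (intro exI[of _ I] exI[of _ l] exI[of _ b]) blast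
qed

text \<open>The signed sums of b \<nu> x \<nu>, all signs equally likely, have mean modulus at least
  a constant times the l^2 norm of b x. Any domination of the diagonal operator by such an l^2 norm,
  with b in the unit ball of l^p', therefore becomes one with r = 1.\<close>

lemma diag_dom_signs:
  fixes a b :: "'i \<Rightarrow> real"
  assumes p: "p > 1" and N: "finite N" and b: "\<And>\<nu>. \<nu> \<in> N \<Longrightarrow> 0 \<le> b \<nu>"
    and bn: "(\<Sum>\<nu>\<in>N. b \<nu> powr conj_exp p) \<le> 1" and B: "B \<ge> 0"
    and dom: "\<And>x. (\<Sum>\<nu>\<in>N. (a \<nu> * cmod (x \<nu>)) powr p) powr (1 / p) \<le> B * sqrt (\<Sum>\<nu>\<in>N. (b \<nu> * cmod (x \<nu>))\<^sup>2)"
  shows "diag_dom p 1 N a (B / Khintchine_lower_const)"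
proof -
  define K where "K = Khintchine_lower_const"
  have K: "K > 0" unfolding K_def by (rule Khintchine_lower_const_pos)
  define l :: "'i set \<Rightarrow> real" where "l A = B / K / 2 ^ card N" for A
  define c :: "'i set \<Rightarrow> 'i \<Rightarrow> complex" where "c A \<nu> = of_real (rsign A \<nu> * b \<nu>)" for A \<nu>
  have "(\<Sum>\<nu>\<in>N. (a \<nu> * cmod (x \<nu>)) powr p) powr (1 / p) \<le> (\<Sum>A\<in>Pow N. l A * cmod (\<Sum>\<nu>\<in>N. c A \<nu> * x \<nu>) powr 1)"
    for x :: "'i \<Rightarrow> complex"
  proof -
    have "(\<Sum>\<nu>\<in>N. (b \<nu> * cmod (x \<nu>))\<^sup>2) = (\<Sum>\<nu>\<in>N. (cmod (of_real (b \<nu>) * x \<nu>))\<^sup>2)"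
      by (simp add: norm_mult power_mult_distrib)
    then have "B * sqrt (\<Sum>\<nu>\<in>N. (b \<nu> * cmod (x \<nu>))\<^sup>2) = B / K * (K * sqrt (\<Sum>\<nu>\<in>N. (cmod (of_real (b \<nu>) * x \<nu>))\<^sup>2))"
      using K by simp
    also have "\<dots> \<le> B / K * ((\<Sum>A\<in>Pow N. cmod (\<Sum>\<nu>\<in>N. rsign A \<nu> *\<^sub>R (of_real (b \<nu>) * x \<nu>))) / 2 ^ card N)"
      using B K unfolding K_def by (intro mult_left_mono Khintchine_lower N) auto
    also have "\<dots> = (\<Sum>A\<in>Pow N. l A * cmod (\<Sum>\<nu>\<in>N. c A \<nu> * x \<nu>) powr 1)"
      by (simp add: l_def c_def sum_distrib_left scaleR_conv_of_real sum_divide_distrib mult_ac)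
    finally show ?thesis using dom[of x] by linarith
  qed
  moreover have "sum l (Pow N) \<le> (B / K) powr 1"
    using B K N by (simp add: l_def card_Pow)
  moreover have "(\<Sum>\<nu>\<in>N. cmod (c A \<nu>) powr conj_exp p) \<le> 1" for A
  proof -
    have "(\<Sum>\<nu>\<in>N. cmod (c A \<nu>) powr conj_exp p) = (\<Sum>\<nu>\<in>N. b \<nu> powr conj_exp p)"
      using b by (intro sum.cong) (auto simp: c_def rsign_def norm_mult)
    then show ?thesis using bn by simp
  qed
  moreover have "\<forall>A\<in>Pow N. 0 \<le> l A" using B K by (simp add: l_def)
  ultimately show ?thesis unfolding diag_dom_def K_def[symmetric] using N
    by (intro exI[of _ "Pow N"] exI[of _ l] exI[of _ c]) auto
qed

lemma diag_dom_zero: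
  assumes "\<And>\<nu>. \<nu> \<in> N \<Longrightarrow> a \<nu> = 0" "p > 0"
  shows "diag_dom p r N a B"
  unfolding diag_dom_def using assms
  by (intro exI[of _ "{}"]) (simp add: sum.neutral)

text \<open>The l^p norm of a x is bounded by a weighted l^2 norm of x through Hoelder's inequality
  with exponents 2/p and 2/(2 - p), after writing a^p as (a^(2/q))^p a^(2 - p).\<close>

lemma diag_dom_lt2:
  fixes a :: "'i \<Rightarrow> real"
  assumes p: "1 < p" "p < 2" and N: "finite N" and a: "\<And>\<nu>. \<nu> \<in> N \<Longrightarrow> 0 \<le> a \<nu>"
  shows "diag_dom p 1 N a ((\<Sum>\<nu>\<in>N. a \<nu> powr 2) powr (1 / 2) / Khintchine_lower_const)"
proof -
  define T where "T = (\<Sum>\<nu>\<in>N. a \<nu> powr 2)"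
  define q where "q = conj_exp p"
  have q: "q > 1" "1/p + 1/q = 1" unfolding q_def using p by (auto intro: conj_exp_gt1 conj_exp_sum)
  have q': "1/q = 1 - 1/p" using q by simp
  show ?thesis
  proof (cases "T = 0")
    case True
    then have "a \<nu> = 0" if "\<nu> \<in> N" for \<nu>
      using that N unfolding T_def by (subst (asm) sum_nonneg_eq_0_iff) auto
    then show ?thesis using p by (intro diag_dom_zero) auto
  next
    case False
    then have T: "T > 0" unfolding T_def by (simp add: less_le sum_nonneg)
    \<comment> \<open>b^q is a^2 divided by its sum T, which puts b in the unit ball of l^q; the
      factor left over in Hoelder's inequality also sums to T, and the powers of T combine to
      T^(1/2).\<close>
    define b where "b \<nu> = a \<nu> powr (2/q) / T powr (1/q)" for \<nu>
    have "(\<Sum>\<nu>\<in>N. b \<nu> powr q) = (\<Sum>\<nu>\<in>N. a \<nu> powr 2 / T)"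
      using q T by (intro sum.cong) (auto simp: b_def powr_divide powr_powr)
    also have "\<dots> = 1" using T by (simp add: sum_divide_distrib[symmetric] T_def[symmetric])
    finally have bn: "(\<Sum>\<nu>\<in>N. b \<nu> powr q) \<le> 1" by simp
    have dom: "(\<Sum>\<nu>\<in>N. (a \<nu> * cmod (x \<nu>)) powr p) powr (1 / p) \<le> T powr (1/2) * sqrt (\<Sum>\<nu>\<in>N. (b \<nu> * cmod (x \<nu>))\<^sup>2)"
      for x :: "'i \<Rightarrow> complex"
    proof -
      define P where "P = 2 / p"
      define Q where "Q = 2 / (2 - p)"
      define R where "R = (\<Sum>\<nu>\<in>N. (a \<nu> powr (2/q) * cmod (x \<nu>)) powr 2)"
      have R0: "R \<ge> 0" by (simp add: R_def sum_nonneg)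
      have e1: "2 - p + p * (2 / q) = p"
      proof -
        have "p * (2 / q) = 2 * (p * (1/q))" by simp
        also have "p * (1/q) = p - 1" unfolding q' using p by (simp add: right_diff_distrib)
        finally show ?thesis by simp
      qed
      have "(\<Sum>\<nu>\<in>N. (a \<nu> * cmod (x \<nu>)) powr p) = (\<Sum>\<nu>\<in>N. (a \<nu> powr (2/q) * cmod (x \<nu>)) powr p * a \<nu> powr (2 - p))"
      proof (rule sum.cong)
        fix \<nu> assume "\<nu> \<in> N"
        have "a \<nu> powr p = a \<nu> powr (2 - p + p * (2/q))" by (simp only: e1)
        also have "\<dots> = a \<nu> powr (2 - p) * (a \<nu> powr (2/q)) powr p" by (simp add: powr_add powr_powr mult.commute)
        finally show "(a \<nu> * cmod (x \<nu>)) powr p = (a \<nu> powr (2/q) * cmod (x \<nu>)) powr p * a \<nu> powr (2 - p)"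
          using a[OF \<open>\<nu> \<in> N\<close>] by (simp add: powr_mult mult_ac)
      qed simp
      also have "\<dots> \<le> (\<Sum>\<nu>\<in>N. ((a \<nu> powr (2/q) * cmod (x \<nu>)) powr p) powr P) powr (1/P) * (\<Sum>\<nu>\<in>N. (a \<nu> powr (2 - p)) powr Q) powr (1/Q)"
        using p N by (intro Holder_sum) (auto simp: P_def Q_def field_simps)
      also have "(\<Sum>\<nu>\<in>N. ((a \<nu> powr (2/q) * cmod (x \<nu>)) powr p) powr P) = R"
        using p by (simp add: R_def P_def powr_powr)
      also have "(\<Sum>\<nu>\<in>N. (a \<nu> powr (2 - p)) powr Q) = T"
      proof -
        have "2 - p \<noteq> 0" using p by simp
        then have "(2 - p) * Q = 2"
          unfolding Q_def times_divide_eq_right by (rule nonzero_mult_div_cancel_left)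
        then show ?thesis by (simp add: T_def powr_powr)
      qed
      finally have "(\<Sum>\<nu>\<in>N. (a \<nu> * cmod (x \<nu>)) powr p) powr (1/p) \<le> (R powr (1/P) * T powr (1/Q)) powr (1/p)"
        using p by (intro powr_mono2) (auto intro: sum_nonneg)
      also have "\<dots> = R powr (1/2) * T powr (1/p - 1/2)"
      proof -
        have "1 / P * (1 / p) = 1/2" "1 / Q * (1 / p) = 1/p - 1/2"
          using p by (simp_all add: P_def Q_def field_simps)
        then show ?thesis using R0 T by (simp only: powr_mult powr_powr less_imp_le powr_ge_zero)
      qed
      also have "R = T powr (2/q) * (\<Sum>\<nu>\<in>N. (b \<nu> * cmod (x \<nu>))\<^sup>2)"
        unfolding R_def sum_distrib_left using T
      proof (intro sum.cong)
        fix \<nu>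
        have "T powr (2/q) = (T powr (1/q))\<^sup>2" by (simp add: power2_eq_square powr_add[symmetric])
        then have "T powr (2/q) * (b \<nu> * cmod (x \<nu>))\<^sup>2 = (a \<nu> powr (2/q) * cmod (x \<nu>))\<^sup>2"
          using T by (simp add: b_def power_mult_distrib power_divide)
        then show "(a \<nu> powr (2/q) * cmod (x \<nu>)) powr 2 = T powr (2/q) * (b \<nu> * cmod (x \<nu>))\<^sup>2" by simp
      qed simp
      also have "(T powr (2/q) * (\<Sum>\<nu>\<in>N. (b \<nu> * cmod (x \<nu>))\<^sup>2)) powr (1/2) * T powr (1/p - 1/2)
          = (T powr (1/q) * T powr (1/p - 1/2)) * sqrt (\<Sum>\<nu>\<in>N. (b \<nu> * cmod (x \<nu>))\<^sup>2)"
        using T by (simp add: powr_mult powr_powr powr_half_sqrt sum_nonneg)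
      also have "T powr (1/q) * T powr (1/p - 1/2) = T powr (1/2)"
        unfolding powr_add[symmetric] q' by simp
      finally show ?thesis .
    qed
    show ?thesis unfolding T_def[symmetric]
      by (rule diag_dom_signs[OF p(1) N _ bn[unfolded q_def] _ dom]) (auto simp: b_def)
  qed
qed

text \<open>For p >= 2 the l^2 norm already dominates the l^p norm, so b is simply a divided by its
  l^p' norm.\<close>

lemma diag_dom_ge2:
  fixes a :: "'i \<Rightarrow> real"
  assumes p: "2 \<le> p" and N: "finite N" and a: "\<And>\<nu>. \<nu> \<in> N \<Longrightarrow> 0 \<le> a \<nu>"
  shows "diag_dom p 1 N a ((\<Sum>\<nu>\<in>N. a \<nu> powr conj_exp p) powr (1 / conj_exp p) / Khintchine_lower_const)"
proof -
  define q where "q = conj_exp p"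
  have q: "q > 1" unfolding q_def using p by (intro conj_exp_gt1) auto
  define T where "T = (\<Sum>\<nu>\<in>N. a \<nu> powr q)"
  show ?thesis
  proof (cases "T = 0")
    case True
    then have "a \<nu> = 0" if "\<nu> \<in> N" for \<nu>
      using that N unfolding T_def by (subst (asm) sum_nonneg_eq_0_iff) auto
    then show ?thesis using p by (intro diag_dom_zero) auto
  next
    case False
    then have T: "T > 0" unfolding T_def by (simp add: less_le sum_nonneg)
    define S where "S = T powr (1/q)"
    have S: "S > 0" using T by (simp add: S_def)
    define b where "b \<nu> = a \<nu> / S" for \<nu>
    have "(\<Sum>\<nu>\<in>N. b \<nu> powr q) = (\<Sum>\<nu>\<in>N. a \<nu> powr q / T)"
      using q T a by (intro sum.cong) (auto simp: b_def S_def powr_divide powr_powr)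
    also have "\<dots> = 1" using T by (simp add: sum_divide_distrib[symmetric] T_def[symmetric])
    finally have bn: "(\<Sum>\<nu>\<in>N. b \<nu> powr q) \<le> 1" by simp
    have dom: "(\<Sum>\<nu>\<in>N. (a \<nu> * cmod (x \<nu>)) powr p) powr (1 / p) \<le> S * sqrt (\<Sum>\<nu>\<in>N. (b \<nu> * cmod (x \<nu>))\<^sup>2)"
      for x :: "'i \<Rightarrow> complex"
    proof -
      define R where "R = (\<Sum>\<nu>\<in>N. (a \<nu> * cmod (x \<nu>))\<^sup>2)"
      have R0: "R \<ge> 0" by (simp add: R_def sum_nonneg)
      have "(\<Sum>\<nu>\<in>N. (a \<nu> * cmod (x \<nu>)) powr p) \<le> (\<Sum>\<nu>\<in>N. (a \<nu> * cmod (x \<nu>)) powr 2) powr (p / 2)"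
        using p N a by (intro sum_powr_le_powr_sum) auto
      also have "(\<Sum>\<nu>\<in>N. (a \<nu> * cmod (x \<nu>)) powr 2) = R"
        unfolding R_def using a by (intro sum.cong) auto
      finally have "(\<Sum>\<nu>\<in>N. (a \<nu> * cmod (x \<nu>)) powr p) powr (1/p) \<le> (R powr (p/2)) powr (1/p)"
        using p by (intro powr_mono2) (auto intro: sum_nonneg)
      also have "\<dots> = sqrt R" using p R0 by (simp add: powr_powr powr_half_sqrt)
      also have "R = S\<^sup>2 * (\<Sum>\<nu>\<in>N. (b \<nu> * cmod (x \<nu>))\<^sup>2)"
        unfolding R_def sum_distrib_left using S
        by (intro sum.cong) (auto simp: b_def power_mult_distrib power_divide)
      finally show ?thesis using S by (simp add: real_sqrt_mult)
    qed
    show ?thesis unfolding T_def[symmetric] S_def[symmetric] q_def[symmetric]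
      by (rule diag_dom_signs[OF _ N _ bn[unfolded q_def] _ dom]) (use p a S in \<open>auto simp: b_def\<close>)
  qed
qed

section \<open>Upper bounds\<close>

context fock_lattice
begin

text \<open>Large enough that the shifted centres cover the disc of radius h about every point of
  the cell, small enough that they stay within the distance 4 h allowed in sampling.\<close>

definition shift_box :: "complex set" where
  "shift_box = cbox (- Complex (2 * h) (2 * h)) (Complex (2 * h) (2 * h))"

text \<open>Linear in f for fixed s, in contrast to the Gaussian modulus, which is recovered as its
  absolute value up to the factor W \<nu>^(1/p). As \<nu> varies it is the sampling operator into
  l^p.\<close>

definition point_eval :: "complex \<Rightarrow> (complex \<Rightarrow> complex) \<Rightarrow> int \<times> int \<Rightarrow> complex" where
  "point_eval s f \<nu> = of_real (W \<nu> powr (1/p) * exp (- (\<alpha> / 2) * (cmod (cell_center h \<nu> + s))\<^sup>2)) * f (cell_center h \<nu> + s)"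

lemma cmod_point_eval: "cmod (point_eval s f \<nu>) = W \<nu> powr (1/p) * gauss_mod \<alpha> f (cell_center h \<nu> + s)"
  by (simp add: point_eval_def gauss_mod_def norm_mult mult_ac)

lemma continuous_on_point_eval:
  assumes "f holomorphic_on UNIV"
  shows "continuous_on A (\<lambda>s. point_eval s f \<nu>)"
proof -
  have "continuous_on UNIV f" using assms by (rule holomorphic_on_imp_continuous_on)
  then have "continuous_on A (\<lambda>s. f (cell_center h \<nu> + s))"
    by (rule continuous_on_compose2) (auto intro!: continuous_intros)
  then show ?thesis unfolding point_eval_def by (intro continuous_intros)
qed

text \<open>Sampling bounds the l^p norm of the point values by the Fock norm, uniformly in the
  shift s, and Hoelder's inequality pairs them with b in the unit ball of l^p'.\<close>

lemma point_eval_functional: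
  obtains C where "C > 0"
    "\<And>N b s. finite N \<Longrightarrow> s \<in> shift_box \<Longrightarrow> (\<Sum>\<nu>\<in>N. cmod (b \<nu>) powr conj_exp p) \<le> 1 \<Longrightarrow>
      (\<lambda>f. (\<Sum>\<nu>\<in>N. b \<nu> * point_eval s f \<nu>) / of_real C) \<in> dual_ball (fock_set \<alpha> p wm) (fock_norm \<alpha> p wm)"
proof -
  obtain C where C: "C > 0" and samp: "\<And>f N \<zeta>. f holomorphic_on UNIV \<Longrightarrow> finite N \<Longrightarrow> (\<And>\<nu>. \<nu> \<in> N \<Longrightarrow> cmod (\<zeta> \<nu> - cell_center h \<nu>) \<le> 4 * h) \<Longrightarrow>
      ennreal (\<Sum>\<nu>\<in>N. W \<nu> * gauss_mod \<alpha> f (\<zeta> \<nu>) powr p) \<le> ennreal C * fock_mass \<alpha> p wm f"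
    using sampling by blast
  define K where "K = C powr (1/p)"
  have K: "K > 0" unfolding K_def using C by simp
  have "(\<lambda>f. (\<Sum>\<nu>\<in>N. b \<nu> * point_eval s f \<nu>) / of_real K) \<in> dual_ball (fock_set \<alpha> p wm) (fock_norm \<alpha> p wm)"
    if N: "finite N" and s: "s \<in> shift_box" and b: "(\<Sum>\<nu>\<in>N. cmod (b \<nu>) powr conj_exp p) \<le> 1" for N b s
    unfolding dual_ball_def
  proof (intro CollectI conjI ballI allI)
    fix f g :: "complex \<Rightarrow> complex"
    show "(\<Sum>\<nu>\<in>N. b \<nu> * point_eval s (\<lambda>s. f s + g s) \<nu>) / of_real K
        = (\<Sum>\<nu>\<in>N. b \<nu> * point_eval s f \<nu>) / of_real K + (\<Sum>\<nu>\<in>N. b \<nu> * point_eval s g \<nu>) / of_real K"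
      by (simp add: point_eval_def add_divide_distrib[symmetric] sum.distrib[symmetric] distrib_left)
  next
    fix c and f :: "complex \<Rightarrow> complex"
    have "(\<Sum>\<nu>\<in>N. b \<nu> * point_eval s (\<lambda>s. c * f s) \<nu>) = c * (\<Sum>\<nu>\<in>N. b \<nu> * point_eval s f \<nu>)"
      unfolding sum_distrib_left by (intro sum.cong) (simp_all add: point_eval_def mult_ac)
    then show "(\<Sum>\<nu>\<in>N. b \<nu> * point_eval s (\<lambda>s. c * f s) \<nu>) / of_real K = c * ((\<Sum>\<nu>\<in>N. b \<nu> * point_eval s f \<nu>) / of_real K)"
      by simp
  next
    fix f assume "f \<in> fock_set \<alpha> p wm"
    then have f: "f holomorphic_on UNIV" and fin: "fock_mass \<alpha> p wm f < top" by (auto simp: fock_set_def)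
    have sh: "cmod s \<le> 4 * h"
    proof -
      have "\<bar>Re s\<bar> \<le> 2 * h" "\<bar>Im s\<bar> \<le> 2 * h" using s by (auto simp: shift_box_def in_cbox_complex_iff)
      then show ?thesis using cmod_le[of s] by linarith
    qed
    have "ennreal (\<Sum>\<nu>\<in>N. W \<nu> * gauss_mod \<alpha> f (cell_center h \<nu> + s) powr p) \<le> ennreal C * fock_mass \<alpha> p wm f"
      using sh by (intro samp f N) auto
    also have "\<dots> = ennreal (C * fock_norm \<alpha> p wm f powr p)"
      using p C by (subst fock_mass_eq_norm[OF _ fin]) (auto simp: ennreal_mult)
    finally have S: "(\<Sum>\<nu>\<in>N. W \<nu> * gauss_mod \<alpha> f (cell_center h \<nu> + s) powr p) \<le> C * fock_norm \<alpha> p wm f powr p"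
      using C by (subst (asm) ennreal_le_iff) auto
    have "cmod (\<Sum>\<nu>\<in>N. b \<nu> * point_eval s f \<nu>) \<le> (\<Sum>\<nu>\<in>N. cmod (point_eval s f \<nu>) * cmod (b \<nu>))"
      by (rule order_trans[OF norm_sum]) (simp add: norm_mult mult.commute)
    also have "\<dots> \<le> (\<Sum>\<nu>\<in>N. cmod (point_eval s f \<nu>) powr p) powr (1/p)
                   * (\<Sum>\<nu>\<in>N. cmod (b \<nu>) powr conj_exp p) powr (1/conj_exp p)"
      by (intro Holder_sum p conj_exp_sum N) auto
    also have "\<dots> \<le> (C * fock_norm \<alpha> p wm f powr p) powr (1/p) * 1"
    proof (intro mult_mono)
      have "(\<Sum>\<nu>\<in>N. cmod (point_eval s f \<nu>) powr p) = (\<Sum>\<nu>\<in>N. W \<nu> * gauss_mod \<alpha> f (cell_center h \<nu> + s) powr p)"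
        using p W by (intro sum.cong) (auto simp: cmod_point_eval powr_mult powr_powr less_imp_le)
      then show "(\<Sum>\<nu>\<in>N. cmod (point_eval s f \<nu>) powr p) powr (1/p) \<le> (C * fock_norm \<alpha> p wm f powr p) powr (1/p)"
        using S p by (intro powr_mono2) (auto intro!: sum_nonneg simp: less_imp_le[OF W])
      have "(\<Sum>\<nu>\<in>N. cmod (b \<nu>) powr conj_exp p) powr (1/conj_exp p) \<le> 1 powr (1/conj_exp p)"
        using b conj_exp_gt1[OF p] by (intro powr_mono2) (auto intro: sum_nonneg)
      then show "(\<Sum>\<nu>\<in>N. cmod (b \<nu>) powr conj_exp p) powr (1/conj_exp p) \<le> 1" by simp
    qed auto
    also have "\<dots> = K * fock_norm \<alpha> p wm f" using C p by (simp add: K_def powr_mult powr_powr)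
    finally show "cmod ((\<Sum>\<nu>\<in>N. b \<nu> * point_eval s f \<nu>) / of_real K) \<le> fock_norm \<alpha> p wm f"
      using K by (simp add: norm_divide field_simps)
  qed
  with K that show ?thesis by blast
qed

definition cell_avg :: "real \<Rightarrow> (complex \<Rightarrow> complex) \<Rightarrow> int \<times> int \<Rightarrow> real" where
  "cell_avg r f \<nu> = integral shift_box (\<lambda>s. gauss_mod \<alpha> f (cell_center h \<nu> + s) powr r)"

lemma continuous_on_gauss_mod_shift:
  "f holomorphic_on UNIV \<Longrightarrow> r > 0 \<Longrightarrow> continuous_on A (\<lambda>s. gauss_mod \<alpha> f (z + s) powr r)"
proof -
  assume f: "f holomorphic_on UNIV" and r: "r > 0"
  have "continuous_on A (\<lambda>s. gauss_mod \<alpha> f (z + s))"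
    by (rule continuous_on_compose2[OF continuous_on_gauss_mod[OF f, of UNIV]]) (auto intro!: continuous_intros)
  then show ?thesis using r by (intro continuous_on_powr' continuous_intros) auto
qed

lemma cell_avg_nonneg: "f holomorphic_on UNIV \<Longrightarrow> r > 0 \<Longrightarrow> 0 \<le> cell_avg r f \<nu>"
  unfolding cell_avg_def shift_box_def by (intro integral_nonneg integrable_continuous continuous_on_gauss_mod_shift) auto

text \<open>For each shift s the domination is applied to the point values at all shifted centres at
  once. Minkowski's inequality, with exponent p / r >= 1, takes the average over s outside; what is
  averaged is an integral against the Pietsch measure of functionals that are K times elements of
  the dual ball, so its mass B^r and the bound V finish the estimate.\<close>

lemma diag_dom_transfer:
  assumes r: "1 \<le> r" "r \<le> p"
  obtains C where "C > 0"
    "\<And>N a B J f V. finite N \<Longrightarrow> (\<And>\<nu>. \<nu> \<in> N \<Longrightarrow> 0 \<le> a \<nu>) \<Longrightarrow> diag_dom p r N a B \<Longrightarrow> finite J \<Longrightarrow>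
      (\<And>j. j \<in> J \<Longrightarrow> f j \<in> fock_set \<alpha> p wm) \<Longrightarrow>
      (\<And>\<phi>. \<phi> \<in> dual_ball (fock_set \<alpha> p wm) (fock_norm \<alpha> p wm) \<Longrightarrow> (\<Sum>j\<in>J. cmod (\<phi> (f j)) powr r) \<le> V) \<Longrightarrow>
      (\<Sum>j\<in>J. (\<Sum>\<nu>\<in>N. a \<nu> powr p * W \<nu> * cell_avg r (f j) \<nu> powr (p / r)) powr (r / p)) \<le> C * B powr r * V"
proof -
  obtain K where K: "K > 0" and fn: "\<And>N b s. finite N \<Longrightarrow> s \<in> shift_box \<Longrightarrow> (\<Sum>\<nu>\<in>N. cmod (b \<nu>) powr conj_exp p) \<le> 1 \<Longrightarrow>
      (\<lambda>f. (\<Sum>\<nu>\<in>N. b \<nu> * point_eval s f \<nu>) / of_real K) \<in> dual_ball (fock_set \<alpha> p wm) (fock_norm \<alpha> p wm)"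
    using point_eval_functional by blast
  \<comment> \<open>The summand 1 makes D positive without evaluating the measure of the
    box.\<close>
  define D where "D = measure lborel shift_box + 1"
  have D: "D > 0" "measure lborel shift_box \<le> D" using measure_nonneg[of lborel shift_box] by (simp_all add: D_def add_nonneg_pos)
  define C where "C = D * K powr r"
  have C: "C > 0" unfolding C_def using D K by simp
  have "(\<Sum>j\<in>J. (\<Sum>\<nu>\<in>N. a \<nu> powr p * W \<nu> * cell_avg r (f j) \<nu> powr (p / r)) powr (r / p)) \<le> C * B powr r * V"
    if N: "finite N" and a: "\<And>\<nu>. \<nu> \<in> N \<Longrightarrow> 0 \<le> a \<nu>" and dd: "diag_dom p r N a B" and J: "finite J"
      and f: "\<And>j. j \<in> J \<Longrightarrow> f j \<in> fock_set \<alpha> p wm"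
      and V: "\<And>\<phi>. \<phi> \<in> dual_ball (fock_set \<alpha> p wm) (fock_norm \<alpha> p wm) \<Longrightarrow> (\<Sum>j\<in>J. cmod (\<phi> (f j)) powr r) \<le> V"
    for N and a :: "int \<times> int \<Rightarrow> real" and B and J :: "'j set" and f V
  proof -
    have fh: "f j holomorphic_on UNIV" if "j \<in> J" for j using f[OF that] by (simp add: fock_set_def)
    have V0: "V \<ge> 0" using V[OF dual_ball_zero] by simp
    obtain I :: "(int \<times> int) set set" and l and b :: "(int \<times> int) set \<Rightarrow> int \<times> int \<Rightarrow> complex"
      where I: "finite I" and l': "\<forall>i\<in>I. 0 \<le> l i"
      and b': "\<forall>i\<in>I. (\<Sum>\<nu>\<in>N. cmod (b i \<nu>) powr conj_exp p) \<le> 1" and lB: "sum l I \<le> B powr r"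
      and dom': "\<forall>x. (\<Sum>\<nu>\<in>N. (a \<nu> * cmod (x \<nu>)) powr p) powr (r / p)
            \<le> (\<Sum>i\<in>I. l i * cmod (\<Sum>\<nu>\<in>N. b i \<nu> * x \<nu>) powr r)"
      using dd unfolding diag_dom_def by blast
    note l = l'[rule_format] and b = b'[rule_format] and dom = dom'[rule_format]
    define \<Phi> where "\<Phi> j s = (\<Sum>i\<in>I. l i * cmod (\<Sum>\<nu>\<in>N. b i \<nu> * point_eval s (f j) \<nu>) powr r)" for j s
    have cont\<Phi>: "continuous_on shift_box (\<Phi> j)" if "j \<in> J" for j
      unfolding \<Phi>_def using r
      by (intro continuous_on_sum continuous_on_mult continuous_on_const continuous_on_powr' continuous_on_norm continuous_on_point_eval fh that) auto
    have "(\<Sum>\<nu>\<in>N. a \<nu> powr p * W \<nu> * cell_avg r (f j) \<nu> powr (p / r)) powr (r / p) \<le> integral shift_box (\<Phi> j)"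
      if j: "j \<in> J" for j
    proof -
      have "(\<Sum>\<nu>\<in>N. (a \<nu> powr p * W \<nu>) * integral shift_box (\<lambda>s. gauss_mod \<alpha> (f j) (cell_center h \<nu> + s) powr r) powr (p / r)) powr (1 / (p / r))
         \<le> integral shift_box (\<lambda>s. (\<Sum>\<nu>\<in>N. (a \<nu> powr p * W \<nu>) * (gauss_mod \<alpha> (f j) (cell_center h \<nu> + s) powr r) powr (p / r)) powr (1 / (p / r)))"
        unfolding shift_box_def using r N W fh[OF j]
        by (intro Minkowski_integral continuous_on_gauss_mod_shift) (auto simp: less_imp_le)
      also have "\<dots> \<le> integral shift_box (\<Phi> j)"
      proof (rule integral_le)
        show "\<Phi> j integrable_on shift_box"
          using cont\<Phi>[OF j] unfolding shift_box_def by (intro integrable_continuous)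
        show "(\<lambda>s. (\<Sum>\<nu>\<in>N. (a \<nu> powr p * W \<nu>) * (gauss_mod \<alpha> (f j) (cell_center h \<nu> + s) powr r) powr (p / r)) powr (1 / (p / r))) integrable_on shift_box"
          unfolding shift_box_def using r N W fh[OF j]
          by (intro integrable_continuous continuous_on_powr' continuous_on_sum continuous_on_mult continuous_on_const continuous_on_gauss_mod_shift)
             (auto simp: less_imp_le intro!: sum_nonneg)
        fix s assume "s \<in> shift_box"
        have "(\<Sum>\<nu>\<in>N. (a \<nu> powr p * W \<nu>) * (gauss_mod \<alpha> (f j) (cell_center h \<nu> + s) powr r) powr (p / r))
            = (\<Sum>\<nu>\<in>N. (a \<nu> * cmod (point_eval s (f j) \<nu>)) powr p)"
          using a W r p by (intro sum.cong) (auto simp: cmod_point_eval powr_mult powr_powr less_imp_le)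
        then show "(\<Sum>\<nu>\<in>N. (a \<nu> powr p * W \<nu>) * (gauss_mod \<alpha> (f j) (cell_center h \<nu> + s) powr r) powr (p / r)) powr (1 / (p / r)) \<le> \<Phi> j s"
          using dom[of "point_eval s (f j)"] by (simp add: \<Phi>_def)
      qed
      finally show ?thesis by (simp add: cell_avg_def)
    qed
    then have "(\<Sum>j\<in>J. (\<Sum>\<nu>\<in>N. a \<nu> powr p * W \<nu> * cell_avg r (f j) \<nu> powr (p / r)) powr (r / p)) \<le> (\<Sum>j\<in>J. integral shift_box (\<Phi> j))"
      by (rule sum_mono)
    also have "\<dots> = integral shift_box (\<lambda>s. \<Sum>j\<in>J. \<Phi> j s)"
      using cont\<Phi> unfolding shift_box_def by (intro integral_sum[symmetric] integrable_continuous J)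
    also have "\<dots> \<le> integral shift_box (\<lambda>s. K powr r * B powr r * V)"
    proof (rule integral_le)
      show "(\<lambda>s. \<Sum>j\<in>J. \<Phi> j s) integrable_on shift_box"
        using cont\<Phi> unfolding shift_box_def by (intro integrable_continuous continuous_on_sum)
      show "(\<lambda>s. K powr r * B powr r * V) integrable_on shift_box"
        unfolding shift_box_def by (intro integrable_continuous continuous_on_const)
      fix s assume s: "s \<in> shift_box"
      \<comment> \<open>Exchanging the sums puts the sum over the family innermost, where V bounds
        it for each single functional i.\<close>
      have "(\<Sum>j\<in>J. \<Phi> j s) = (\<Sum>i\<in>I. l i * (\<Sum>j\<in>J. cmod (\<Sum>\<nu>\<in>N. b i \<nu> * point_eval s (f j) \<nu>) powr r))"
        unfolding \<Phi>_def sum_distrib_left by (rule sum.swap)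
      also have "\<dots> \<le> (\<Sum>i\<in>I. l i * (K powr r * V))"
      proof (intro sum_mono mult_left_mono l)
        fix i assume i: "i \<in> I"
        have "(\<Sum>j\<in>J. cmod (\<Sum>\<nu>\<in>N. b i \<nu> * point_eval s (f j) \<nu>) powr r)
            = K powr r * (\<Sum>j\<in>J. cmod ((\<Sum>\<nu>\<in>N. b i \<nu> * point_eval s (f j) \<nu>) / of_real K) powr r)"
          using K by (simp add: norm_divide powr_divide sum_distrib_left)
        also have "\<dots> \<le> K powr r * V"
          using V[OF fn[OF N s b[OF i]]] by (intro mult_left_mono) auto
        finally show "(\<Sum>j\<in>J. cmod (\<Sum>\<nu>\<in>N. b i \<nu> * point_eval s (f j) \<nu>) powr r) \<le> K powr r * V" .
      qed
      also have "\<dots> = sum l I * (K powr r * V)" by (simp add: sum_distrib_right)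
      also have "\<dots> \<le> B powr r * (K powr r * V)" using lB V0 by (intro mult_right_mono) auto
      finally show "(\<Sum>j\<in>J. \<Phi> j s) \<le> K powr r * B powr r * V" by (simp add: mult_ac)
    qed
    also have "\<dots> = measure lborel shift_box * (K powr r * B powr r * V)" unfolding shift_box_def by simp
    also have "\<dots> \<le> D * (K powr r * B powr r * V)" using D V0 by (intro mult_right_mono) auto
    finally show ?thesis by (simp add: C_def mult_ac)
  qed
  with C that show ?thesis by blast
qed

lemma fock_mass_le_cells:
  assumes mu: "sets \<mu> = sets borel" and f: "f holomorphic_on UNIV"
    and G: "\<And>\<nu> u. u \<in> cell h \<nu> \<Longrightarrow> gauss_mod \<alpha> f u powr p \<le> G \<nu>" and m: "\<And>\<nu>. emeasure \<mu> (cell h \<nu>) = ennreal (m \<nu>)"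
    and m0: "\<And>\<nu>. 0 \<le> m \<nu>"
    and bd: "\<And>N. finite N \<Longrightarrow> (\<Sum>\<nu>\<in>N. m \<nu> * G \<nu>) \<le> L"
  shows "fock_mass \<alpha> p \<mu> f \<le> ennreal L"
proof -
  have ms: "(\<lambda>u. ennreal (gauss_mod \<alpha> f u powr p)) \<in> borel_measurable \<mu>"
    using mu by (intro gauss_mod_measurable f) auto
  have G0: "G \<nu> \<ge> 0" for \<nu>
    using G[of "cell_center h \<nu>" \<nu>] cell_index_cell_center[OF h(1), of \<nu>] by (smt (verit) cell_def mem_Collect_eq powr_ge_zero)
  have "fock_mass \<alpha> p \<mu> f = (\<integral>\<^sup>+\<nu>. (\<integral>\<^sup>+u\<in>cell h \<nu>. ennreal (gauss_mod \<alpha> f u powr p) \<partial>\<mu>) \<partial>count_space UNIV)"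
    unfolding fock_mass_def using mu by (intro nn_integral_cells ms) auto
  also have "\<dots> \<le> ennreal L"
  proof (rule nn_integral_count_space_le)
    fix N :: "(int \<times> int) set" assume N: "finite N"
    have "(\<Sum>\<nu>\<in>N. \<integral>\<^sup>+u\<in>cell h \<nu>. ennreal (gauss_mod \<alpha> f u powr p) \<partial>\<mu>) \<le> (\<Sum>\<nu>\<in>N. ennreal (m \<nu> * G \<nu>))"
    proof (rule sum_mono)
      fix \<nu>
      have "(\<integral>\<^sup>+u\<in>cell h \<nu>. ennreal (gauss_mod \<alpha> f u powr p) \<partial>\<mu>) \<le> (\<integral>\<^sup>+u. ennreal (G \<nu>) * indicator (cell h \<nu>) u \<partial>\<mu>)"
        using G[of _ \<nu>] by (intro nn_integral_mono) (auto simp: indicator_def intro!: ennreal_leI)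
      also have "\<dots> = ennreal (G \<nu>) * ennreal (m \<nu>)"
        using mu by (subst nn_integral_cmult_indicator) (auto simp: m)
      finally show "(\<integral>\<^sup>+u\<in>cell h \<nu>. ennreal (gauss_mod \<alpha> f u powr p) \<partial>\<mu>) \<le> ennreal (m \<nu> * G \<nu>)"
        using m0 G0 by (simp add: ennreal_mult mult.commute)
    qed
    also have "\<dots> = ennreal (\<Sum>\<nu>\<in>N. m \<nu> * G \<nu>)" using m0 G0 by (intro sum_ennreal) auto
    also have "\<dots> \<le> ennreal L" using bd[OF N] by (rule ennreal_leI)
    finally show "(\<Sum>\<nu>\<in>N. \<integral>\<^sup>+u\<in>cell h \<nu>. ennreal (gauss_mod \<alpha> f u powr p) \<partial>\<mu>) \<le> ennreal L" .
  qed simp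
  finally show ?thesis .
qed

text \<open>The values of f on a cell are replaced by \<open>cell_avg\<close>, which makes the
  target norm at most a sum over all cells. Domination is available on finite sets N only, with B
  independent of N, so the limit over N is taken last.\<close>

lemma summing_upper:
  assumes r: "1 \<le> r" "r \<le> p"
  obtains C where "C > 0"
    "\<And>\<mu> m B. sets \<mu> = sets borel \<Longrightarrow> (\<And>\<nu>. emeasure \<mu> (cell h \<nu>) = ennreal (m \<nu>)) \<Longrightarrow> (\<And>\<nu>. 0 \<le> m \<nu>) \<Longrightarrow> B \<ge> 0 \<Longrightarrow>
      (\<And>N. finite N \<Longrightarrow> diag_dom p r N (\<lambda>\<nu>. (m \<nu> / W \<nu>) powr (1/p)) B) \<Longrightarrow>
      (\<forall>f\<in>fock_set \<alpha> p wm. fock_mass \<alpha> p \<mu> f < top) \<and>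
      summing_const r (fock_set \<alpha> p wm) (fock_norm \<alpha> p wm) (fock_norm \<alpha> p \<mu>) (\<lambda>f. f) (C * B)"
proof -
  obtain C1 where C1: "C1 > 0" and ca: "\<And>f \<nu> u. f holomorphic_on UNIV \<Longrightarrow> u \<in> cell h \<nu> \<Longrightarrow>
      gauss_mod \<alpha> f u powr r \<le> C1 * cell_avg r f \<nu>"
    using cell_average[of r] r unfolding cell_avg_def shift_box_def by (metis less_le_trans zero_less_one)
  obtain C2 where C2: "C2 > 0" and tr: "\<And>N a B J f V. finite N \<Longrightarrow> (\<And>\<nu>. \<nu> \<in> N \<Longrightarrow> 0 \<le> a \<nu>) \<Longrightarrow> diag_dom p r N a B \<Longrightarrow> finite J \<Longrightarrow>
      (\<And>j::nat. j \<in> J \<Longrightarrow> f j \<in> fock_set \<alpha> p wm) \<Longrightarrow>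
      (\<And>\<phi>. \<phi> \<in> dual_ball (fock_set \<alpha> p wm) (fock_norm \<alpha> p wm) \<Longrightarrow> (\<Sum>j\<in>J. cmod (\<phi> (f j)) powr r) \<le> V) \<Longrightarrow>
      (\<Sum>j\<in>J. (\<Sum>\<nu>\<in>N. a \<nu> powr p * W \<nu> * cell_avg r (f j) \<nu> powr (p / r)) powr (r / p)) \<le> C2 * B powr r * V"
    using diag_dom_transfer[OF r] by blast
  define C where "C = (C1 * C2) powr (1/r)"
  have C: "C > 0" unfolding C_def using C1 C2 by simp
  have Cr: "C powr r = C1 * C2" unfolding C_def using C1 C2 r by (simp add: powr_powr)
  have "(\<forall>f\<in>fock_set \<alpha> p wm. fock_mass \<alpha> p \<mu> f < top) \<and>
      summing_const r (fock_set \<alpha> p wm) (fock_norm \<alpha> p wm) (fock_norm \<alpha> p \<mu>) (\<lambda>f. f) (C * B)"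
    if mu: "sets \<mu> = sets borel" and m: "\<And>\<nu>. emeasure \<mu> (cell h \<nu>) = ennreal (m \<nu>)" and m0: "\<And>\<nu>. 0 \<le> m \<nu>"
      and B: "B \<ge> 0" and dd: "\<And>N. finite N \<Longrightarrow> diag_dom p r N (\<lambda>\<nu>. (m \<nu> / W \<nu>) powr (1/p)) B" for \<mu> m B
  proof -
    define G where "G f \<nu> = (C1 * cell_avg r f \<nu>) powr (p / r)" for f \<nu>
    define t where "t f \<nu> = m \<nu> * G f \<nu>" for f \<nu>
    have t0: "t f \<nu> \<ge> 0" for f \<nu> using m0 by (simp add: t_def G_def)
    have G: "gauss_mod \<alpha> f u powr p \<le> G f \<nu>" if "f holomorphic_on UNIV" "u \<in> cell h \<nu>" for f u \<nu>
    proof -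
      have "(gauss_mod \<alpha> f u powr r) powr (p / r) \<le> G f \<nu>"
        unfolding G_def using ca[OF that] r by (intro powr_mono2) auto
      then show ?thesis using r by (simp add: powr_powr)
    qed
    have main: "(\<Sum>j\<in>J. (\<Sum>\<nu>\<in>N. t (f j) \<nu>) powr (r / p)) \<le> (C * B) powr r * V"
      if N: "finite N" and J: "finite J" and f: "\<And>j::nat. j \<in> J \<Longrightarrow> f j \<in> fock_set \<alpha> p wm"
        and V: "\<And>\<phi>. \<phi> \<in> dual_ball (fock_set \<alpha> p wm) (fock_norm \<alpha> p wm) \<Longrightarrow> (\<Sum>j\<in>J. cmod (\<phi> (f j)) powr r) \<le> V"
      for N J f V
    proof -
      have "(\<Sum>\<nu>\<in>N. t (f j) \<nu>) powr (r / p) = C1 * (\<Sum>\<nu>\<in>N. ((m \<nu> / W \<nu>) powr (1/p)) powr p * W \<nu> * cell_avg r (f j) \<nu> powr (p / r)) powr (r / p)"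
        if j: "j \<in> J" for j
      proof -
        have av: "cell_avg r (f j) \<nu> \<ge> 0" for \<nu> using f[OF j] r by (intro cell_avg_nonneg) (auto simp: fock_set_def)
        have "(\<Sum>\<nu>\<in>N. t (f j) \<nu>) = C1 powr (p / r) * (\<Sum>\<nu>\<in>N. ((m \<nu> / W \<nu>) powr (1/p)) powr p * W \<nu> * cell_avg r (f j) \<nu> powr (p / r))"
          unfolding sum_distrib_left t_def G_def
        proof (rule sum.cong)
          fix \<nu>
          have "((m \<nu> / W \<nu>) powr (1/p)) powr p * W \<nu> = m \<nu>"
            using m0[of \<nu>] W[of \<nu>] p by (simp add: powr_powr)
          moreover have "(C1 * cell_avg r (f j) \<nu>) powr (p / r) = C1 powr (p / r) * cell_avg r (f j) \<nu> powr (p / r)"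
            using C1 av by (simp add: powr_mult)
          ultimately show "m \<nu> * (C1 * cell_avg r (f j) \<nu>) powr (p / r)
             = C1 powr (p / r) * (((m \<nu> / W \<nu>) powr (1/p)) powr p * W \<nu> * cell_avg r (f j) \<nu> powr (p / r))"
            by (simp only: mult_ac)
        qed simp
        moreover have "0 \<le> (\<Sum>\<nu>\<in>N. ((m \<nu> / W \<nu>) powr (1/p)) powr p * W \<nu> * cell_avg r (f j) \<nu> powr (p / r))"
          using W by (intro sum_nonneg mult_nonneg_nonneg) (auto simp: less_imp_le)
        moreover have "(C1 powr (p / r)) powr (r / p) = C1" using C1 r p by (simp add: powr_powr)
        ultimately show ?thesis by (simp only: powr_mult powr_ge_zero)
      qed
      then have "(\<Sum>j\<in>J. (\<Sum>\<nu>\<in>N. t (f j) \<nu>) powr (r / p))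
          = C1 * (\<Sum>j\<in>J. (\<Sum>\<nu>\<in>N. ((m \<nu> / W \<nu>) powr (1/p)) powr p * W \<nu> * cell_avg r (f j) \<nu> powr (p / r)) powr (r / p))"
        unfolding sum_distrib_left[of C1] by (rule sum.cong[OF refl])
      also have "\<dots> \<le> C1 * (C2 * B powr r * V)"
        using C1 by (intro mult_left_mono tr N J f V dd) auto
      also have "\<dots> = (C * B) powr r * V" using C B by (simp add: powr_mult Cr)
      finally show ?thesis .
    qed
    \<comment> \<open>The bound for the family consisting of f alone, where V is the r-th power of
      the norm of f, keeps the partial sums bounded; finiteness of the target norm of f follows from
      it.\<close>
    have summ: "t f summable_on UNIV" if f: "f \<in> fock_set \<alpha> p wm" for f
    proof (rule nonneg_bounded_partial_sums_imp_summable_on[where C = "((C * B) powr r * fock_norm \<alpha> p wm f powr r) powr (p / r)"])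
      show "\<forall>\<^sub>F N in finite_subsets_at_top UNIV. sum (t f) N \<le> ((C * B) powr r * fock_norm \<alpha> p wm f powr r) powr (p / r)"
      proof (rule eventually_finite_subsets_at_top_weakI)
        fix N :: "(int \<times> int) set" assume N: "finite N"
        have "(\<Sum>j\<in>{0::nat}. (\<Sum>\<nu>\<in>N. t f \<nu>) powr (r / p)) \<le> (C * B) powr r * fock_norm \<alpha> p wm f powr r"
        proof (rule main[OF N])
          fix \<phi> assume "\<phi> \<in> dual_ball (fock_set \<alpha> p wm) (fock_norm \<alpha> p wm)"
          then show "(\<Sum>j\<in>{0::nat}. cmod (\<phi> f) powr r) \<le> fock_norm \<alpha> p wm f powr r"
            using f r by (auto simp: dual_ball_def intro!: powr_mono2)
        qed (use f in auto)
        then have "((\<Sum>\<nu>\<in>N. t f \<nu>) powr (r / p)) powr (p / r) \<le> ((C * B) powr r * fock_norm \<alpha> p wm f powr r) powr (p / r)"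
          using r p by (intro powr_mono2) auto
        then show "sum (t f) N \<le> ((C * B) powr r * fock_norm \<alpha> p wm f powr r) powr (p / r)"
          using r p t0 by (simp add: powr_powr sum_nonneg)
      qed
    qed (use t0 in auto)
    have nm: "fock_mass \<alpha> p \<mu> f \<le> ennreal (infsum (t f) UNIV)" if f: "f \<in> fock_set \<alpha> p wm" for f
    proof (rule fock_mass_le_cells[OF mu _ _ m m0])
      show "f holomorphic_on UNIV" using f by (simp add: fock_set_def)
      then show "gauss_mod \<alpha> f u powr p \<le> G f \<nu>" if "u \<in> cell h \<nu>" for \<nu> u using G that by blast
      show "(\<Sum>\<nu>\<in>N. m \<nu> * G f \<nu>) \<le> infsum (t f) UNIV" if "finite N" for N
        using finite_sum_le_infsum[OF summ[OF f] that] t0 by (simp add: t_def)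
    qed
    have fin: "fock_mass \<alpha> p \<mu> f < top" if "f \<in> fock_set \<alpha> p wm" for f
      using nm[OF that] by (simp add: le_less_trans)
    have "summing_const r (fock_set \<alpha> p wm) (fock_norm \<alpha> p wm) (fock_norm \<alpha> p \<mu>) (\<lambda>f. f) (C * B)"
    proof (rule summing_constI)
      fix n :: nat and f V
      assume f: "\<And>j. j < n \<Longrightarrow> f j \<in> fock_set \<alpha> p wm"
        and V: "\<And>\<phi>. \<phi> \<in> dual_ball (fock_set \<alpha> p wm) (fock_norm \<alpha> p wm) \<Longrightarrow> (\<Sum>j<n. cmod (\<phi> (f j)) powr r) \<le> V"
      have "(\<Sum>j<n. fock_norm \<alpha> p \<mu> (f j) powr r) \<le> (\<Sum>j<n. infsum (t (f j)) UNIV powr (r / p))"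
      proof (rule sum_mono)
        fix j assume "j \<in> {..<n}"
        then have fj: "f j \<in> fock_set \<alpha> p wm" using f by auto
        have "enn2real (fock_mass \<alpha> p \<mu> (f j)) \<le> infsum (t (f j)) UNIV"
          using nm[OF fj] t0 by (intro enn2real_leI infsum_nonneg) auto
        then have "enn2real (fock_mass \<alpha> p \<mu> (f j)) powr (r / p) \<le> infsum (t (f j)) UNIV powr (r / p)"
          using r by (intro powr_mono2) auto
        then show "fock_norm \<alpha> p \<mu> (f j) powr r \<le> infsum (t (f j)) UNIV powr (r / p)"
          by (simp add: fock_norm_def powr_powr)
      qed
      \<comment> \<open>With the family fixed, the finite sets N exhaust the lattice; the bound for
        each N passes to the limit.\<close>
      also have "\<dots> \<le> (C * B) powr r * V"
      proof (rule tendsto_upperbound)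
        show "((\<lambda>N. \<Sum>j<n. (sum (t (f j)) N) powr (r / p)) \<longlongrightarrow> (\<Sum>j<n. infsum (t (f j)) UNIV powr (r / p))) (finite_subsets_at_top UNIV)"
          using r p t0
          by (intro tendsto_sum tendsto_powr' infsum_tendsto summ f tendsto_const) (auto intro!: always_eventually sum_nonneg)
        show "\<forall>\<^sub>F N in finite_subsets_at_top UNIV. (\<Sum>j<n. (sum (t (f j)) N) powr (r / p)) \<le> (C * B) powr r * V"
          by (intro eventually_finite_subsets_at_top_weakI main V) (auto intro: f)
      qed simp
      finally show "(\<Sum>j<n. fock_norm \<alpha> p \<mu> (f j) powr r) \<le> (C * B) powr r * V" .
    qed (use r C B in auto)
    with fin show ?thesis by blast
  qed
  with C that show ?thesis by blast
qed

end

section \<open>Lower bounds\<close>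

lemma dual_ball_add:
  "\<phi> \<in> dual_ball X nX \<Longrightarrow> f \<in> X \<Longrightarrow> g \<in> X \<Longrightarrow> \<phi> (\<lambda>s. f s + g s) = \<phi> f + \<phi> g"
  by (simp add: dual_ball_def)

lemma dual_ball_scale: "\<phi> \<in> dual_ball X nX \<Longrightarrow> f \<in> X \<Longrightarrow> \<phi> (\<lambda>s. c * f s) = c * \<phi> f"
  by (simp add: dual_ball_def)

lemma dual_ball_le: "\<phi> \<in> dual_ball X nX \<Longrightarrow> f \<in> X \<Longrightarrow> cmod (\<phi> f) \<le> nX f"
  by (simp add: dual_ball_def)

context fock_lattice
begin

definition cell_mass :: "complex measure \<Rightarrow> int \<times> int \<Rightarrow> real" where
  "cell_mass \<mu> \<nu> = enn2real (emeasure \<mu> (cell h \<nu>))"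

text \<open>
  Since \<open>enn2real \<infinity> = 0\<close>, the numbers \<open>cell_mass \<mu> \<nu>\<close> are meaningful only together with the finiteness of
  the measures of the cells.
\<close>

lemma cell_mass_nonneg [simp]: "0 \<le> cell_mass \<mu> \<nu>"
  by (simp add: cell_mass_def)

abbreviation lattice_summing :: "real \<Rightarrow> complex measure \<Rightarrow> real \<Rightarrow> bool" where
  "lattice_summing r \<mu> \<equiv> summing_const r (fock_set \<alpha> p wm) (fock_norm \<alpha> p wm) (fock_norm \<alpha> p \<mu>) (\<lambda>f. f)"

text \<open>The necessity half at summing exponent r, with t the power to which the constant enters.
  C is uniform in \<mu>, K and N.\<close>

definition lower_bound :: "real \<Rightarrow> real \<Rightarrow> real \<Rightarrow> bool" where
  "lower_bound r t C \<longleftrightarrow> (\<forall>\<mu> K N. sets \<mu> = sets borel \<longrightarrow> (\<forall>f\<in>fock_set \<alpha> p wm. fock_mass \<alpha> p \<mu> f < top) \<longrightarrow>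
     lattice_summing r \<mu> K \<longrightarrow> finite N \<longrightarrow> (\<Sum>\<nu>\<in>N. (cell_mass \<mu> \<nu> / W \<nu>) powr (t / p)) \<le> C * K powr t)"

text \<open>The condition on y and Q says that the diagonal operator y maps the unit ball of l^p'
  into the ball of radius sqrt Q of l^2. Keeping y free lets one randomised test serve both p >= 2
  and p < 2.\<close>

definition sign_bound :: "real \<Rightarrow> real \<Rightarrow> bool" where
  "sign_bound r C \<longleftrightarrow> (\<forall>\<mu> K N y Q. sets \<mu> = sets borel \<longrightarrow> (\<forall>f\<in>fock_set \<alpha> p wm. fock_mass \<alpha> p \<mu> f < top) \<longrightarrow>
     lattice_summing r \<mu> K \<longrightarrow> finite N \<longrightarrow> (\<forall>\<nu>. 0 \<le> y \<nu>) \<longrightarrow> Q \<ge> 0 \<longrightarrow>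
     (\<forall>c. (\<forall>\<nu>\<in>N. 0 \<le> c \<nu>) \<longrightarrow> (\<Sum>\<nu>\<in>N. c \<nu> powr conj_exp p) \<le> 1 \<longrightarrow> (\<Sum>\<nu>\<in>N. (y \<nu> * c \<nu>)\<^sup>2) \<le> Q) \<longrightarrow>
     (\<Sum>\<nu>\<in>N. cell_mass \<mu> \<nu> / W \<nu> * y \<nu> powr p) \<le> C * K powr p * Q powr (p / 2))"

section \<open>Normalised kernels and the functionals applied to them\<close>

text \<open>The factor W \<nu>^(-1/p) compensates the mass of the weight around the cell, so that
  the Fock norms are bounded uniformly in \<nu>.\<close>

definition test_fun :: "int \<times> int \<Rightarrow> complex \<Rightarrow> complex" where
  "test_fun \<nu> u = of_real (W \<nu> powr (- 1 / p)) * fock_kernel \<alpha> (cell_center h \<nu>) u"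

lemma W_powr: "(W \<nu> powr (- 1 / p)) powr p = 1 / W \<nu>"
proof -
  have "- 1 / p * p = -1" using p by simp
  then have "(W \<nu> powr (- 1 / p)) powr p = W \<nu> powr - 1" by (simp only: powr_powr)
  then show ?thesis using W[of \<nu>] by (simp add: powr_minus divide_inverse)
qed

lemma test_fun_comb_holomorphic: "(\<lambda>u. \<Sum>\<nu>\<in>N. c \<nu> * test_fun \<nu> u) holomorphic_on A"
  unfolding test_fun_def by (intro holomorphic_intros fock_kernel_holomorphic)

lemma test_fun_comb_mass:
  "\<exists>C>0. \<forall>N c. finite N \<longrightarrow> fock_mass \<alpha> p wm (\<lambda>u. \<Sum>\<nu>\<in>N. c \<nu> * test_fun \<nu> u) \<le> ennreal (C * (\<Sum>\<nu>\<in>N. cmod (c \<nu>) powr p))"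
proof -
  obtain C where C: "C > 0" and syn: "\<And>N c. finite N \<Longrightarrow> fock_mass \<alpha> p wm (\<lambda>u. \<Sum>\<nu>\<in>N. c \<nu> * fock_kernel \<alpha> (cell_center h \<nu>) u)
       \<le> ennreal (C * (\<Sum>\<nu>\<in>N. cmod (c \<nu>) powr p * W \<nu>))"
    using synthesis by blast
  have "fock_mass \<alpha> p wm (\<lambda>u. \<Sum>\<nu>\<in>N. c \<nu> * test_fun \<nu> u) \<le> ennreal (C * (\<Sum>\<nu>\<in>N. cmod (c \<nu>) powr p))"
    if N: "finite N" for N c
  proof -
    have "(\<Sum>\<nu>\<in>N. cmod (c \<nu> * of_real (W \<nu> powr (- 1 / p))) powr p * W \<nu>) = (\<Sum>\<nu>\<in>N. cmod (c \<nu>) powr p)"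
    proof (rule sum.cong)
      fix \<nu>
      have "cmod (c \<nu> * of_real (W \<nu> powr (- 1 / p))) powr p = cmod (c \<nu>) powr p * (W \<nu> powr (- 1 / p)) powr p"
        by (simp only: norm_mult norm_of_real powr_mult abs_of_nonneg powr_ge_zero norm_ge_zero)
      then show "cmod (c \<nu> * of_real (W \<nu> powr (- 1 / p))) powr p * W \<nu> = cmod (c \<nu>) powr p"
        unfolding W_powr using W[of \<nu>] by simp
    qed simp
    then show ?thesis using syn[OF N, of "\<lambda>\<nu>. c \<nu> * of_real (W \<nu> powr (- 1 / p))"]
      by (simp add: test_fun_def mult.assoc)
  qed
  with C show ?thesis by blast
qed

lemma test_fun_comb_mem:
  assumes N: "finite N"
  shows "(\<lambda>u. \<Sum>\<nu>\<in>N. c \<nu> * test_fun \<nu> u) \<in> fock_set \<alpha> p wm"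
proof -
  obtain C where "\<forall>N c. finite N \<longrightarrow> fock_mass \<alpha> p wm (\<lambda>u. \<Sum>\<nu>\<in>N. c \<nu> * test_fun \<nu> u) \<le> ennreal (C * (\<Sum>\<nu>\<in>N. cmod (c \<nu>) powr p))"
    using test_fun_comb_mass by blast
  then have "fock_mass \<alpha> p wm (\<lambda>u. \<Sum>\<nu>\<in>N. c \<nu> * test_fun \<nu> u) \<le> ennreal (C * (\<Sum>\<nu>\<in>N. cmod (c \<nu>) powr p))"
    using N by blast
  also have "\<dots> < top" by simp
  finally show ?thesis by (simp add: fock_set_def test_fun_comb_holomorphic)
qed

lemma test_fun_comb_norm:
  "\<exists>C>0. \<forall>N c. finite N \<longrightarrow> fock_norm \<alpha> p wm (\<lambda>u. \<Sum>\<nu>\<in>N. c \<nu> * test_fun \<nu> u) \<le> C * (\<Sum>\<nu>\<in>N. cmod (c \<nu>) powr p) powr (1/p)"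
proof -
  obtain C where C: "C > 0" and le: "\<And>N c. finite N \<Longrightarrow>
      fock_mass \<alpha> p wm (\<lambda>u. \<Sum>\<nu>\<in>N. c \<nu> * test_fun \<nu> u) \<le> ennreal (C * (\<Sum>\<nu>\<in>N. cmod (c \<nu>) powr p))"
    using test_fun_comb_mass by blast
  have "fock_norm \<alpha> p wm (\<lambda>u. \<Sum>\<nu>\<in>N. c \<nu> * test_fun \<nu> u) \<le> C powr (1/p) * (\<Sum>\<nu>\<in>N. cmod (c \<nu>) powr p) powr (1/p)"
    if N: "finite N" for N c
  proof (rule fock_norm_leI)
    have "(C powr (1/p) * (\<Sum>\<nu>\<in>N. cmod (c \<nu>) powr p) powr (1/p)) powr p = C * (\<Sum>\<nu>\<in>N. cmod (c \<nu>) powr p)"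
      using C p by (simp add: powr_mult powr_powr sum_nonneg)
    then show "fock_mass \<alpha> p wm (\<lambda>u. \<Sum>\<nu>\<in>N. c \<nu> * test_fun \<nu> u) \<le> ennreal ((C powr (1/p) * (\<Sum>\<nu>\<in>N. cmod (c \<nu>) powr p) powr (1/p)) powr p)"
      using le[OF N, of c] by simp
  qed (use p in auto)
  moreover have "C powr (1/p) > 0" using C by simp
  ultimately show ?thesis by blast
qed

lemma test_fun_mem: "test_fun \<nu> \<in> fock_set \<alpha> p wm"
  using test_fun_comb_mem[of "{\<nu>}" "\<lambda>_. 1"] by simp

lemma dual_ball_test_fun_comb:
  assumes \<phi>: "\<phi> \<in> dual_ball (fock_set \<alpha> p wm) (fock_norm \<alpha> p wm)" and N: "finite N"
  shows "\<phi> (\<lambda>u. \<Sum>\<nu>\<in>N. c \<nu> * test_fun \<nu> u) = (\<Sum>\<nu>\<in>N. c \<nu> * \<phi> (test_fun \<nu>))"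
  using N
proof (induction N rule: finite_induct)
  \<comment> \<open>That a functional vanishes at 0 is not part of the definition of the dual ball;
    it follows from homogeneity with scalar 0.\<close>
  case empty
  have "\<phi> (\<lambda>u. 0 * test_fun (0, 0) u) = 0 * \<phi> (test_fun (0, 0))"
    by (rule dual_ball_scale[OF \<phi> test_fun_mem])
  then show ?case by simp
next
  case (insert a N)
  have ca: "(\<lambda>u. c a * test_fun a u) \<in> fock_set \<alpha> p wm"
    using test_fun_comb_mem[of "{a}" c] by simp
  have "\<phi> (\<lambda>u. c a * test_fun a u + (\<Sum>\<nu>\<in>N. c \<nu> * test_fun \<nu> u)) = \<phi> (\<lambda>u. c a * test_fun a u) + \<phi> (\<lambda>u. \<Sum>\<nu>\<in>N. c \<nu> * test_fun \<nu> u)"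
    by (rule dual_ball_add[OF \<phi> ca test_fun_comb_mem[OF insert.hyps(1)]])
  moreover have "\<phi> (\<lambda>u. c a * test_fun a u) = c a * \<phi> (test_fun a)"
    by (rule dual_ball_scale[OF \<phi> test_fun_mem])
  ultimately show ?case using insert by simp
qed

text \<open>The adjoint of synthesis: combinations of test functions map l^p boundedly into the Fock
  space, so \<phi> induces a bounded functional on l^p. Its l^p' norm is read off from the extremal
  sequence of Hoelder's inequality on N.\<close>

lemma dual_ball_test_fun_bound:
  obtains C where "C > 0"
    "\<And>\<phi> N. \<phi> \<in> dual_ball (fock_set \<alpha> p wm) (fock_norm \<alpha> p wm) \<Longrightarrow> finite N \<Longrightarrow>
       (\<Sum>\<nu>\<in>N. (cmod (\<phi> (test_fun \<nu>)) / C) powr conj_exp p) \<le> 1"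
proof -
  obtain C where C: "C > 0" and cb: "\<And>N c. finite N \<Longrightarrow>
      fock_norm \<alpha> p wm (\<lambda>u. \<Sum>\<nu>\<in>N. c \<nu> * test_fun \<nu> u) \<le> C * (\<Sum>\<nu>\<in>N. cmod (c \<nu>) powr p) powr (1/p)"
    using test_fun_comb_norm by blast
  define q where "q = conj_exp p"
  have q: "q > 1" "1/p + 1/q = 1" unfolding q_def using p by (auto intro: conj_exp_gt1 conj_exp_sum)
  have qp: "(q - 1) * p = q" unfolding q_def conj_exp_def using p by (simp add: field_simps)
  have "(\<Sum>\<nu>\<in>N. (cmod (\<phi> (test_fun \<nu>)) / C) powr q) \<le> 1"
    if \<phi>: "\<phi> \<in> dual_ball (fock_set \<alpha> p wm) (fock_norm \<alpha> p wm)" and N: "finite N" for \<phi> N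
  proof -
    define T where "T = (\<Sum>\<nu>\<in>N. cmod (\<phi> (test_fun \<nu>)) powr q)"
    have T0: "T \<ge> 0" by (simp add: T_def sum_nonneg)
    \<comment> \<open>The conjugate sign makes every product nonnegative, and |c \<nu>|^p = |\<phi>
      (test_fun \<nu>)|^q because (q - 1) p = q; this leads to T <= C T^(1/p).\<close>
    define c where "c \<nu> = cnj (sgn (\<phi> (test_fun \<nu>))) * of_real (cmod (\<phi> (test_fun \<nu>)) powr (q - 1))" for \<nu>
    have c1: "c \<nu> * \<phi> (test_fun \<nu>) = of_real (cmod (\<phi> (test_fun \<nu>)) powr q)" for \<nu>
    proof (cases "\<phi> (test_fun \<nu>) = 0")
      case False
      define x where "x = \<phi> (test_fun \<nu>)"
      have x: "cmod x > 0" using False by (simp add: x_def)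
      have "cnj (sgn x) * x = of_real (cmod x)"
      proof -
        have "cnj x * x = of_real (cmod x) * of_real (cmod x)"
          using complex_norm_square[of x] by (simp only: power2_eq_square of_real_mult mult.commute)
        moreover have "cnj (sgn x) * x = (cnj x * x) / of_real (cmod x)" by (simp add: sgn_eq)
        ultimately show ?thesis using x by simp
      qed
      moreover have "cmod x powr q = cmod x * cmod x powr (q - 1)" using x by (simp add: powr_mult_base)
      moreover have "c \<nu> * \<phi> (test_fun \<nu>) = (cnj (sgn x) * x) * of_real (cmod x powr (q - 1))"
        by (simp only: c_def x_def mult_ac)
      ultimately show ?thesis unfolding x_def[symmetric] by simp
    qed (use q in \<open>simp add: c_def\<close>)
    have c2: "cmod (c \<nu>) powr p = cmod (\<phi> (test_fun \<nu>)) powr q" for \<nu>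
    proof (cases "\<phi> (test_fun \<nu>) = 0")
      case False
      then show ?thesis using qp by (simp add: c_def norm_mult norm_sgn powr_powr)
    qed (use q p in \<open>simp add: c_def\<close>)
    have "of_real T = \<phi> (\<lambda>u. \<Sum>\<nu>\<in>N. c \<nu> * test_fun \<nu> u)"
      unfolding dual_ball_test_fun_comb[OF \<phi> N] c1 T_def by simp
    then have "T = cmod (\<phi> (\<lambda>u. \<Sum>\<nu>\<in>N. c \<nu> * test_fun \<nu> u))" using T0 by (metis norm_of_real abs_of_nonneg)
    also have "\<dots> \<le> fock_norm \<alpha> p wm (\<lambda>u. \<Sum>\<nu>\<in>N. c \<nu> * test_fun \<nu> u)"
      by (rule dual_ball_le[OF \<phi> test_fun_comb_mem[OF N]])
    also have "\<dots> \<le> C * T powr (1/p)" using cb[OF N, of c] by (simp add: c2 T_def)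
    finally have TT: "T \<le> C * T powr (1/p)" .
    have "T \<le> C powr q"
    proof (cases "T = 0")
      case False
      with T0 have T: "T > 0" by simp
      have "T = T powr (1/q) * T powr (1/p)" using T q by (simp add: powr_add[symmetric] add.commute)
      with TT have "T powr (1/q) * T powr (1/p) \<le> C * T powr (1/p)" by simp
      then have "T powr (1/q) \<le> C" using T by simp
      then have "(T powr (1/q)) powr q \<le> C powr q" using q by (intro powr_mono2) auto
      then show ?thesis using T q by (simp add: powr_powr)
    qed simp
    have "(\<Sum>\<nu>\<in>N. (cmod (\<phi> (test_fun \<nu>)) / C) powr q) = T / C powr q"
      using C by (simp add: powr_divide T_def sum_divide_distrib)
    also have "\<dots> \<le> 1" using \<open>T \<le> C powr q\<close> C by simp
    finally show ?thesis .
  qed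
  with C that show ?thesis unfolding q_def by blast
qed

definition test_const :: real where
  "test_const = exp (- (\<alpha> / 2) * h\<^sup>2)"

lemma test_const_pos: "test_const > 0"
  by (simp add: test_const_def)

lemma gauss_mod_tf_lower:
  assumes u: "u \<in> cell h \<nu>"
  shows "test_const * W \<nu> powr (- 1 / p) \<le> gauss_mod \<alpha> (test_fun \<nu>) u"
proof -
  have "(cmod (u - cell_center h \<nu>))\<^sup>2 \<le> h\<^sup>2"
    using cell_center_dist_upper[OF h(1) u] by (intro power_mono) auto
  then have "\<alpha> / 2 * (cmod (u - cell_center h \<nu>))\<^sup>2 \<le> \<alpha> / 2 * h\<^sup>2" using \<alpha> by (intro mult_left_mono) auto
  then have "test_const \<le> gauss_mod \<alpha> (fock_kernel \<alpha> (cell_center h \<nu>)) u" by (simp add: test_const_def gauss_mod_kern)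
  moreover have "gauss_mod \<alpha> (test_fun \<nu>) u = W \<nu> powr (- 1 / p) * gauss_mod \<alpha> (fock_kernel \<alpha> (cell_center h \<nu>)) u"
    by (simp add: gauss_mod_def test_fun_def norm_mult)
  ultimately show ?thesis by (metis mult.commute mult_left_mono powr_ge_zero)
qed

lemma emeasure_cell_le:
  assumes mu: "sets \<mu> = sets borel"
  shows "ennreal (test_const powr p / W \<nu>) * emeasure \<mu> (cell h \<nu>) \<le> fock_mass \<alpha> p \<mu> (test_fun \<nu>)"
proof -
  have "ennreal (test_const powr p / W \<nu>) * emeasure \<mu> (cell h \<nu>) = (\<integral>\<^sup>+u. ennreal (test_const powr p / W \<nu>) * indicator (cell h \<nu>) u \<partial>\<mu>)"
    using mu by (subst nn_integral_cmult_indicator) auto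
  also have "\<dots> \<le> fock_mass \<alpha> p \<mu> (test_fun \<nu>)"
    unfolding fock_mass_def
  proof (rule nn_integral_mono)
    fix u
    have "ennreal (test_const powr p / W \<nu>) \<le> ennreal (gauss_mod \<alpha> (test_fun \<nu>) u powr p)" if "u \<in> cell h \<nu>"
    proof (rule ennreal_leI)
      have "test_const powr p / W \<nu> = (test_const * W \<nu> powr (- 1 / p)) powr p"
        using test_const_pos by (simp only: powr_mult W_powr less_imp_le powr_ge_zero) simp
      also have "\<dots> \<le> gauss_mod \<alpha> (test_fun \<nu>) u powr p"
        using gauss_mod_tf_lower[OF that] p test_const_pos by (intro powr_mono2) auto
      finally show "test_const powr p / W \<nu> \<le> gauss_mod \<alpha> (test_fun \<nu>) u powr p" .
    qed
    then show "ennreal (test_const powr p / W \<nu>) * indicator (cell h \<nu>) u \<le> ennreal (gauss_mod \<alpha> (test_fun \<nu>) u powr p)"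
      by (auto simp: indicator_def)
  qed
  finally show ?thesis .
qed

text \<open>A cell of infinite measure would give its own test function infinite norm in the target
  space.\<close>

lemma emeasure_cell_finite:
  assumes mu: "sets \<mu> = sets borel" and fin: "\<And>f. f \<in> fock_set \<alpha> p wm \<Longrightarrow> fock_mass \<alpha> p \<mu> f < top"
  shows "emeasure \<mu> (cell h \<nu>) < top"
proof (rule ccontr)
  assume "\<not> emeasure \<mu> (cell h \<nu>) < top"
  then have "emeasure \<mu> (cell h \<nu>) = top" using less_top by blast
  moreover have "test_const powr p / W \<nu> > 0" using test_const_pos W[of \<nu>] by simp
  ultimately show False
    using emeasure_cell_le[OF mu, of \<nu>] fin[OF test_fun_mem, of \<nu>] test_const_pos W[of \<nu>]
    by (auto simp: ennreal_mult_top split: if_splits)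
qed

lemma cell_mass_le:
  assumes mu: "sets \<mu> = sets borel" and fin: "\<And>f. f \<in> fock_set \<alpha> p wm \<Longrightarrow> fock_mass \<alpha> p \<mu> f < top"
  shows "cell_mass \<mu> \<nu> / W \<nu> \<le> fock_norm \<alpha> p \<mu> (test_fun \<nu>) powr p / test_const powr p"
proof -
  have "ennreal (test_const powr p / W \<nu>) * ennreal (cell_mass \<mu> \<nu>) \<le> ennreal (fock_norm \<alpha> p \<mu> (test_fun \<nu>) powr p)"
    using emeasure_cell_le[OF mu, of \<nu>] emeasure_cell_finite[OF mu fin, of \<nu>] fock_mass_eq_norm[OF _ fin[OF test_fun_mem], of \<nu>] p
    by (simp add: cell_mass_def)
  then have "test_const powr p / W \<nu> * cell_mass \<mu> \<nu> \<le> fock_norm \<alpha> p \<mu> (test_fun \<nu>) powr p"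
    using W[of \<nu>] test_const_pos by (simp add: ennreal_mult[symmetric] ennreal_le_iff cell_mass_def)
  then show ?thesis using W[of \<nu>] test_const_pos by (simp add: field_simps)
qed

section \<open>Testing on single kernels and on random sums\<close>

text \<open>The test functions of N form the family. Their images under a functional lie in a ball
  of l^p', which for r >= p' is contained in a ball of l^r, while the target norm of each is bounded
  below by the integral over its own cell.\<close>

lemma summing_lower_direct:
  assumes r: "conj_exp p \<le> r"
  shows "\<exists>C>0. lower_bound r r C"
proof -
  define q where "q = conj_exp p"
  have q: "q > 1" "q \<le> r" unfolding q_def using p r by (auto intro: conj_exp_gt1)
  obtain D where D: "D > 0" and db: "\<And>\<phi> N. \<phi> \<in> dual_ball (fock_set \<alpha> p wm) (fock_norm \<alpha> p wm) \<Longrightarrow> finite N \<Longrightarrow>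
       (\<Sum>\<nu>\<in>N. (cmod (\<phi> (test_fun \<nu>)) / D) powr q) \<le> 1"
    using dual_ball_test_fun_bound unfolding q_def by blast
  define C where "C = D powr r / test_const powr r"
  have C: "C > 0" unfolding C_def using D test_const_pos by simp
  have "(\<Sum>\<nu>\<in>N. (cell_mass \<mu> \<nu> / W \<nu>) powr (r / p)) \<le> C * K powr r"
    if mu: "sets \<mu> = sets borel" and fin': "\<forall>f\<in>fock_set \<alpha> p wm. fock_mass \<alpha> p \<mu> f < top"
      and sc: "lattice_summing r \<mu> K" and N: "finite N" for \<mu> K N
  proof -
    note fin = fin'[rule_format]
    have "(\<Sum>\<nu>\<in>N. (cell_mass \<mu> \<nu> / W \<nu>) powr (r / p)) \<le> (\<Sum>\<nu>\<in>N. fock_norm \<alpha> p \<mu> (test_fun \<nu>) powr r / test_const powr r)"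
    proof (rule sum_mono)
      fix \<nu>
      have "(cell_mass \<mu> \<nu> / W \<nu>) powr (r / p) \<le> (fock_norm \<alpha> p \<mu> (test_fun \<nu>) powr p / test_const powr p) powr (r / p)"
        using cell_mass_le[OF mu fin, of \<nu>] W[of \<nu>] q p by (intro powr_mono2) auto
      also have "\<dots> = fock_norm \<alpha> p \<mu> (test_fun \<nu>) powr r / test_const powr r"
        using p test_const_pos by (simp add: powr_divide powr_powr)
      finally show "(cell_mass \<mu> \<nu> / W \<nu>) powr (r / p) \<le> fock_norm \<alpha> p \<mu> (test_fun \<nu>) powr r / test_const powr r" .
    qed
    also have "\<dots> = (\<Sum>\<nu>\<in>N. fock_norm \<alpha> p \<mu> (test_fun \<nu>) powr r) / test_const powr r" by (simp add: sum_divide_distrib)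
    also have "\<dots> \<le> (K powr r * D powr r) / test_const powr r"
    proof (rule divide_right_mono)
      show "(\<Sum>\<nu>\<in>N. fock_norm \<alpha> p \<mu> (test_fun \<nu>) powr r) \<le> K powr r * D powr r"
      proof (rule summing_constD[OF sc _ _ N test_fun_mem])
        fix \<phi> assume \<phi>: "\<phi> \<in> dual_ball (fock_set \<alpha> p wm) (fock_norm \<alpha> p wm)"
        have "(\<Sum>\<nu>\<in>N. (cmod (\<phi> (test_fun \<nu>)) / D) powr r) \<le> (\<Sum>\<nu>\<in>N. (cmod (\<phi> (test_fun \<nu>)) / D) powr q) powr (r / q)"
          using q N D by (intro sum_powr_le_powr_sum) auto
        also have "\<dots> \<le> 1 powr (r / q)" using db[OF \<phi> N] q by (intro powr_mono2) (auto intro: sum_nonneg)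
        finally have "(\<Sum>\<nu>\<in>N. (cmod (\<phi> (test_fun \<nu>)) / D) powr r) \<le> 1" by simp
        moreover have "(\<Sum>\<nu>\<in>N. (cmod (\<phi> (test_fun \<nu>)) / D) powr r) = (\<Sum>\<nu>\<in>N. cmod (\<phi> (test_fun \<nu>)) powr r) / D powr r"
          using D by (simp add: powr_divide sum_divide_distrib)
        ultimately show "(\<Sum>\<nu>\<in>N. cmod (\<phi> (test_fun \<nu>)) powr r) \<le> D powr r" using D by (simp add: divide_le_eq)
      qed (use q in auto)
    qed simp
    finally show ?thesis by (simp add: C_def mult.commute)
  qed
  with C show ?thesis unfolding lower_bound_def by blast
qed

text \<open>The family consists of the sums with coefficients y \<nu> and all sign patterns. For a
  functional, Khintchine's inequality with exponent r bounds the mean of |\<phi> (f A)|^r by a power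
  of the l^2 norm of y \<nu> \<phi> (test_fun \<nu>), hence by Q. For the target norm the lower
  inequality is applied at each point u and then integrated against \<mu>.\<close>

lemma summing_lower_random:
  assumes r: "p \<le> r"
  shows "\<exists>C>0. sign_bound r C"
proof -
  have r0: "r > 0" "r / p \<ge> 1" using r p by auto
  obtain D where D: "D > 0" and db: "\<And>\<phi> N. \<phi> \<in> dual_ball (fock_set \<alpha> p wm) (fock_norm \<alpha> p wm) \<Longrightarrow> finite N \<Longrightarrow>
       (\<Sum>\<nu>\<in>N. (cmod (\<phi> (test_fun \<nu>)) / D) powr conj_exp p) \<le> 1"
    using dual_ball_test_fun_bound by blast
  define kl where "kl = Khintchine_lower_const"
  have kl: "kl > 0" unfolding kl_def by (rule Khintchine_lower_const_pos)
  define ku where "ku = Khintchine_const r"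
  have ku: "ku > 0" unfolding ku_def using r0 by (intro Khintchine_const_pos)
  \<comment> \<open>The numerator is the cost of the functionals after taking p/r-th powers, the
    denominator the loss in the pointwise lower bound.\<close>
  define C where "C = (ku powr (p / r) * D powr p) / (kl * test_const) powr p"
  have C: "C > 0" unfolding C_def using D ku kl test_const_pos by simp
  have "(\<Sum>\<nu>\<in>N. cell_mass \<mu> \<nu> / W \<nu> * y \<nu> powr p) \<le> C * K powr p * Q powr (p / 2)"
    if mu: "sets \<mu> = sets borel" and fin': "\<forall>f\<in>fock_set \<alpha> p wm. fock_mass \<alpha> p \<mu> f < top"
      and sc: "lattice_summing r \<mu> K" and N: "finite N"
      and y': "\<forall>\<nu>. 0 \<le> y \<nu>" and Q: "Q \<ge> 0"
      and yQ': "\<forall>c. (\<forall>\<nu>\<in>N. 0 \<le> c \<nu>) \<longrightarrow> (\<Sum>\<nu>\<in>N. c \<nu> powr conj_exp p) \<le> 1 \<longrightarrow> (\<Sum>\<nu>\<in>N. (y \<nu> * c \<nu>)\<^sup>2) \<le> Q"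
    for \<mu> K N y Q
  proof -
    note fin = fin'[rule_format]
    note y = y'[rule_format] and yQ = yQ'[rule_format]
    define n2 :: real where "n2 = 2 ^ card N"
    have n2: "n2 > 0" by (simp add: n2_def)
    define f where "f A = (\<lambda>u. \<Sum>\<nu>\<in>N. of_real (rsign A \<nu> * y \<nu>) * test_fun \<nu> u)" for A
    have f_mem: "f A \<in> fock_set \<alpha> p wm" for A unfolding f_def by (rule test_fun_comb_mem[OF N])
    have em: "emeasure \<mu> (cell h \<nu>) = ennreal (cell_mass \<mu> \<nu>)" for \<nu>
      using emeasure_cell_finite[OF mu fin, of \<nu>] by (simp add: cell_mass_def)
    have K0: "K \<ge> 0" using sc by (simp add: summing_const_def)
    have "(\<Sum>A\<in>Pow N. fock_norm \<alpha> p \<mu> (f A) powr r) \<le> K powr r * (n2 * ku * (D powr r * Q powr (r / 2)))"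
    proof (rule summing_constD[OF sc r0(1) _ _ f_mem])
      fix \<phi> assume \<phi>: "\<phi> \<in> dual_ball (fock_set \<alpha> p wm) (fock_norm \<alpha> p wm)"
      have "(\<Sum>A\<in>Pow N. cmod (\<phi> (f A)) powr r) = (\<Sum>A\<in>Pow N. cmod (\<Sum>\<nu>\<in>N. rsign A \<nu> *\<^sub>R (of_real (y \<nu>) * \<phi> (test_fun \<nu>))) powr r)"
        unfolding f_def dual_ball_test_fun_comb[OF \<phi> N] by (simp add: scaleR_conv_of_real mult.assoc)
      also have "\<dots> \<le> n2 * ku * (\<Sum>\<nu>\<in>N. (cmod (of_real (y \<nu>) * \<phi> (test_fun \<nu>)))\<^sup>2) powr (r / 2)"
        unfolding n2_def ku_def by (rule Khintchine_upper[OF N r0(1)])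
      also have "(\<Sum>\<nu>\<in>N. (cmod (of_real (y \<nu>) * \<phi> (test_fun \<nu>)))\<^sup>2) = D\<^sup>2 * (\<Sum>\<nu>\<in>N. (y \<nu> * (cmod (\<phi> (test_fun \<nu>)) / D))\<^sup>2)"
        using D y by (simp add: sum_distrib_left norm_mult power_mult_distrib power_divide)
      also have "n2 * ku * (D\<^sup>2 * (\<Sum>\<nu>\<in>N. (y \<nu> * (cmod (\<phi> (test_fun \<nu>)) / D))\<^sup>2)) powr (r / 2) \<le> n2 * ku * (D\<^sup>2 * Q) powr (r / 2)"
        using n2 ku r0 D db[OF \<phi> N]
        by (intro mult_left_mono powr_mono2 yQ) (auto intro!: mult_nonneg_nonneg sum_nonneg)
      also have "(D\<^sup>2 * Q) powr (r / 2) = D powr r * Q powr (r / 2)"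
        using D Q by (simp add: powr_mult powr_powr flip: powr_numeral)
      finally show "(\<Sum>A\<in>Pow N. cmod (\<phi> (f A)) powr r) \<le> n2 * ku * (D powr r * Q powr (r / 2))" .
    qed (use N in auto)
    then have S1: "(\<Sum>A\<in>Pow N. fock_norm \<alpha> p \<mu> (f A) powr r) / n2 \<le> K powr r * (ku * (D powr r * Q powr (r / 2)))"
      using n2 by (simp add: field_simps)
    define X where "X = (\<Sum>A\<in>Pow N. 1 / n2 * fock_norm \<alpha> p \<mu> (f A) powr p)"
    have X0: "X \<ge> 0" unfolding X_def using n2 by (intro sum_nonneg) auto
    \<comment> \<open>Jensen's inequality for the uniform probability on sign patterns; r / p >= 1
      passes from the mean of p-th powers to that of r-th powers.\<close>
    have "X powr (r / p) \<le> (\<Sum>A\<in>Pow N. 1 / n2) powr (r / p - 1) * (\<Sum>A\<in>Pow N. 1 / n2 * (fock_norm \<alpha> p \<mu> (f A) powr p) powr (r / p))"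
      unfolding X_def using r0 N n2 by (intro power_mean_sum) auto
    also have "(\<Sum>A\<in>Pow N. 1 / n2) = 1" using N by (simp add: card_Pow n2_def)
    also have "1 powr (r / p - 1) * (\<Sum>A\<in>Pow N. 1 / n2 * (fock_norm \<alpha> p \<mu> (f A) powr p) powr (r / p))
        = (\<Sum>A\<in>Pow N. fock_norm \<alpha> p \<mu> (f A) powr r) / n2"
      using p by (simp add: powr_powr sum_divide_distrib)
    also note S1
    finally have "(X powr (r / p)) powr (p / r) \<le> (K powr r * (ku * (D powr r * Q powr (r / 2)))) powr (p / r)"
      using r0 p by (intro powr_mono2) auto
    also have "(X powr (r / p)) powr (p / r) = X" using X0 r0 p by (simp add: powr_powr)
    also have "(K powr r * (ku * (D powr r * Q powr (r / 2)))) powr (p / r)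
        = K powr p * (ku powr (p / r) * (D powr p * Q powr (p / 2)))"
      using K0 ku D Q r0 by (simp add: powr_mult powr_powr)
    finally have X1: "X \<le> K powr p * (ku powr (p / r) * (D powr p * Q powr (p / 2)))" .
    define e where "e \<nu> = (kl * test_const) powr p * y \<nu> powr p / W \<nu>" for \<nu>
    have e0: "e \<nu> \<ge> 0" for \<nu> using W[of \<nu>] by (simp add: e_def)
    have pt: "e \<nu> \<le> (\<Sum>A\<in>Pow N. 1 / n2 * gauss_mod \<alpha> (f A) u powr p)" if u: "u \<in> cell h \<nu>" and \<nu>: "\<nu> \<in> N" for u \<nu>
    proof -
      define x where "x \<kappa> = of_real (y \<kappa>) * test_fun \<kappa> u * of_real (exp (- (\<alpha> / 2) * (cmod u)\<^sup>2))" for \<kappa>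
      have cx: "cmod (x \<kappa>) = y \<kappa> * gauss_mod \<alpha> (test_fun \<kappa>) u" for \<kappa>
        using y[of \<kappa>] by (simp add: x_def gauss_mod_def norm_mult)
      have cf: "cmod (\<Sum>\<kappa>\<in>N. rsign A \<kappa> *\<^sub>R x \<kappa>) = gauss_mod \<alpha> (f A) u" for A
      proof -
        have "(\<Sum>\<kappa>\<in>N. rsign A \<kappa> *\<^sub>R x \<kappa>) = f A u * of_real (exp (- (\<alpha> / 2) * (cmod u)\<^sup>2))"
          unfolding f_def sum_distrib_right x_def by (intro sum.cong) (auto simp: scaleR_conv_of_real mult_ac)
        then show ?thesis by (simp add: gauss_mod_def norm_mult)
      qed
      have "y \<nu> * (test_const * W \<nu> powr (- 1 / p)) \<le> cmod (x \<nu>)"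
        unfolding cx using gauss_mod_tf_lower[OF u] y by (intro mult_left_mono) auto
      also have "\<dots> = sqrt ((cmod (x \<nu>))\<^sup>2)" by simp
      \<comment> \<open>Read backwards: of the square function at u only the term of the cell
        containing u is kept.\<close>
      also have "\<dots> \<le> sqrt (\<Sum>\<kappa>\<in>N. (cmod (x \<kappa>))\<^sup>2)"
        using N \<nu> by (intro real_sqrt_le_mono member_le_sum) auto
      finally have "kl * (y \<nu> * (test_const * W \<nu> powr (- 1 / p))) \<le> kl * sqrt (\<Sum>\<kappa>\<in>N. (cmod (x \<kappa>))\<^sup>2)"
        using kl by (intro mult_left_mono) auto
      also have "\<dots> \<le> (\<Sum>A\<in>Pow N. gauss_mod \<alpha> (f A) u) / n2"
        using Khintchine_lower[OF N, of x] unfolding cf kl_def n2_def .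
      also have "\<dots> = (\<Sum>A\<in>Pow N. 1 / n2 * gauss_mod \<alpha> (f A) u)" by (simp add: sum_divide_distrib)
      finally have "(kl * (y \<nu> * (test_const * W \<nu> powr (- 1 / p)))) powr p \<le> (\<Sum>A\<in>Pow N. 1 / n2 * gauss_mod \<alpha> (f A) u) powr p"
        using kl y test_const_pos p by (intro powr_mono2) auto
      also have "\<dots> \<le> (\<Sum>A\<in>Pow N. 1 / n2) powr (p - 1) * (\<Sum>A\<in>Pow N. 1 / n2 * gauss_mod \<alpha> (f A) u powr p)"
        using p N n2 by (intro power_mean_sum) auto
      also have "(\<Sum>A\<in>Pow N. 1 / n2) = 1" using N by (simp add: card_Pow n2_def)
      finally have "(kl * (y \<nu> * (test_const * W \<nu> powr (- 1 / p)))) powr p \<le> (\<Sum>A\<in>Pow N. 1 / n2 * gauss_mod \<alpha> (f A) u powr p)"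
        by simp
      moreover have "(kl * (y \<nu> * (test_const * W \<nu> powr (- 1 / p)))) powr p = e \<nu>"
        using kl test_const_pos y[of \<nu>] by (simp only: e_def powr_mult W_powr less_imp_le powr_ge_zero mult_nonneg_nonneg) simp
      ultimately show ?thesis by simp
    qed
    have msf: "(\<lambda>u. ennreal (gauss_mod \<alpha> (f A) u powr p)) \<in> borel_measurable \<mu>" for A
      using f_mem[of A] mu by (intro gauss_mod_measurable) (auto simp: fock_set_def)
    have "ennreal (\<Sum>\<nu>\<in>N. e \<nu> * cell_mass \<mu> \<nu>) = (\<Sum>\<nu>\<in>N. ennreal (e \<nu>) * emeasure \<mu> (cell h \<nu>))"
      unfolding em using e0 by (subst sum_ennreal[symmetric]) (auto simp: cell_mass_def ennreal_mult)
    also have "\<dots> = (\<integral>\<^sup>+u. (\<Sum>\<nu>\<in>N. ennreal (e \<nu>) * indicator (cell h \<nu>) u) \<partial>\<mu>)"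
      using mu by (subst nn_integral_sum) (auto simp: nn_integral_cmult_indicator)
    also have "\<dots> \<le> (\<integral>\<^sup>+u. (\<Sum>A\<in>Pow N. ennreal (1 / n2) * ennreal (gauss_mod \<alpha> (f A) u powr p)) \<partial>\<mu>)"
    proof (rule nn_integral_mono)
      fix u
      have "(\<Sum>\<nu>\<in>N. ennreal (e \<nu>) * indicator (cell h \<nu>) u) = (\<Sum>\<nu>\<in>N. if \<nu> = cell_index h u then ennreal (e (cell_index h u)) else 0)"
        by (intro sum.cong) (auto simp: indicator_def cell_def)
      also have "\<dots> = (if cell_index h u \<in> N then ennreal (e (cell_index h u)) else 0)" using N by simp
      also have "\<dots> \<le> ennreal (\<Sum>A\<in>Pow N. 1 / n2 * gauss_mod \<alpha> (f A) u powr p)"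
        using pt[of u "cell_index h u"] by (auto simp: cell_def intro!: ennreal_leI)
      also have "\<dots> = (\<Sum>A\<in>Pow N. ennreal (1 / n2) * ennreal (gauss_mod \<alpha> (f A) u powr p))"
        using n2 by (subst sum_ennreal[symmetric]) (auto simp: ennreal_mult[symmetric])
      finally show "(\<Sum>\<nu>\<in>N. ennreal (e \<nu>) * indicator (cell h \<nu>) u) \<le> (\<Sum>A\<in>Pow N. ennreal (1 / n2) * ennreal (gauss_mod \<alpha> (f A) u powr p))" .
    qed
    also have "\<dots> = (\<Sum>A\<in>Pow N. ennreal (1 / n2) * fock_mass \<alpha> p \<mu> (f A))"
      using msf by (simp add: nn_integral_sum nn_integral_cmult fock_mass_def)
    also have "\<dots> = (\<Sum>A\<in>Pow N. ennreal (1 / n2 * fock_norm \<alpha> p \<mu> (f A) powr p))"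
      using n2 p fock_mass_eq_norm[OF _ fin[OF f_mem]] by (intro sum.cong) (auto simp: ennreal_mult[symmetric])
    also have "\<dots> = ennreal X" unfolding X_def using n2 by (intro sum_ennreal) auto
    finally have "(\<Sum>\<nu>\<in>N. e \<nu> * cell_mass \<mu> \<nu>) \<le> X" using X0 by (simp add: ennreal_le_iff)
    moreover have "(\<Sum>\<nu>\<in>N. e \<nu> * cell_mass \<mu> \<nu>) = (kl * test_const) powr p * (\<Sum>\<nu>\<in>N. cell_mass \<mu> \<nu> / W \<nu> * y \<nu> powr p)"
      by (simp add: e_def sum_distrib_left mult_ac)
    ultimately have "(kl * test_const) powr p * (\<Sum>\<nu>\<in>N. cell_mass \<mu> \<nu> / W \<nu> * y \<nu> powr p)
        \<le> K powr p * (ku powr (p / r) * (D powr p * Q powr (p / 2)))" using X1 by linarith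
    then show ?thesis using kl test_const_pos by (simp add: C_def field_simps)
  qed
  with C show ?thesis unfolding sign_bound_def by blast
qed

text \<open>For p >= 2 the conjugate exponent is at most 2, so the unit ball of l^p' lies in that of
  l^2, and y = 1 is admissible with Q = 1.\<close>

lemma summing_lower_ge2:
  assumes r: "p \<le> r" and p2: "2 \<le> p"
  shows "\<exists>C>0. lower_bound r p C"
proof -
  obtain C where C: "C > 0" and sb: "sign_bound r C"
    using summing_lower_random[OF r] by blast
  note lo = sb[unfolded sign_bound_def, rule_format]
  have q: "1 < conj_exp p" "conj_exp p \<le> 2" using p2 conj_exp_gt1[OF p] by (auto simp: conj_exp_def field_simps)
  have "(\<Sum>\<nu>\<in>N. (cell_mass \<mu> \<nu> / W \<nu>) powr (p / p)) \<le> C * K powr p"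
    if mu: "sets \<mu> = sets borel" and fin': "\<forall>f\<in>fock_set \<alpha> p wm. fock_mass \<alpha> p \<mu> f < top"
      and sc: "lattice_summing r \<mu> K" and N: "finite N" for \<mu> K N
  proof -
    note fin = fin'[rule_format]
    have "(\<Sum>\<nu>\<in>N. cell_mass \<mu> \<nu> / W \<nu> * 1 powr p) \<le> C * K powr p * 1 powr (p / 2)"
    proof (rule lo[OF mu fin sc N])
      fix c :: "int \<times> int \<Rightarrow> real" assume c: "\<And>\<nu>. \<nu> \<in> N \<Longrightarrow> 0 \<le> c \<nu>" and c1: "(\<Sum>\<nu>\<in>N. c \<nu> powr conj_exp p) \<le> 1"
      have "(\<Sum>\<nu>\<in>N. (1 * c \<nu>)\<^sup>2) = (\<Sum>\<nu>\<in>N. c \<nu> powr 2)" using c by (intro sum.cong) auto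
      also have "\<dots> \<le> (\<Sum>\<nu>\<in>N. c \<nu> powr conj_exp p) powr (2 / conj_exp p)"
        using q N c by (intro sum_powr_le_powr_sum) auto
      also have "\<dots> \<le> 1 powr (2 / conj_exp p)" using c1 q by (intro powr_mono2) (auto intro: sum_nonneg)
      finally show "(\<Sum>\<nu>\<in>N. (1 * c \<nu>)\<^sup>2) \<le> 1" by simp
    qed auto
    then show ?thesis using W p by (simp add: less_imp_le)
  qed
  with C show ?thesis unfolding lower_bound_def by blast
qed

text \<open>For p < 2 the conjugate exponent exceeds 2, and a diagonal operator from l^p' to l^2 is
  measured by the l^(2p/(2 - p)) norm of y. For the right y both sides are powers of T, giving T <=
  C K^p T^(1 - p/2), in which the finite number T can be divided out.\<close>

lemma summing_lower_lt2:
  assumes r: "2 \<le> r" and p2: "p < 2"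
  shows "\<exists>C>0. lower_bound r 2 C"
proof -
  have "p \<le> r" using r p2 by simp
  then obtain C where C: "C > 0" and sb: "sign_bound r C"
    using summing_lower_random by blast
  note lo = sb[unfolded sign_bound_def, rule_format]
  define q where "q = conj_exp p"
  have q: "q > 2" unfolding q_def conj_exp_def using p p2 by (simp add: less_divide_eq)
  have q2: "2 / q + (2 - p) / p = 1"
    unfolding q_def conj_exp_def using p by (simp add: field_simps)
  have "(\<Sum>\<nu>\<in>N. (cell_mass \<mu> \<nu> / W \<nu>) powr (2 / p)) \<le> C powr (2 / p) * K powr 2"
    if mu: "sets \<mu> = sets borel" and fin': "\<forall>f\<in>fock_set \<alpha> p wm. fock_mass \<alpha> p \<mu> f < top"
      and sc: "lattice_summing r \<mu> K" and N: "finite N" for \<mu> K N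
  proof -
    note fin = fin'[rule_format]
    have K0: "K \<ge> 0" using sc by (simp add: summing_const_def)
    define b where "b \<nu> = cell_mass \<mu> \<nu> / W \<nu>" for \<nu>
    have b0: "b \<nu> \<ge> 0" for \<nu> using W[of \<nu>] by (simp add: b_def)
    define T where "T = (\<Sum>\<nu>\<in>N. b \<nu> powr (2 / p))"
    have T0: "T \<ge> 0" by (simp add: T_def sum_nonneg)
    \<comment> \<open>the extremal weight for the Hoelder inequality bounding \<open>Q\<close>\<close>
    define y where "y \<nu> = b \<nu> powr ((2 - p) / (p * p))" for \<nu>
    have "(\<Sum>\<nu>\<in>N. b \<nu> * y \<nu> powr p) \<le> C * K powr p * (T powr ((2 - p) / p)) powr (p / 2)"
      unfolding b_def
    proof (rule lo[OF mu fin sc N])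
      fix c :: "int \<times> int \<Rightarrow> real" assume c: "\<And>\<nu>. \<nu> \<in> N \<Longrightarrow> 0 \<le> c \<nu>" and c1: "(\<Sum>\<nu>\<in>N. c \<nu> powr conj_exp p) \<le> 1"
      have "(\<Sum>\<nu>\<in>N. (y \<nu> * c \<nu>)\<^sup>2) = (\<Sum>\<nu>\<in>N. c \<nu> powr 2 * y \<nu> powr 2)"
        using c by (intro sum.cong) (auto simp: y_def power_mult_distrib mult.commute)
      also have "\<dots> \<le> (\<Sum>\<nu>\<in>N. (c \<nu> powr 2) powr (q / 2)) powr (1 / (q / 2)) * (\<Sum>\<nu>\<in>N. (y \<nu> powr 2) powr (p / (2 - p))) powr (1 / (p / (2 - p)))"
        using q N q2 by (intro Holder_sum) auto
      also have "(\<Sum>\<nu>\<in>N. (c \<nu> powr 2) powr (q / 2)) = (\<Sum>\<nu>\<in>N. c \<nu> powr conj_exp p)" by (simp add: powr_powr q_def)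
      also have "(\<Sum>\<nu>\<in>N. (y \<nu> powr 2) powr (p / (2 - p))) = T"
      proof -
        have "(2 - p) / (p * p) * 2 * (p / (2 - p)) = 2 / p" using p p2 by (simp add: field_simps)
        then show ?thesis by (simp only: T_def y_def powr_powr)
      qed
      also have "(\<Sum>\<nu>\<in>N. c \<nu> powr conj_exp p) powr (1 / (q / 2)) * T powr (1 / (p / (2 - p))) \<le> 1 powr (1 / (q / 2)) * T powr (1 / (p / (2 - p)))"
        using c1 q by (intro mult_right_mono powr_mono2) (auto intro: sum_nonneg)
      finally show "(\<Sum>\<nu>\<in>N. (y \<nu> * c \<nu>)\<^sup>2) \<le> T powr ((2 - p) / p)" by simp
    qed (auto simp: y_def)
    also have "(\<Sum>\<nu>\<in>N. b \<nu> * y \<nu> powr p) = T"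
      unfolding T_def
    proof (rule sum.cong)
      fix \<nu>
      have "b \<nu> * y \<nu> powr p = b \<nu> powr 1 * b \<nu> powr ((2 - p) / p)"
        using b0[of \<nu>] p by (simp add: y_def powr_powr)
      also have "\<dots> = b \<nu> powr (1 + (2 - p) / p)" by (simp only: powr_add)
      also have "1 + (2 - p) / p = 2 / p" using p by (simp add: field_simps)
      finally show "b \<nu> * y \<nu> powr p = b \<nu> powr (2 / p)" .
    qed simp
    also have "(T powr ((2 - p) / p)) powr (p / 2) = T powr (1 - p / 2)"
    proof -
      have "(2 - p) / p * (p / 2) = 1 - p / 2" using p by (simp add: field_simps)
      then show ?thesis by (simp only: powr_powr)
    qed
    finally have TT: "T \<le> C * K powr p * T powr (1 - p / 2)" .
    have "T \<le> C powr (2 / p) * K powr 2"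
    proof (cases "T = 0")
      case False
      with T0 have T: "T > 0" by simp
      have "T = T powr (p / 2) * T powr (1 - p / 2)" using T by (simp add: powr_add[symmetric])
      with TT have "T powr (p / 2) * T powr (1 - p / 2) \<le> C * K powr p * T powr (1 - p / 2)" by simp
      then have "T powr (p / 2) \<le> C * K powr p" using T by simp
      then have "(T powr (p / 2)) powr (2 / p) \<le> (C * K powr p) powr (2 / p)" using p by (intro powr_mono2) auto
      then show ?thesis using T C p by (simp add: powr_powr powr_mult)
    qed (use C in auto)
    then show ?thesis by (simp add: T_def b_def)
  qed
  moreover have "C powr (2 / p) > 0" using C by simp
  ultimately show ?thesis unfolding lower_bound_def by blast
qed

end

lemma ennreal_inverse_antimono:
  fixes a b :: ennreal
  shows "a \<le> b \<Longrightarrow> inverse b \<le> inverse a"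
  unfolding less_eq_ennreal.rep_eq inverse_ennreal.rep_eq
  by (intro ereal_inverse_antimono) (auto simp: enn2ereal_nonneg)

section \<open>The averaging function\<close>

text \<open>
  Fubini is not available, as the measure need not be \<open>\<sigma>\<close>-finite; the map is lower semicontinuous.
\<close>

lemma measurable_emeasure_ball:
  fixes m :: "complex measure"
  assumes m: "sets borel \<subseteq> sets m"
  shows "(\<lambda>z. emeasure m (ball z 1)) \<in> borel_measurable borel"
proof (rule borel_measurableI_greater)
  fix y :: ennreal
  have "open {z. y < emeasure m (ball z 1)}"
    unfolding open_dist
  proof (intro ballI)
    fix z assume "z \<in> {z. y < emeasure m (ball z 1)}"
    then have y: "y < emeasure m (ball z 1)" by simp
    define A where "A n = ball z (1 - 1 / real (Suc n))" for n
    have "incseq A"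
      unfolding A_def incseq_def by (intro allI impI subset_ball diff_left_mono) (simp add: frac_le)
    moreover have "range A \<subseteq> sets m" using m by (auto simp: A_def)
    ultimately have "(SUP n. emeasure m (A n)) = emeasure m (\<Union>n. A n)" by (rule SUP_emeasure_incseq[rotated])
    also have "(\<Union>n. A n) = ball z 1"
    proof (intro equalityI subsetI)
      fix x assume "x \<in> ball z 1"
      then have "0 < 1 - dist z x" by simp
      then obtain n where "1 / real (Suc n) < 1 - dist z x" using nat_approx_posE by blast
      then show "x \<in> (\<Union>n. A n)" unfolding A_def by (intro UN_I[of n]) auto
    next
      fix x assume "x \<in> (\<Union>n. A n)"
      then obtain n where "dist z x < 1 - 1 / real (Suc n)" by (auto simp: A_def)
      also have "\<dots> \<le> 1" by simp
      finally show "x \<in> ball z 1" by simp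
    qed
    finally obtain n where n: "y < emeasure m (A n)" using y by (metis less_SUP_iff)
    have "y < emeasure m (ball x 1)" if "dist x z < 1 / real (Suc n)" for x
    proof -
      have "A n \<subseteq> ball x 1"
      proof
        fix u assume "u \<in> A n"
        then have "dist z u < 1 - 1 / real (Suc n)" by (simp add: A_def)
        then show "u \<in> ball x 1" using that dist_triangle[of x u z] by simp
      qed
      then have "emeasure m (A n) \<le> emeasure m (ball x 1)" using m by (intro emeasure_mono) auto
      then show ?thesis using n by simp
    qed
    then show "\<exists>e>0. \<forall>x. dist x z < e \<longrightarrow> x \<in> {z. y < emeasure m (ball z 1)}"
      by (intro exI[of _ "1 / real (Suc n)"]) auto
  qed
  then show "{x \<in> space borel. y < emeasure m (ball x 1)} \<in> sets borel" by simp
qed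

lemma epowr_ennreal: "x \<ge> 0 \<Longrightarrow> epowr (ennreal x) s = ennreal (x powr s)"
  by (simp add: epowr_def)

lemma epowr_mono: "s > 0 \<Longrightarrow> x \<le> y \<Longrightarrow> epowr x s \<le> epowr y s"
  by (cases x; cases y) (auto simp: epowr_def top_unique intro!: ennreal_leI powr_mono2)

lemma measurable_epowr [measurable]:
  assumes "f \<in> borel_measurable m"
  shows "(\<lambda>x. epowr (f x) s) \<in> borel_measurable m"
  using assms unfolding epowr_def by measurable

context fock_lattice
begin

definition lattice_average :: "complex measure \<Rightarrow> complex \<Rightarrow> ennreal" where
  "lattice_average \<mu> z = emeasure \<mu> (ball z 1) / emeasure wm (ball z 1)"

text \<open>A displacement of length at most 1 changes each cell index by at most this
  number.\<close>

definition ball_reach :: nat where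
  "ball_reach = nat \<lceil>1 / h\<rceil>"

lemma lattice_average_measurable:
  assumes "sets \<mu> = sets borel"
  shows "lattice_average \<mu> \<in> borel_measurable lebesgue"
proof -
  have "(\<lambda>z. emeasure \<mu> (ball z 1)) \<in> borel_measurable borel" "(\<lambda>z. emeasure wm (ball z 1)) \<in> borel_measurable borel"
    using assms sets_wm by (auto intro!: measurable_emeasure_ball)
  then have "lattice_average \<mu> \<in> borel_measurable borel" unfolding lattice_average_def by measurable
  then show ?thesis by (rule borel_measurable_finer) auto
qed

lemma cell_subset_ball:
  assumes "z \<in> cell h \<nu>"
  shows "cell h \<nu> \<subseteq> ball z 1"
proof
  fix u assume u: "u \<in> cell h \<nu>"
  have "cmod (z - u) \<le> cmod (z - cell_center h \<nu>) + cmod (u - cell_center h \<nu>)"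
    using norm_triangle_ineq4[of "z - cell_center h \<nu>" "u - cell_center h \<nu>"] by simp
  also have "\<dots> \<le> h + h" using assms u h by (intro add_mono cell_center_dist_upper) auto
  finally show "u \<in> ball z 1" using h by (simp add: dist_norm)
qed

lemma ball_subset_cells:
  assumes "z \<in> cell h \<nu>"
  shows "ball z 1 \<subseteq> (\<Union>\<kappa>\<in>cell_block ball_reach \<nu>. cell h \<kappa>)"
proof
  fix u assume u: "u \<in> ball z 1"
  have "1 / h \<le> real ball_reach" unfolding ball_reach_def by linarith
  then have "1 \<le> real ball_reach * h" using h by (simp add: divide_le_eq)
  then have "cmod (u - z) \<le> real ball_reach * h" using u by (simp add: dist_norm norm_minus_commute)
  then have "cell_index h u \<in> cell_block ball_reach (cell_index h z)" using h by (intro cell_index_near)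
  then show "u \<in> (\<Union>\<kappa>\<in>cell_block ball_reach \<nu>. cell h \<kappa>)" using assms by (auto simp: cell_def)
qed

lemma emeasure_ball_le_cells:
  assumes "z \<in> cell h \<nu>" "sets borel \<subseteq> sets m"
  shows "emeasure m (ball z 1) \<le> (\<Sum>\<kappa>\<in>cell_block ball_reach \<nu>. emeasure m (cell h \<kappa>))"
proof -
  have "emeasure m (ball z 1) \<le> emeasure m (\<Union>\<kappa>\<in>cell_block ball_reach \<nu>. cell h \<kappa>)"
    using assms by (intro emeasure_mono ball_subset_cells) (auto intro!: sets.finite_UN)
  also have "\<dots> \<le> (\<Sum>\<kappa>\<in>cell_block ball_reach \<nu>. emeasure m (cell h \<kappa>))"
    using assms by (intro emeasure_subadditive_finite) auto
  finally show ?thesis .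
qed

definition ball_const :: real where
  "ball_const = real (card (cell_block ball_reach (0, 0))) * M ^ (2 * ball_reach)"

lemma ball_const_pos: "ball_const > 0"
  using M by (simp add: ball_const_def card_cell_block)

lemma wm_ball_upper: "z \<in> cell h \<nu> \<Longrightarrow> emeasure wm (ball z 1) \<le> ennreal (ball_const * W \<nu>)"
proof -
  assume z: "z \<in> cell h \<nu>"
  have "emeasure wm (ball z 1) \<le> (\<Sum>\<kappa>\<in>cell_block ball_reach \<nu>. emeasure wm (cell h \<kappa>))"
    using z by (rule emeasure_ball_le_cells) (auto simp: sets_wm)
  also have "\<dots> = ennreal (\<Sum>\<kappa>\<in>cell_block ball_reach \<nu>. W \<kappa>)"
    unfolding emeasure_cell using W by (intro sum_ennreal) (auto simp: less_imp_le)
  also have "\<dots> \<le> ennreal (ball_const * W \<nu>)"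
  proof (rule ennreal_leI)
    have "(\<Sum>\<kappa>\<in>cell_block ball_reach \<nu>. W \<kappa>) \<le> (\<Sum>\<kappa>\<in>cell_block ball_reach \<nu>. M ^ (2 * ball_reach) * W \<nu>)" by (intro sum_mono W_cell_block)
    then show "(\<Sum>\<kappa>\<in>cell_block ball_reach \<nu>. W \<kappa>) \<le> ball_const * W \<nu>" by (simp add: ball_const_def card_cell_block mult_ac)
  qed
  finally show ?thesis .
qed

lemma wm_ball_lower: "z \<in> cell h \<nu> \<Longrightarrow> ennreal (W \<nu>) \<le> emeasure wm (ball z 1)"
  unfolding emeasure_cell[symmetric] by (intro emeasure_mono cell_subset_ball) (auto simp: sets_wm)

text \<open>Comparison with discs of radius h/2 inside and 2 h outside the cell; the numbers 1/4 and
  16 absorb pi.\<close>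

lemma cell_area:
  "ennreal (h\<^sup>2 / 4) \<le> emeasure lebesgue (cell h \<nu>)" "emeasure lebesgue (cell h \<nu>) \<le> ennreal (16 * h\<^sup>2)"
proof -
  have area: "emeasure lebesgue (ball z \<rho>) = ennreal (pi * \<rho>\<^sup>2)" if "\<rho> \<ge> 0" for z :: complex and \<rho>
    using that by (simp add: emeasure_ball unit_ball_vol_2)
  have "ball (cell_center h \<nu>) (h / 2) \<subseteq> cell h \<nu>"
    by (rule ball_subset_cell[OF h(1)])
  then have "emeasure lebesgue (ball (cell_center h \<nu>) (h / 2)) \<le> emeasure lebesgue (cell h \<nu>)"
    by (rule emeasure_mono) simp
  then have "ennreal (pi * (h / 2)\<^sup>2) \<le> emeasure lebesgue (cell h \<nu>)"
    using h by (subst (asm) area) auto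
  moreover have "ennreal (h\<^sup>2 / 4) \<le> ennreal (pi * (h / 2)\<^sup>2)"
    using pi_gt3 by (intro ennreal_leI) (simp add: power_divide mult_le_cancel_right1)
  ultimately show "ennreal (h\<^sup>2 / 4) \<le> emeasure lebesgue (cell h \<nu>)" by (rule order_trans[rotated])
  have "cell h \<nu> \<subseteq> ball (cell_center h \<nu>) (2 * h)"
  proof
    fix u assume "u \<in> cell h \<nu>"
    from cell_center_dist_upper[OF h(1) this] show "u \<in> ball (cell_center h \<nu>) (2 * h)"
      using h by (simp add: dist_norm norm_minus_commute)
  qed
  then have "emeasure lebesgue (cell h \<nu>) \<le> emeasure lebesgue (ball (cell_center h \<nu>) (2 * h))"
    by (rule emeasure_mono) simp
  then have "emeasure lebesgue (cell h \<nu>) \<le> ennreal (pi * (2 * h)\<^sup>2)"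
    using h by (subst (asm) area) auto
  also have "\<dots> \<le> ennreal (16 * h\<^sup>2)"
    using pi_less_4 by (intro ennreal_leI) (simp add: power_mult_distrib mult_right_mono)
  finally show "emeasure lebesgue (cell h \<nu>) \<le> ennreal (16 * h\<^sup>2)" .
qed

text \<open>On a cell the average is at least the measure of the cell divided by
  \<open>ball_const * W \<nu>\<close>, so the integral dominates a lattice sum; 4 / h^2 is the
  inverse of the lower bound for the area. A cell of infinite measure would make the average
  infinite on a set of positive area.\<close>

lemma lattice_average_lower:
  assumes mu: "sets \<mu> = sets borel" and s: "s > 0" and fin: "integral_powr s (lattice_average \<mu>) < top"
  shows "emeasure \<mu> (cell h \<nu>) < top"
    and "finite N \<Longrightarrow> (\<Sum>\<nu>\<in>N. (cell_mass \<mu> \<nu> / W \<nu>) powr s) \<le> ball_const powr s * 4 / h\<^sup>2 * enn2real (integral_powr s (lattice_average \<mu>))"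
proof -
  have ms: "(\<lambda>z. epowr (lattice_average \<mu> z) s) \<in> borel_measurable lebesgue"
    using lattice_average_measurable[OF mu] by measurable
  have low: "emeasure \<mu> (cell h \<nu>) / ennreal (ball_const * W \<nu>) \<le> lattice_average \<mu> z" if z: "z \<in> cell h \<nu>" for z \<nu>
  proof -
    have "emeasure \<mu> (cell h \<nu>) / ennreal (ball_const * W \<nu>) \<le> emeasure \<mu> (ball z 1) / ennreal (ball_const * W \<nu>)"
      using mu by (intro divide_right_mono_ennreal emeasure_mono cell_subset_ball z) auto
    also have "\<dots> \<le> lattice_average \<mu> z"
      unfolding lattice_average_def divide_ennreal_def using wm_ball_upper[OF z]
      by (intro mult_left_mono) (auto simp: ennreal_inverse_antimono)
    finally show ?thesis .
  qed
  have sumle: "(\<Sum>\<nu>\<in>N. epowr (emeasure \<mu> (cell h \<nu>) / ennreal (ball_const * W \<nu>)) s * ennreal (h\<^sup>2 / 4)) \<le> integral_powr s (lattice_average \<mu>)"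
    if N: "finite N" for N
  proof -
    have "(\<Sum>\<nu>\<in>N. epowr (emeasure \<mu> (cell h \<nu>) / ennreal (ball_const * W \<nu>)) s * ennreal (h\<^sup>2 / 4))
       \<le> (\<Sum>\<nu>\<in>N. epowr (emeasure \<mu> (cell h \<nu>) / ennreal (ball_const * W \<nu>)) s * emeasure lebesgue (cell h \<nu>))"
      by (intro sum_mono mult_left_mono cell_area) auto
    also have "\<dots> = (\<Sum>\<nu>\<in>N. (\<integral>\<^sup>+z. epowr (emeasure \<mu> (cell h \<nu>) / ennreal (ball_const * W \<nu>)) s * indicator (cell h \<nu>) z \<partial>lebesgue))"
      by (subst nn_integral_cmult_indicator) auto
    also have "\<dots> \<le> (\<Sum>\<nu>\<in>N. (\<integral>\<^sup>+z. epowr (lattice_average \<mu> z) s * indicator (cell h \<nu>) z \<partial>lebesgue))"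
      using low s by (intro sum_mono nn_integral_mono) (auto simp: indicator_def intro!: epowr_mono)
    also have "\<dots> = (\<integral>\<^sup>+z. (\<Sum>\<nu>\<in>N. epowr (lattice_average \<mu> z) s * indicator (cell h \<nu>) z) \<partial>lebesgue)"
      by (subst nn_integral_sum) (auto intro!: borel_measurable_times_ennreal borel_measurable_indicator ms)
    also have "\<dots> \<le> integral_powr s (lattice_average \<mu>)"
      unfolding integral_powr_def
    proof (rule nn_integral_mono)
      fix z
      have "(\<Sum>\<nu>\<in>N. epowr (lattice_average \<mu> z) s * indicator (cell h \<nu>) z) = (\<Sum>\<nu>\<in>N. if \<nu> = cell_index h z then epowr (lattice_average \<mu> z) s else 0)"
        by (intro sum.cong) (auto simp: indicator_def cell_def)
      also have "\<dots> = (if cell_index h z \<in> N then epowr (lattice_average \<mu> z) s else 0)" using N by simp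
      finally show "(\<Sum>\<nu>\<in>N. epowr (lattice_average \<mu> z) s * indicator (cell h \<nu>) z) \<le> epowr (lattice_average \<mu> z) s" by simp
    qed
    finally show ?thesis .
  qed
  have h4: "h\<^sup>2 / 4 > 0" using h by simp
  have wW: "ball_const * W \<nu> > 0" for \<nu> using ball_const_pos W[of \<nu>] by simp
  show cfin: "emeasure \<mu> (cell h \<nu>) < top" for \<nu>
  proof (rule ccontr)
    assume "\<not> emeasure \<mu> (cell h \<nu>) < top"
    then have "emeasure \<mu> (cell h \<nu>) = top" using less_top by blast
    then have "epowr (emeasure \<mu> (cell h \<nu>) / ennreal (ball_const * W \<nu>)) s = top"
      by (simp add: epowr_def ennreal_top_divide)
    then show False using sumle[of "{\<nu>}"] fin h4 by (simp add: ennreal_top_mult)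
  qed
  show "(\<Sum>\<nu>\<in>N. (cell_mass \<mu> \<nu> / W \<nu>) powr s) \<le> ball_const powr s * 4 / h\<^sup>2 * enn2real (integral_powr s (lattice_average \<mu>))" if N: "finite N"
  proof -
    have term_eq: "epowr (emeasure \<mu> (cell h \<nu>) / ennreal (ball_const * W \<nu>)) s * ennreal (h\<^sup>2 / 4)
       = ennreal ((cell_mass \<mu> \<nu> / W \<nu>) powr s / ball_const powr s * (h\<^sup>2 / 4))" for \<nu>
    proof -
      have ec: "emeasure \<mu> (cell h \<nu>) = ennreal (cell_mass \<mu> \<nu>)" using cfin[of \<nu>] by (simp add: cell_mass_def)
      have "cell_mass \<mu> \<nu> \<ge> 0" by (simp add: cell_mass_def)
      then have "emeasure \<mu> (cell h \<nu>) / ennreal (ball_const * W \<nu>) = ennreal (cell_mass \<mu> \<nu> / (ball_const * W \<nu>))"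
        unfolding ec using wW[of \<nu>] by (rule divide_ennreal)
      moreover have "cell_mass \<mu> \<nu> / (ball_const * W \<nu>) = (cell_mass \<mu> \<nu> / W \<nu>) / ball_const" by simp
      moreover have "cell_mass \<mu> \<nu> / W \<nu> \<ge> 0" using W[of \<nu>] by (simp add: cell_mass_def)
      ultimately show ?thesis using ball_const_pos h4
        by (simp only: epowr_ennreal divide_nonneg_nonneg less_imp_le powr_divide ennreal_mult powr_ge_zero)
    qed
    have "ennreal (\<Sum>\<nu>\<in>N. (cell_mass \<mu> \<nu> / W \<nu>) powr s / ball_const powr s * (h\<^sup>2 / 4)) \<le> integral_powr s (lattice_average \<mu>)"
      using sumle[OF N] unfolding term_eq by (subst (asm) sum_ennreal) auto
    also have "integral_powr s (lattice_average \<mu>) = ennreal (enn2real (integral_powr s (lattice_average \<mu>)))" using fin by simp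
    finally have "(\<Sum>\<nu>\<in>N. (cell_mass \<mu> \<nu> / W \<nu>) powr s / ball_const powr s * (h\<^sup>2 / 4)) \<le> enn2real (integral_powr s (lattice_average \<mu>))"
      by (simp add: ennreal_le_iff)
    also have "(\<Sum>\<nu>\<in>N. (cell_mass \<mu> \<nu> / W \<nu>) powr s / ball_const powr s * (h\<^sup>2 / 4)) = (h\<^sup>2 / 4 / ball_const powr s) * (\<Sum>\<nu>\<in>N. (cell_mass \<mu> \<nu> / W \<nu>) powr s)"
      unfolding sum_distrib_left by (intro sum.cong) (simp_all add: mult.commute)
    finally show ?thesis using h ball_const_pos by (simp add: field_simps)
  qed
qed

text \<open>On a cell the average is controlled by the cells of the surrounding block, whose weights
  are comparable; as each cell lies in boundedly many blocks, summation costs only a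
  constant.\<close>

lemma lattice_average_upper:
  assumes s: "s > 0"
  obtains C where "C > 0"
    "\<And>\<mu> X. sets \<mu> = sets borel \<Longrightarrow> (\<And>\<nu>. emeasure \<mu> (cell h \<nu>) < top) \<Longrightarrow>
      (\<And>N. finite N \<Longrightarrow> (\<Sum>\<nu>\<in>N. (cell_mass \<mu> \<nu> / W \<nu>) powr s) \<le> X) \<Longrightarrow> integral_powr s (lattice_average \<mu>) \<le> ennreal (C * X)"
proof -
  define n where "n = real (card (cell_block ball_reach (0, 0)))"
  have cn: "real (card (cell_block ball_reach \<nu>)) = n" for \<nu> by (simp add: n_def card_cell_block)
  have n: "n > 0" by (simp add: n_def card_cell_block)
  define K where "K = (n * M ^ (2 * ball_reach)) powr s"
  have K: "K > 0" unfolding K_def using n M by simp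
  define C where "C = 16 * h\<^sup>2 * K * n"
  have C: "C > 0" unfolding C_def using n K h by simp
  have "integral_powr s (lattice_average \<mu>) \<le> ennreal (C * X)"
    if mu: "sets \<mu> = sets borel" and fin: "\<And>\<nu>. emeasure \<mu> (cell h \<nu>) < top"
      and X: "\<And>N. finite N \<Longrightarrow> (\<Sum>\<nu>\<in>N. (cell_mass \<mu> \<nu> / W \<nu>) powr s) \<le> X" for \<mu> X
  proof -
    define b where "b \<nu> = cell_mass \<mu> \<nu> / W \<nu>" for \<nu>
    have b0: "b \<nu> \<ge> 0" for \<nu> unfolding b_def using W[of \<nu>] by (simp add: cell_mass_def)
    have ec: "emeasure \<mu> (cell h \<nu>) = ennreal (cell_mass \<mu> \<nu>)" for \<nu> using fin[of \<nu>] by (simp add: cell_mass_def)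
    have cm0: "cell_mass \<mu> \<nu> \<ge> 0" for \<nu> by (simp add: cell_mass_def)
    have up: "epowr (lattice_average \<mu> z) s \<le> ennreal (K * (\<Sum>\<kappa>\<in>cell_block ball_reach \<nu>. b \<kappa> powr s))" if z: "z \<in> cell h \<nu>" for z \<nu>
    proof -
      define S where "S = (\<Sum>\<kappa>\<in>cell_block ball_reach \<nu>. b \<kappa> powr s)"
      have S0: "S \<ge> 0" unfolding S_def by (intro sum_nonneg) auto
      have "lattice_average \<mu> z \<le> ennreal (\<Sum>\<kappa>\<in>cell_block ball_reach \<nu>. cell_mass \<mu> \<kappa>) / emeasure wm (ball z 1)"
        unfolding lattice_average_def using emeasure_ball_le_cells[OF z, of \<mu>] mu cm0
        by (intro divide_right_mono_ennreal) (simp add: ec sum_ennreal)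
      also have "\<dots> \<le> ennreal (\<Sum>\<kappa>\<in>cell_block ball_reach \<nu>. cell_mass \<mu> \<kappa>) / ennreal (W \<nu>)"
        unfolding divide_ennreal_def using wm_ball_lower[OF z]
        by (intro mult_left_mono) (auto simp: ennreal_inverse_antimono)
      also have "\<dots> = ennreal ((\<Sum>\<kappa>\<in>cell_block ball_reach \<nu>. cell_mass \<mu> \<kappa>) / W \<nu>)"
        using W[of \<nu>] cm0 by (simp add: divide_ennreal sum_nonneg)
      finally have m1: "lattice_average \<mu> z \<le> ennreal ((\<Sum>\<kappa>\<in>cell_block ball_reach \<nu>. cell_mass \<mu> \<kappa>) / W \<nu>)" .
      \<comment> \<open>Each term is bounded by the l^s quantity S^(1/s) of the block, which works
        alike for s below and above 1.\<close>
      have m2: "(\<Sum>\<kappa>\<in>cell_block ball_reach \<nu>. cell_mass \<mu> \<kappa>) / W \<nu> \<le> n * M ^ (2 * ball_reach) * S powr (1/s)"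
      proof -
        have "cell_mass \<mu> \<kappa> / W \<nu> \<le> M ^ (2 * ball_reach) * S powr (1/s)" if \<kappa>: "\<kappa> \<in> cell_block ball_reach \<nu>" for \<kappa>
        proof -
          have "b \<kappa> powr s \<le> S" unfolding S_def using \<kappa> by (intro member_le_sum) auto
          then have "(b \<kappa> powr s) powr (1/s) \<le> S powr (1/s)" using s by (intro powr_mono2) auto
          then have bS: "b \<kappa> \<le> S powr (1/s)" using s b0[of \<kappa>] by (simp add: powr_powr)
          have "W \<kappa> \<le> M ^ (2 * ball_reach) * W \<nu>" by (rule W_cell_block[OF \<kappa>])
          then have "b \<kappa> * W \<kappa> \<le> S powr (1/s) * (M ^ (2 * ball_reach) * W \<nu>)"
            using bS W[of \<kappa>] by (intro mult_mono) auto
          moreover have "b \<kappa> * W \<kappa> = cell_mass \<mu> \<kappa>" using W[of \<kappa>] by (simp add: b_def)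
          ultimately show ?thesis using W[of \<nu>] by (simp add: divide_le_eq mult_ac)
        qed
        then have "(\<Sum>\<kappa>\<in>cell_block ball_reach \<nu>. cell_mass \<mu> \<kappa> / W \<nu>) \<le> (\<Sum>\<kappa>\<in>cell_block ball_reach \<nu>. M ^ (2 * ball_reach) * S powr (1/s))" by (rule sum_mono)
        then show ?thesis by (simp add: sum_divide_distrib cn)
      qed
      have "epowr (lattice_average \<mu> z) s \<le> epowr (ennreal (n * M ^ (2 * ball_reach) * S powr (1/s))) s"
        using m1 ennreal_leI[OF m2] s by (intro epowr_mono) auto
      also have "\<dots> = ennreal (K * S)"
        using n M S0 s by (simp add: epowr_ennreal powr_mult powr_powr K_def)
      finally show ?thesis unfolding S_def .
    qed
    have ms: "(\<lambda>z. epowr (lattice_average \<mu> z) s) \<in> borel_measurable lebesgue"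
      using lattice_average_measurable[OF mu] by measurable
    have "integral_powr s (lattice_average \<mu>) = (\<integral>\<^sup>+\<nu>. (\<integral>\<^sup>+z\<in>cell h \<nu>. epowr (lattice_average \<mu> z) s \<partial>lebesgue) \<partial>count_space UNIV)"
      unfolding integral_powr_def by (intro nn_integral_cells ms) auto
    also have "\<dots> \<le> ennreal (C * X)"
    proof (rule nn_integral_count_space_le)
      fix N :: "(int \<times> int) set" assume N: "finite N"
      have "(\<Sum>\<nu>\<in>N. \<integral>\<^sup>+z\<in>cell h \<nu>. epowr (lattice_average \<mu> z) s \<partial>lebesgue)
         \<le> (\<Sum>\<nu>\<in>N. ennreal (16 * h\<^sup>2 * K * (\<Sum>\<kappa>\<in>cell_block ball_reach \<nu>. b \<kappa> powr s)))"
      proof (rule sum_mono)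
        fix \<nu>
        define B where "B = K * (\<Sum>\<kappa>\<in>cell_block ball_reach \<nu>. b \<kappa> powr s)"
        have B0: "B \<ge> 0" unfolding B_def using K by (intro mult_nonneg_nonneg sum_nonneg) auto
        have "(\<integral>\<^sup>+z\<in>cell h \<nu>. epowr (lattice_average \<mu> z) s \<partial>lebesgue) \<le> (\<integral>\<^sup>+z. ennreal B * indicator (cell h \<nu>) z \<partial>lebesgue)"
          using up[of _ \<nu>] by (intro nn_integral_mono) (auto simp: indicator_def B_def)
        also have "\<dots> = ennreal B * emeasure lebesgue (cell h \<nu>)"
          by (subst nn_integral_cmult_indicator) auto
        also have "\<dots> \<le> ennreal B * ennreal (16 * h\<^sup>2)" by (intro mult_left_mono cell_area) auto
        also have "\<dots> = ennreal (16 * h\<^sup>2 * B)" using B0 by (simp add: ennreal_mult[symmetric] mult.commute)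
        finally show "(\<integral>\<^sup>+z\<in>cell h \<nu>. epowr (lattice_average \<mu> z) s \<partial>lebesgue) \<le> ennreal (16 * h\<^sup>2 * K * (\<Sum>\<kappa>\<in>cell_block ball_reach \<nu>. b \<kappa> powr s))"
          by (simp add: B_def mult.assoc)
      qed
      also have "\<dots> = ennreal (16 * h\<^sup>2 * K * (\<Sum>\<nu>\<in>N. \<Sum>\<kappa>\<in>cell_block ball_reach \<nu>. b \<kappa> powr s))"
        using K by (subst sum_ennreal) (auto simp: sum_distrib_left sum_nonneg)
      also have "\<dots> \<le> ennreal (C * X)"
      proof (rule ennreal_leI)
        \<comment> \<open>All cells met by the blocks about N. A cell \<kappa> is counted once for
          each \<nu> in N whose block contains it, and these \<nu> lie in the block about \<kappa>,
          so there are at most n of them.\<close>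
        define U where "U = (\<Union>\<nu>\<in>N. cell_block ball_reach \<nu>)"
        have U: "finite U" using N by (simp add: U_def)
        have "(\<Sum>\<nu>\<in>N. \<Sum>\<kappa>\<in>cell_block ball_reach \<nu>. b \<kappa> powr s) = (\<Sum>\<nu>\<in>N. \<Sum>\<kappa>\<in>U. if \<kappa> \<in> cell_block ball_reach \<nu> then b \<kappa> powr s else 0)"
          using U by (intro sum.cong refl sum.mono_neutral_cong_left) (auto simp: U_def)
        also have "\<dots> = (\<Sum>\<kappa>\<in>U. \<Sum>\<nu>\<in>N. if \<kappa> \<in> cell_block ball_reach \<nu> then b \<kappa> powr s else 0)" by (rule sum.swap)
        also have "\<dots> \<le> (\<Sum>\<kappa>\<in>U. n * b \<kappa> powr s)"
        proof (rule sum_mono)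
          fix \<kappa>
          have "(\<Sum>\<nu>\<in>N. if \<kappa> \<in> cell_block ball_reach \<nu> then b \<kappa> powr s else 0) = real (card {\<nu>\<in>N. \<kappa> \<in> cell_block ball_reach \<nu>}) * b \<kappa> powr s"
            using N by (simp add: sum.If_cases Int_def)
          also have "\<dots> \<le> n * b \<kappa> powr s"
          proof (intro mult_right_mono)
            have "{\<nu>\<in>N. \<kappa> \<in> cell_block ball_reach \<nu>} \<subseteq> cell_block ball_reach \<kappa>" by (auto simp: cell_block_sym[of \<kappa>])
            then show "real (card {\<nu>\<in>N. \<kappa> \<in> cell_block ball_reach \<nu>}) \<le> n"
              using card_mono[of "cell_block ball_reach \<kappa>"] cn[of \<kappa>] by (metis finite_cell_block of_nat_mono)
          qed simp
          finally show "(\<Sum>\<nu>\<in>N. if \<kappa> \<in> cell_block ball_reach \<nu> then b \<kappa> powr s else 0) \<le> n * b \<kappa> powr s" .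
        qed
        also have "\<dots> = n * (\<Sum>\<kappa>\<in>U. b \<kappa> powr s)" by (simp add: sum_distrib_left)
        also have "\<dots> \<le> n * X" using X[OF U] n by (intro mult_left_mono) (auto simp: b_def)
        finally have "16 * h\<^sup>2 * K * (\<Sum>\<nu>\<in>N. \<Sum>\<kappa>\<in>cell_block ball_reach \<nu>. b \<kappa> powr s) \<le> 16 * h\<^sup>2 * K * (n * X)"
          using K by (intro mult_left_mono) auto
        then show "16 * h\<^sup>2 * K * (\<Sum>\<nu>\<in>N. \<Sum>\<kappa>\<in>cell_block ball_reach \<nu>. b \<kappa> powr s) \<le> C * X" by (simp add: C_def mult.assoc)
      qed
      finally show "(\<Sum>\<nu>\<in>N. \<integral>\<^sup>+z\<in>cell h \<nu>. epowr (lattice_average \<mu> z) s \<partial>lebesgue) \<le> ennreal (C * X)" .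
    qed simp
    finally show ?thesis .
  qed
  with C that show ?thesis by blast
qed

end

section \<open>Weights\<close>

lemma weight_measurable:
  assumes "weight w"
  shows "w \<in> borel_measurable lebesgue"
proof (rule borel_measurable_LIMSEQ_real)
  fix n
  have "w absolutely_integrable_on cball 0 (real n)" using assms by (simp add: weight_def)
  then have "(\<lambda>z. indicator (cball 0 (real n)) z *\<^sub>R w z) \<in> borel_measurable lebesgue"
    unfolding set_integrable_def by (rule borel_measurable_integrable)
  then show "(\<lambda>z. indicator (cball 0 (real n)) z * w z) \<in> borel_measurable lebesgue" by simp
next
  fix z :: complex
  obtain n0 where n0: "cmod z \<le> real n0" using real_arch_simple by blast
  have "\<forall>\<^sub>F n in sequentially. indicator (cball 0 (real n)) z * w z = w z"
    using eventually_ge_at_top[of n0]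
  proof eventually_elim
    case (elim n)
    then have "cmod z \<le> real n" using n0 by linarith
    then show ?case by (simp add: indicator_def)
  qed
  then show "(\<lambda>n. indicator (cball 0 (real n)) z * w z) \<longlonglongrightarrow> w z" by (rule tendsto_eventually)
qed

definition weight_measure :: "(complex \<Rightarrow> real) \<Rightarrow> complex measure" where
  "weight_measure w = density lebesgue (\<lambda>u. ennreal (w u))"

lemma sets_weight_measure: "sets (weight_measure w) = sets lebesgue"
  by (simp add: weight_measure_def)

lemma emeasure_weight_measure:
  assumes "weight w" "E \<in> sets lebesgue"
  shows "emeasure (weight_measure w) E = wmass w E"
  unfolding weight_measure_def wmass_def using weight_measurable[OF assms(1)] assms(2)
  by (subst emeasure_density) auto

lemma nn_integral_weight_measure:
  assumes "weight w" "f \<in> borel_measurable lebesgue"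
  shows "(\<integral>\<^sup>+u. f u \<partial>weight_measure w) = (\<integral>\<^sup>+u. ennreal (w u) * f u \<partial>lebesgue)"
  unfolding weight_measure_def using weight_measurable[OF assms(1)] assms(2)
  by (subst nn_integral_density) auto

lemma wmass_mono: "E \<subseteq> F \<Longrightarrow> wmass w E \<le> wmass w F"
  unfolding wmass_def by (intro nn_integral_mono) (auto simp: indicator_def)

lemma wmass_finite:
  assumes w: "weight w" and E: "bounded E"
  shows "wmass w E < top"
proof -
  obtain r where "E \<subseteq> ball 0 r" using bounded_subset_ballD[OF E, of 0] by blast
  then have r: "E \<subseteq> cball 0 r" using ball_subset_cball by blast
  have "w absolutely_integrable_on cball 0 r" using w by (simp add: weight_def)
  then have int: "integrable lebesgue (\<lambda>z. indicator (cball 0 r) z * w z)" by (simp add: set_integrable_def)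
  have "wmass w E \<le> wmass w (cball 0 r)" by (rule wmass_mono[OF r])
  also have "\<dots> = (\<integral>\<^sup>+z. ennreal (norm (indicator (cball 0 r) z * w z)) \<partial>lebesgue)"
    unfolding wmass_def using w by (intro nn_integral_cong) (auto simp: indicator_def weight_def)
  also have "\<dots> < top" using int by (simp add: integrable_iff_bounded)
  finally show ?thesis .
qed

lemma AE_pos_integral_pos:
  assumes f: "f \<in> borel_measurable lebesgue" and pos: "AE z in lebesgue. 0 < f z"
    and E: "E \<in> sets lebesgue" and E0: "emeasure lebesgue E > 0"
  shows "(\<integral>\<^sup>+u\<in>E. ennreal (f u) \<partial>lebesgue) > 0"
proof (rule ccontr)
  assume "\<not> ?thesis"
  then have "(\<integral>\<^sup>+u. ennreal (f u) * indicator E u \<partial>lebesgue) = 0" by simp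
  moreover have "(\<lambda>u. ennreal (f u) * indicator E u) \<in> borel_measurable lebesgue"
    using f E by (intro borel_measurable_times_ennreal borel_measurable_indicator measurable_compose[OF f]) auto
  ultimately have "AE u in lebesgue. ennreal (f u) * indicator E u = 0"
    by (simp add: nn_integral_0_iff_AE)
  with pos have "AE u in lebesgue. u \<notin> E"
    by eventually_elim (auto simp: indicator_def split: if_splits)
  then have "emeasure lebesgue E = 0" using E by (simp add: AE_iff_measurable[OF E])
  then show False using E0 by simp
qed

lemma square_eq_cbox:
  "square t z = cbox (z - Complex (t / 2) (t / 2)) (z + Complex (t / 2) (t / 2))"
proof -
  have "\<bar>a - b\<bar> \<le> t / 2 \<longleftrightarrow> b - t / 2 \<le> a \<and> a \<le> b + t / 2" for a b :: real
    by arith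
  then show ?thesis unfolding square_def by (simp add: in_cbox_complex_iff set_eq_iff)
qed

lemma square_sets [simp]: "square t z \<in> sets lebesgue"
  by (simp add: square_eq_cbox)

lemma bounded_square: "bounded (square t z)"
  by (simp add: square_eq_cbox)

lemma area_square: "t > 0 \<Longrightarrow> area (square t z) = ennreal (t * t)"
  unfolding area_def square_eq_cbox
  by (simp add: emeasure_lborel_cbox_eq Basis_complex_def inner_complex_def)

section \<open>Restricted Muckenhoupt classes and the mass of subsets\<close>

text \<open>A lower bound of A-infinity type on squares of one fixed side; the area of the square is
  constant and absorbed in c. \<open>enn2real\<close> loses nothing here, since a weight has finite
  mass on a square.\<close>

definition A_infty_ineq :: "(complex \<Rightarrow> real) \<Rightarrow> real \<Rightarrow> real \<Rightarrow> real \<Rightarrow> bool" where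
  "A_infty_ineq w t c q \<longleftrightarrow> (\<forall>z E. E \<in> sets lebesgue \<longrightarrow> E \<subseteq> square t z \<longrightarrow>
     ennreal (c * measure lebesgue E powr q * enn2real (wmass w (square t z))) \<le> wmass w E)"

text \<open>The essential infimum over Q is at most the mean of w over E, so the defining condition
  yields w(Q) <= S |Q| w(E) / |E|, which is the inequality with exponent 1.\<close>

lemma A_restricted_1_ineq:
  assumes w: "w \<in> A_restricted_1"
  shows "weight w \<and> (AE z in lebesgue. 0 < w z) \<and> (\<exists>t>0. \<exists>c>0. A_infty_ineq w t c 1)"
proof -
  from w have wt: "weight w" and pos: "AE z in lebesgue. 0 < w z" by (auto simp: A_restricted_1_def)
  from w obtain t where t: "t > 0" and sup: "(SUP z. wmass w (square t z) /
        (area (square t z) * ess_inf_on (square t z) w)) < top" by (auto simp: A_restricted_1_def)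
  \<comment> \<open>The summand 1 makes S positive, so that it can be divided by, without a lower
    bound for the supremum.\<close>
  define S where "S = enn2real (SUP z. wmass w (square t z) / (area (square t z) * ess_inf_on (square t z) w)) + 1"
  have S: "S > 0" by (simp add: S_def add_nonneg_pos)
  have Sb: "wmass w (square t z) / (area (square t z) * ess_inf_on (square t z) w) \<le> ennreal S" for z
  proof -
    have "wmass w (square t z) / (area (square t z) * ess_inf_on (square t z) w)
       \<le> (SUP z. wmass w (square t z) / (area (square t z) * ess_inf_on (square t z) w))" by (intro SUP_upper) auto
    also have "\<dots> = ennreal (S - 1)" using sup by (simp add: S_def)
    also have "\<dots> \<le> ennreal S" by (intro ennreal_leI) simp
    finally show ?thesis .
  qed
  define c where "c = 1 / (S * (t * t))"
  have c: "c > 0" using S t by (simp add: c_def)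
  have "ennreal (c * measure lebesgue E powr 1 * enn2real (wmass w (square t z))) \<le> wmass w E"
    if E: "E \<in> sets lebesgue" and sub: "E \<subseteq> square t z" for z E
  proof -
    define Q where "Q = square t z"
    have wQ: "wmass w Q < top" unfolding Q_def by (intro wmass_finite wt bounded_square)
    have wE: "wmass w E < top" using bounded_subset[OF bounded_square sub] by (intro wmass_finite wt)
    define e where "e = measure lebesgue E"
    have Ef: "emeasure lebesgue E < top"
    proof -
      have "emeasure lebesgue E \<le> emeasure lebesgue Q" using sub by (intro emeasure_mono) (auto simp: Q_def)
      also have "\<dots> < top" using area_square[OF t, of z] by (simp add: area_def Q_def)
      finally show ?thesis .
    qed
    show ?thesis
    proof (cases "e = 0")
      case False
      then have e: "e > 0" unfolding e_def by (simp add: less_le)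
      have Ee: "emeasure lebesgue E = ennreal e" using Ef by (simp add: e_def emeasure_eq_ennreal_measure)
      define x where "x = enn2real (wmass w E) / e"
      have x0: "x \<ge> 0" using e by (simp add: x_def)
      have "ess_inf_on Q w \<le> ennreal x"
        unfolding ess_inf_on_def
      proof (rule Sup_least)
        fix m assume "m \<in> {m. AE u in lebesgue. u \<in> Q \<longrightarrow> m \<le> ennreal (w u)}"
        then have m: "AE u in lebesgue. u \<in> Q \<longrightarrow> m \<le> ennreal (w u)" by simp
        have "m * ennreal e = (\<integral>\<^sup>+u. m * indicator E u \<partial>lebesgue)"
          using E Ee by (subst nn_integral_cmult_indicator) auto
        also have "\<dots> \<le> wmass w E"
          unfolding wmass_def using m sub by (intro nn_integral_mono_AE) (auto simp: Q_def indicator_def)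
        also have "wmass w E = ennreal (x * e)" using wE e by (simp add: x_def)
        finally have me: "m * ennreal e \<le> ennreal x * ennreal e" using x0 e by (simp add: ennreal_mult)
        show "m \<le> ennreal x"
        proof (cases m)
          case (real r)
          then have "r * e \<le> x * e" using me e x0 by (simp add: ennreal_mult[symmetric] ennreal_le_iff)
          then show ?thesis using e real by (simp add: ennreal_leI)
        next
          case top
          then show ?thesis using me e by (simp add: ennreal_top_mult ennreal_mult[symmetric] x0 top_unique)
        qed
      qed
      then have "wmass w Q / (ennreal (t * t) * ennreal x) \<le> wmass w Q / (area Q * ess_inf_on Q w)"
        unfolding divide_ennreal_def area_square[OF t] Q_def
        by (intro mult_left_mono ennreal_inverse_antimono) auto
      also have "\<dots> \<le> ennreal S" using Sb[of z] by (simp add: Q_def)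
      finally have b: "wmass w Q / ennreal (t * t * x) \<le> ennreal S" using t x0 by (simp add: ennreal_mult)
      have Qpos: "wmass w Q > 0"
        unfolding wmass_def using weight_measurable[OF wt] pos area_square[OF t, of z] t
        by (intro AE_pos_integral_pos) (auto simp: Q_def area_def)
      define v where "v = enn2real (wmass w Q)"
      have v: "wmass w Q = ennreal v" "v > 0" using wQ Qpos by (auto simp: v_def enn2real_positive_iff)
      \<comment> \<open>A set E of zero weighted mass would make the bounded quotient infinite,
        because w(Q) is positive.\<close>
      have "x > 0"
      proof (rule ccontr)
        assume "\<not> x > 0"
        then have "x = 0" using x0 by simp
        then have "wmass w Q / ennreal (t * t * x) = top" using v by (simp add: ennreal_divide_zero)
        then show False using b by (simp add: top_unique)
      qed
      then have "v / (t * t * x) \<le> S" using b v t S by (simp add: divide_ennreal ennreal_le_iff)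
      then have "v \<le> S * (t * t * x)" using \<open>x > 0\<close> t by (simp add: divide_le_eq)
      then have "c * e * v \<le> c * e * (S * (t * t * x))" using c e by (intro mult_left_mono) auto
      also have "\<dots> = e * x" unfolding c_def using S t by simp
      also have "\<dots> = enn2real (wmass w E)" using e by (simp add: x_def)
      finally have "ennreal (c * e * v) \<le> ennreal (enn2real (wmass w E))" by (rule ennreal_leI)
      then show ?thesis using wE e by (simp add: v_def e_def Q_def)
    qed (simp add: e_def)
  qed
  then show ?thesis using wt pos t c unfolding A_infty_ineq_def by blast
qed

text \<open>With the dual weight v = w^(-1/(p - 1)), Hoelder's inequality on E would give |E|^p <=
  w(E) v(Q)^(p - 1), and the defining condition bounds v(Q)^(p - 1) by a multiple of 1 / w(Q). The
  argument below yields this up to a factor 2^p.\<close>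

lemma A_restricted_gt1_ineq:
  assumes p: "p > 1" and w: "w \<in> A_restricted_gt1 p"
  shows "weight w \<and> (AE z in lebesgue. 0 < w z) \<and> (\<exists>t>0. \<exists>c>0. A_infty_ineq w t c p)"
proof -
  define k where "k = p - 1"
  have k: "k > 0" "conj_exp p / p = 1 / k" "p / conj_exp p = k" using p by (auto simp: k_def conj_exp_def)
  define v where "v u = w u powr (- (1 / k))" for u
  from w have wt: "weight w" and pos: "AE z in lebesgue. 0 < w z" by (auto simp: A_restricted_gt1_def)
  from w obtain t where t: "t > 0" and sup: "(SUP z. (1 / area (square t z) * wmass w (square t z)) *
        epowr (1 / area (square t z) * wmass v (square t z)) k) < top"
    unfolding A_restricted_gt1_def k v_def by blast
  define S where "S = enn2real (SUP z. (1 / area (square t z) * wmass w (square t z)) *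
        epowr (1 / area (square t z) * wmass v (square t z)) k) + 1"
  have S: "S > 0" by (simp add: S_def add_nonneg_pos)
  have Sb: "(1 / area (square t z) * wmass w (square t z)) * epowr (1 / area (square t z) * wmass v (square t z)) k \<le> ennreal S" for z
  proof -
    have "(1 / area (square t z) * wmass w (square t z)) * epowr (1 / area (square t z) * wmass v (square t z)) k
       \<le> (SUP z. (1 / area (square t z) * wmass w (square t z)) * epowr (1 / area (square t z) * wmass v (square t z)) k)" by (intro SUP_upper) auto
    also have "\<dots> = ennreal (S - 1)" using sup by (simp add: S_def)
    also have "\<dots> \<le> ennreal S" by (intro ennreal_leI) simp
    finally show ?thesis .
  qed
  have wm: "w \<in> borel_measurable lebesgue" by (rule weight_measurable[OF wt])
  have vm: "v \<in> borel_measurable lebesgue" unfolding v_def using wm by measurable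
  have vpos: "AE z in lebesgue. 0 < v z" using pos by eventually_elim (simp add: v_def)
  \<comment> \<open>S bounds the averaged product, (t * t)^p undoes the two normalisations by area,
    of total exponent 1 + k = p, and 2^p is the loss in the pointwise inequality.\<close>
  define c where "c = 1 / (2 powr p * S * (t * t) powr p)"
  have c: "c > 0" using S t by (simp add: c_def)
  have "ennreal (c * measure lebesgue E powr p * enn2real (wmass w (square t z))) \<le> wmass w E"
    if E: "E \<in> sets lebesgue" and sub: "E \<subseteq> square t z" for z E
  proof -
    define Q where "Q = square t z"
    have aQ: "area Q = ennreal (t * t)" "emeasure lebesgue Q > 0" "Q \<in> sets lebesgue"
      using area_square[OF t, of z] t by (auto simp: Q_def area_def)
    have wQ: "wmass w Q < top" unfolding Q_def by (intro wmass_finite wt bounded_square)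
    have wE: "wmass w E < top" using bounded_subset[OF bounded_square sub] by (intro wmass_finite wt)
    define e where "e = measure lebesgue E"
    have Ef: "emeasure lebesgue E < top"
    proof -
      have "emeasure lebesgue E \<le> emeasure lebesgue Q" using sub by (intro emeasure_mono) (auto simp: Q_def)
      also have "\<dots> < top" using aQ by (simp add: area_def)
      finally show ?thesis .
    qed
    have Qpos: "wmass w Q > 0" "wmass v Q > 0"
      unfolding wmass_def using wm vm pos vpos aQ by (auto intro!: AE_pos_integral_pos)
    define W where "W = enn2real (wmass w Q)"
    have W: "wmass w Q = ennreal W" "W > 0" using wQ Qpos by (auto simp: W_def enn2real_positive_iff)
    have tt: "t * t > 0" "t \<noteq> 0" using t by simp_all
    have inva: "1 / area Q = ennreal (1 / (t * t))"
      using tt by (simp add: aQ divide_ennreal_def inverse_ennreal divide_inverse)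
    have b: "(ennreal (1 / (t * t)) * ennreal W) * epowr (ennreal (1 / (t * t)) * wmass v Q) k \<le> ennreal S"
      using Sb[of z] unfolding Q_def[symmetric] inva W .
    \<comment> \<open>As w(Q) is positive, infinite v(Q) would make the bounded product
      infinite.\<close>
    have vQ: "wmass v Q < top"
    proof (rule ccontr)
      assume "\<not> wmass v Q < top"
      then have "wmass v Q = top" using less_top by blast
      then have "epowr (ennreal (1 / (t * t)) * wmass v Q) k = top"
        using t by (simp add: epowr_def ennreal_mult_top)
      then show False using b t W by (simp add: ennreal_mult_top ennreal_mult[symmetric] top_unique)
    qed
    define s where "s = enn2real (wmass v Q)"
    have s: "wmass v Q = ennreal s" "s > 0" using vQ Qpos by (auto simp: s_def enn2real_positive_iff)
    have "epowr (ennreal (1 / (t * t)) * wmass v Q) k = ennreal ((s / (t * t)) powr k)"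
      unfolding s(1) using s(2) tt by (simp add: ennreal_mult[symmetric] epowr_def)
    then have "(ennreal (1 / (t * t)) * ennreal W) * ennreal ((s / (t * t)) powr k) \<le> ennreal S" using b by simp
    then have "W / (t * t) * (s / (t * t)) powr k \<le> S"
      using W tt S by (simp add: ennreal_mult[symmetric] ennreal_le_iff)
    then have b2: "W * s powr k \<le> S * (t * t) powr p"
    proof -
      have "(t * t) powr p = (t * t) * (t * t) powr k"
        using tt powr_add[of "t * t" 1 k] by (simp add: k_def)
      moreover have "W / (t * t) * (s / (t * t)) powr k = W * s powr k / ((t * t) * (t * t) powr k)"
        using s tt by (simp add: powr_divide)
      ultimately have "W * s powr k / (t * t) powr p \<le> S" using \<open>W / (t * t) * (s / (t * t)) powr k \<le> S\<close> by simp
      moreover have "(t * t) powr p > 0" using tt by simp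
      ultimately show ?thesis by (simp add: pos_divide_le_eq)
    qed
    show ?thesis
    proof (cases "e = 0")
      case False
      then have e: "e > 0" unfolding e_def by (simp add: less_le)
      have Ee: "emeasure lebesgue E = ennreal e" using Ef by (simp add: e_def emeasure_eq_ennreal_measure)
      define x where "x = enn2real (wmass w E)"
      have x: "wmass w E = ennreal x" "x \<ge> 0" using wE by (auto simp: x_def)
      define l where "l = (2 * s / e) powr k"
      have l: "l > 0" unfolding l_def using s e by simp
      have lk: "l powr (- (1 / k)) = e / (2 * s)"
        unfolding l_def powr_powr using k s e by (simp add: powr_minus)
      \<comment> \<open>replaces Hoelder; \<open>l\<close> is such that the second term integrates to \<open>e / 2\<close>\<close>
      have pt: "1 \<le> l * w u + e / (2 * s) * v u" if "w u > 0" for u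
      proof (cases "l * w u \<ge> 1")
        case True
        moreover have "0 \<le> e / (2 * s) * v u" using e s by (simp add: v_def)
        ultimately show ?thesis by linarith
      next
        case False
        then have lw: "0 < l * w u" "l * w u \<le> 1" using l that by auto
        have "1 \<le> (l * w u) powr (- (1 / k))"
        proof -
          have "(l * w u) powr (1 / k) \<le> 1 powr (1 / k)" using lw k by (intro powr_mono2) auto
          moreover have "(l * w u) powr (1 / k) > 0" using l that by simp
          ultimately show ?thesis by (simp add: powr_minus one_le_inverse)
        qed
        also have "\<dots> = e / (2 * s) * v u" using l that by (simp add: powr_mult lk v_def)
        finally show ?thesis using lw by linarith
      qed
      have "ennreal e = (\<integral>\<^sup>+u. indicator E u \<partial>lebesgue)" using E Ee by simp
      also have "\<dots> \<le> (\<integral>\<^sup>+u. ennreal l * (ennreal (w u) * indicator E u) + ennreal (e / (2 * s)) * (ennreal (v u) * indicator Q u) \<partial>lebesgue)"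
      proof (rule nn_integral_mono_AE)
        show "AE u in lebesgue. (indicator E u :: ennreal) \<le> ennreal l * (ennreal (w u) * indicator E u) + ennreal (e / (2 * s)) * (ennreal (v u) * indicator Q u)"
          using pos
        proof eventually_elim
          case (elim u)
          show ?case
          proof (cases "u \<in> E")
            case True
            then have "u \<in> Q" using sub by (auto simp: Q_def)
            have "ennreal 1 \<le> ennreal (l * w u + e / (2 * s) * v u)" using pt[OF elim] by (rule ennreal_leI)
            also have "\<dots> = ennreal l * ennreal (w u) + ennreal (e / (2 * s)) * ennreal (v u)"
              using l e s elim by (simp add: ennreal_mult[symmetric] ennreal_plus[symmetric] v_def del: ennreal_plus)
            finally show ?thesis using True \<open>u \<in> Q\<close> by simp
          qed simp
        qed
      qed
      also have "\<dots> = ennreal l * wmass w E + ennreal (e / (2 * s)) * wmass v Q"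
      proof -
        have m1: "(\<lambda>u. ennreal (w u) * indicator E u) \<in> borel_measurable lebesgue"
          using wm E by (intro borel_measurable_times_ennreal borel_measurable_indicator measurable_compose[OF wm]) auto
        have m2: "(\<lambda>u. ennreal (v u) * indicator Q u) \<in> borel_measurable lebesgue"
          using vm aQ by (intro borel_measurable_times_ennreal borel_measurable_indicator measurable_compose[OF vm]) auto
        show ?thesis unfolding wmass_def using m1 m2 by (simp add: nn_integral_add nn_integral_cmult)
      qed
      also have "\<dots> = ennreal (l * x + e / (2 * s) * s)"
        unfolding x(1) s(1) using l x e s by (simp add: ennreal_mult[symmetric] ennreal_plus[symmetric] del: ennreal_plus)
      finally have "e \<le> l * x + e / (2 * s) * s"
        using l x e s by (subst (asm) ennreal_le_iff) auto
      then have "e \<le> l * x + e / 2" using s by simp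
      then have "e / (2 * l) \<le> x" using l by (simp add: field_simps)
      moreover have "c * e powr p * W \<le> e / (2 * l)"
      proof -
        have "2 * l = 2 powr p * s powr k / e powr k"
        proof -
          have "2 powr p = 2 * 2 powr k" using powr_add[of 2 1 k] by (simp add: k_def)
          then show ?thesis unfolding l_def using s e by (simp add: powr_divide powr_mult)
        qed
        then have "e / (2 * l) = e * e powr k / (2 powr p * s powr k)" by simp
        also have "e * e powr k = e powr p" using e powr_add[of e 1 k] by (simp add: k_def)
        finally have eq: "e / (2 * l) = e powr p / (2 powr p * s powr k)" .
        have "c * W \<le> 1 / (2 powr p * s powr k)"
        proof -
          have gen: "W / A \<le> 1 / B" if "W * B \<le> A" "A > 0" "B > 0" for A B :: real
            using that by (simp add: field_simps)
          have "W * (2 powr p * s powr k) \<le> 2 powr p * S * (t * t) powr p"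
            using mult_left_mono[OF b2, of "2 powr p"] by (simp only: mult_ac powr_ge_zero)
          then have "W / (2 powr p * S * (t * t) powr p) \<le> 1 / (2 powr p * s powr k)"
            using S t s by (intro gen) auto
          then show ?thesis by (simp add: c_def)
        qed
        then have "e powr p * (c * W) \<le> e powr p * (1 / (2 powr p * s powr k))" by (intro mult_left_mono) auto
        then show ?thesis unfolding eq by (simp add: mult_ac)
      qed
      ultimately have "c * e powr p * W \<le> x" by linarith
      then have "ennreal (c * e powr p * W) \<le> ennreal x" by (rule ennreal_leI)
      then show ?thesis by (simp add: x(1) e_def W_def Q_def)
    qed (simp add: e_def)
  qed
  then show ?thesis using wt pos t c unfolding A_infty_ineq_def by blast
qed

section \<open>Two-sided estimates on a lattice\<close>

lemma diag_dom_mono: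
  assumes "diag_dom p r N a B" "0 \<le> B" "B \<le> B'" "r > 0"
  shows "diag_dom p r N a B'"
proof -
  have "B powr r \<le> B' powr r" using assms by (intro powr_mono2) auto
  then show ?thesis using assms(1) unfolding diag_dom_def by (meson order_trans)
qed

lemma gauss_mod_scale: "gauss_mod \<alpha> (\<lambda>t. of_real c * f t) u = \<bar>c\<bar> * gauss_mod \<alpha> f u"
  by (simp add: gauss_mod_def norm_mult)

lemma fock_mass_scale:
  assumes f: "f holomorphic_on UNIV" and m: "sets borel \<subseteq> sets m"
  shows "fock_mass \<alpha> p m (\<lambda>t. of_real c * f t) = ennreal (\<bar>c\<bar> powr p) * fock_mass \<alpha> p m f"
proof -
  have "gauss_mod \<alpha> f \<in> borel_measurable borel"
    by (intro borel_measurable_continuous_onI continuous_on_gauss_mod f)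
  then have "(\<lambda>u. ennreal (gauss_mod \<alpha> f u powr p)) \<in> borel_measurable borel" by measurable
  then have "(\<lambda>u. ennreal (gauss_mod \<alpha> f u powr p)) \<in> borel_measurable m" using m by (rule borel_measurable_finer)
  then show ?thesis by (simp add: fock_mass_def gauss_mod_scale powr_mult ennreal_mult nn_integral_cmult)
qed

lemma fock_set_scale:
  assumes "f \<in> fock_set \<alpha> p m" "sets borel \<subseteq> sets m"
  shows "(\<lambda>t. of_real c * f t) \<in> fock_set \<alpha> p m"
  using assms fock_mass_scale[of f m \<alpha> p c]
  by (auto simp: fock_set_def ennreal_mult_less_top intro!: holomorphic_intros)

lemma fock_norm_scale:
  assumes "f holomorphic_on UNIV" "sets borel \<subseteq> sets m" "c \<ge> 0" "p > 0"
  shows "fock_norm \<alpha> p m (\<lambda>t. of_real c * f t) = c * fock_norm \<alpha> p m f"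
  using assms by (simp add: fock_norm_def fock_mass_scale enn2real_mult powr_mult powr_powr)

context fock_lattice
begin

lemma lattice_summing_mono:
  assumes "lattice_summing r \<mu> K" "0 < r" "r \<le> s" and mu: "sets \<mu> = sets borel"
  shows "lattice_summing s \<mu> K"
  using p mu sets_wm
  by (intro summing_const_mono_exponent[OF assms(1-3)] fock_norm_nonneg fock_set_scale fock_norm_scale) (auto simp: fock_set_def)

text \<open>The exponent r is sandwiched: domination of the diagonal operator gives sufficiency at
  r0 <= r, testing gives necessity at r1 >= r. Both involve the same power t, so after transport to
  r by monotonicity they match.\<close>

lemma summing_equivalence:
  assumes r0: "1 \<le> r0" "r0 \<le> p" "r0 \<le> r" and r1: "r \<le> r1" and t: "t > 0" and k: "k > 0"
    and U: "\<And>(N :: (int \<times> int) set) a. finite N \<Longrightarrow> (\<And>\<nu>. \<nu> \<in> N \<Longrightarrow> 0 \<le> a \<nu>) \<Longrightarrow>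
      diag_dom p r0 N a ((\<Sum>\<nu>\<in>N. a \<nu> powr t) powr (1 / t) / k)"
    and L: "\<exists>C>0. lower_bound r1 t C"
  shows "\<exists>c>0. \<forall>\<mu>. sets \<mu> = sets borel \<longrightarrow>
     ((\<forall>f\<in>fock_set \<alpha> p wm. fock_mass \<alpha> p \<mu> f < top) \<and> (\<exists>K. lattice_summing r \<mu> K) \<longleftrightarrow> integral_powr (t / p) (lattice_average \<mu>) < top) \<and>
     (integral_powr (t / p) (lattice_average \<mu>) < top \<longrightarrow>
       comparable c (summing_norm r (fock_set \<alpha> p wm) (fock_norm \<alpha> p wm) (fock_norm \<alpha> p \<mu>) (\<lambda>f. f))
         (enn2real (integral_powr (t / p) (lattice_average \<mu>)) powr (1 / t)))"
proof -
  have tp: "t / p > 0" using t p by simp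
  obtain C1 where C1: "C1 > 0" and L': "\<And>\<mu> K N. sets \<mu> = sets borel \<Longrightarrow> (\<forall>f\<in>fock_set \<alpha> p wm. fock_mass \<alpha> p \<mu> f < top) \<Longrightarrow>
      lattice_summing r1 \<mu> K \<Longrightarrow> finite N \<Longrightarrow> (\<Sum>\<nu>\<in>N. (cell_mass \<mu> \<nu> / W \<nu>) powr (t / p)) \<le> C1 * K powr t"
    using L unfolding lower_bound_def by blast
  obtain C2 where C2: "C2 > 0" and avg_up: "\<And>\<mu> X. sets \<mu> = sets borel \<Longrightarrow> (\<And>\<nu>. emeasure \<mu> (cell h \<nu>) < top) \<Longrightarrow>
      (\<And>N. finite N \<Longrightarrow> (\<Sum>\<nu>\<in>N. (cell_mass \<mu> \<nu> / W \<nu>) powr (t / p)) \<le> X) \<Longrightarrow> integral_powr (t / p) (lattice_average \<mu>) \<le> ennreal (C2 * X)"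
    using lattice_average_upper[OF tp] by blast
  obtain C3 where C3: "C3 > 0" and su: "\<And>\<mu> m B. sets \<mu> = sets borel \<Longrightarrow> (\<And>\<nu>. emeasure \<mu> (cell h \<nu>) = ennreal (m \<nu>)) \<Longrightarrow> (\<And>\<nu>. 0 \<le> m \<nu>) \<Longrightarrow> B \<ge> 0 \<Longrightarrow>
      (\<And>N. finite N \<Longrightarrow> diag_dom p r0 N (\<lambda>\<nu>. (m \<nu> / W \<nu>) powr (1/p)) B) \<Longrightarrow>
      (\<forall>f\<in>fock_set \<alpha> p wm. fock_mass \<alpha> p \<mu> f < top) \<and> lattice_summing r0 \<mu> (C3 * B)"
    using summing_upper[OF r0(1,2)] by blast
  define J where "J \<mu> = enn2real (integral_powr (t / p) (lattice_average \<mu>)) powr (1 / t)" for \<mu>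
  define c1 where "c1 = (C2 * C1) powr (1 / t)"
  have c1: "c1 > 0" unfolding c1_def using C1 C2 by simp
  define D where "D = ball_const powr (t / p) * 4 / h\<^sup>2"
  have D: "D > 0" unfolding D_def using ball_const_pos h by simp
  define c2 where "c2 = C3 * (D powr (1 / t) / k)"
  have c2: "c2 > 0" unfolding c2_def using C3 D k by simp
  \<comment> \<open>Necessity: a summing constant for r is one for r1, where the testing bound is
    available.\<close>
  have fwd: "integral_powr (t / p) (lattice_average \<mu>) < top \<and> J \<mu> \<le> c1 * K"
    if mu: "sets \<mu> = sets borel" and fin: "\<forall>f\<in>fock_set \<alpha> p wm. fock_mass \<alpha> p \<mu> f < top" and K: "lattice_summing r \<mu> K" for \<mu> K
  proof -
    have K0: "K \<ge> 0" using K by (simp add: summing_const_def)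
    have "lattice_summing r1 \<mu> K" using K r0 r1 mu by (intro lattice_summing_mono[OF K]) auto
    then have "integral_powr (t / p) (lattice_average \<mu>) \<le> ennreal (C2 * (C1 * K powr t))"
      using fin by (intro avg_up[OF mu] emeasure_cell_finite[OF mu] L'[OF mu fin]) auto
    also have "\<dots> = ennreal ((c1 * K) powr t)"
      using C1 C2 K0 t by (simp add: c1_def powr_mult powr_powr)
    finally have le: "integral_powr (t / p) (lattice_average \<mu>) \<le> ennreal ((c1 * K) powr t)" .
    then have "enn2real (integral_powr (t / p) (lattice_average \<mu>)) \<le> (c1 * K) powr t" by (simp add: enn2real_leI)
    then have "J \<mu> \<le> ((c1 * K) powr t) powr (1 / t)" unfolding J_def using t by (intro powr_mono2) auto
    then show ?thesis using le t c1 K0 by (simp add: powr_powr le_less_trans)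
  qed
  \<comment> \<open>Sufficiency: a finite integral first makes all cell masses finite, so that they
    can enter as real numbers; the constant obtained at r0 then serves for r.\<close>
  have bwd: "(\<forall>f\<in>fock_set \<alpha> p wm. fock_mass \<alpha> p \<mu> f < top) \<and> lattice_summing r \<mu> (c2 * J \<mu>)"
    if mu: "sets \<mu> = sets borel" and fin: "integral_powr (t / p) (lattice_average \<mu>) < top" for \<mu>
  proof -
    have cfin: "emeasure \<mu> (cell h \<nu>) = ennreal (cell_mass \<mu> \<nu>)" for \<nu>
      using lattice_average_lower(1)[OF mu tp fin, of \<nu>] by (simp add: cell_mass_def)
    have cm0: "0 \<le> cell_mass \<mu> \<nu>" for \<nu> by (simp add: cell_mass_def)
    have J0: "J \<mu> \<ge> 0" by (simp add: J_def)
    have "(\<forall>f\<in>fock_set \<alpha> p wm. fock_mass \<alpha> p \<mu> f < top) \<and> lattice_summing r0 \<mu> (C3 * (D powr (1 / t) / k * J \<mu>))"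
    proof (rule su[OF mu cfin cm0])
      show "0 \<le> D powr (1 / t) / k * J \<mu>" using J0 k by simp
      fix N :: "(int \<times> int) set" assume N: "finite N"
      define a where "a \<nu> = (cell_mass \<mu> \<nu> / W \<nu>) powr (1 / p)" for \<nu>
      have "(\<Sum>\<nu>\<in>N. a \<nu> powr t) = (\<Sum>\<nu>\<in>N. (cell_mass \<mu> \<nu> / W \<nu>) powr (t / p))"
        by (simp add: a_def powr_powr)
      also have "\<dots> \<le> D * enn2real (integral_powr (t / p) (lattice_average \<mu>))"
        unfolding D_def by (rule lattice_average_lower(2)[OF mu tp fin N])
      finally have "(\<Sum>\<nu>\<in>N. a \<nu> powr t) powr (1 / t) \<le> (D * enn2real (integral_powr (t / p) (lattice_average \<mu>))) powr (1 / t)"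
        using t by (intro powr_mono2) (auto intro: sum_nonneg)
      also have "\<dots> = D powr (1 / t) * J \<mu>" using D by (simp add: J_def powr_mult)
      finally have "(\<Sum>\<nu>\<in>N. a \<nu> powr t) powr (1 / t) / k \<le> D powr (1 / t) / k * J \<mu>"
        using k by (simp add: divide_right_mono)
      then show "diag_dom p r0 N (\<lambda>\<nu>. (cell_mass \<mu> \<nu> / W \<nu>) powr (1 / p)) (D powr (1 / t) / k * J \<mu>)"
        using r0 k unfolding a_def by (intro diag_dom_mono[OF U[OF N]]) auto
    qed
    moreover have "C3 * (D powr (1 / t) / k * J \<mu>) = c2 * J \<mu>" by (simp add: c2_def)
    ultimately show ?thesis using r0 lattice_summing_mono[OF _ _ r0(3) mu, of "c2 * J \<mu>"] by auto
  qed
  define c where "c = max c1 c2"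
  have c: "c > 0" "c1 \<le> c" "c2 \<le> c" using c1 by (auto simp: c_def)
  have comp: "comparable c (summing_norm r (fock_set \<alpha> p wm) (fock_norm \<alpha> p wm) (fock_norm \<alpha> p \<mu>) (\<lambda>f. f)) (J \<mu>)"
    if mu: "sets \<mu> = sets borel" and fin: "integral_powr (t / p) (lattice_average \<mu>) < top" for \<mu>
  proof -
    define P where "P = summing_norm r (fock_set \<alpha> p wm) (fock_norm \<alpha> p wm) (fock_norm \<alpha> p \<mu>) (\<lambda>f. f)"
    note b = bwd[OF mu fin]
    have J0: "J \<mu> \<ge> 0" by (simp add: J_def)
    have "P \<le> c2 * J \<mu>" unfolding P_def using b by (intro summing_norm_le) blast
    also have "\<dots> \<le> c * J \<mu>" using c J0 by (intro mult_right_mono) auto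
    finally have "inverse c * P \<le> J \<mu>" using c by (simp add: field_simps)
    moreover have "J \<mu> / c1 \<le> P"
      unfolding P_def
    proof (rule le_summing_norm)
      show "lattice_summing r \<mu> (c2 * J \<mu>)" using b by blast
      fix K assume "lattice_summing r \<mu> K"
      with fwd[OF mu _ this] b have "J \<mu> \<le> c1 * K" by blast
      then show "J \<mu> / c1 \<le> K" using c1 by (simp add: divide_le_eq mult.commute)
    qed
    then have "J \<mu> \<le> c1 * P" using c1 by (simp add: divide_le_eq mult.commute)
    moreover have "c1 * P \<le> c * P"
    proof -
      have "P \<ge> 0" using \<open>J \<mu> / c1 \<le> P\<close> J0 c1 by (meson divide_nonneg_pos order_trans)
      then show ?thesis using c by (intro mult_right_mono) auto
    qed
    ultimately show ?thesis unfolding comparable_def P_def by linarith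
  qed
  show ?thesis
  proof (intro exI[of _ c] conjI allI impI c)
    fix \<mu> :: "complex measure" assume mu: "sets \<mu> = sets borel"
    show "(\<forall>f\<in>fock_set \<alpha> p wm. fock_mass \<alpha> p \<mu> f < top) \<and> (\<exists>K. lattice_summing r \<mu> K) \<longleftrightarrow> integral_powr (t / p) (lattice_average \<mu>) < top"
      using fwd[OF mu] bwd[OF mu] by blast
    assume "integral_powr (t / p) (lattice_average \<mu>) < top"
    from comp[OF mu this] show "comparable c (summing_norm r (fock_set \<alpha> p wm) (fock_norm \<alpha> p wm) (fock_norm \<alpha> p \<mu>) (\<lambda>f. f))
         (enn2real (integral_powr (t / p) (lattice_average \<mu>)) powr (1 / t))" by (simp add: J_def)
  qed
qed

end

text \<open>The comparison of neighbouring cells and the bound for small discs are both instances of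
  w(E) >= c |E|^q w(Q), with Q the square of side t about a cell centre and E a disc in Q.\<close>

lemma weight_lattice:
  assumes \<alpha>: "\<alpha> > 0" and p: "p > 1" and w: "weight w" and pos: "AE z in lebesgue. 0 < w z"
    and t: "t > 0" and c: "c > 0" and q: "q > 0" and ineq: "A_infty_ineq w t c q"
  shows "\<exists>h M c0 \<theta> W. fock_lattice \<alpha> p h M c0 \<theta> (weight_measure w) W"
proof -
  \<comment> \<open>4 h <= t makes the square of side t about a cell centre contain the neighbouring
    cells and every disc of radius h about a point of the cell.\<close>
  define h where "h = min t 1 / 4"
  have h: "h > 0" "h \<le> 1/4" "4 * h \<le> t" using t by (auto simp: h_def)
  define W where "W \<nu> = enn2real (wmass w (cell h \<nu>))" for \<nu>
  have area: "measure lebesgue (ball u \<rho>) = pi * \<rho>\<^sup>2" if "\<rho> \<ge> 0" for u :: complex and \<rho>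
    using that by (simp add: content_ball unit_ball_vol_2)
  have near: "v \<in> square t (cell_center h \<nu>)" if "cmod (v - cell_center h \<nu>) \<le> 2 * h" for v \<nu>
    using that h abs_Re_le_cmod[of "v - cell_center h \<nu>"] abs_Im_le_cmod[of "v - cell_center h \<nu>"]
    unfolding square_def by auto
  have cellsub: "cell h \<nu> \<subseteq> square t (cell_center h \<nu>)" for \<nu>
    using cell_center_dist_upper[OF h(1), of _ \<nu>] h by (intro subsetI near) fastforce
  have adjsub: "cell h \<kappa> \<subseteq> square t (cell_center h \<nu>)" if \<kappa>: "\<kappa> \<in> cell_block 1 \<nu>" for \<kappa> \<nu>
  proof
    fix u assume u: "u \<in> cell h \<kappa>"
    have *: "\<bar>x - h * (of_int k + 1/2)\<bar> \<le> t / 2" if "\<bar>\<lfloor>x / h\<rfloor> - k\<bar> \<le> 1" for x :: real and k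
    proof -
      have "\<bar>x / h - (of_int k + 1/2)\<bar> \<le> 2" using that by linarith
      then have "h * \<bar>x / h - (of_int k + 1/2)\<bar> \<le> h * 2" using h by (intro mult_left_mono) auto
      also have "h * \<bar>x / h - (of_int k + 1/2)\<bar> = \<bar>h * (x / h - (of_int k + 1/2))\<bar>"
        using h by (simp add: abs_mult)
      also have "h * (x / h - (of_int k + 1/2)) = x - h * (of_int k + 1/2)"
        using h by (simp add: right_diff_distrib)
      finally show ?thesis using h by simp
    qed
    have "\<kappa> = (\<lfloor>Re u / h\<rfloor>, \<lfloor>Im u / h\<rfloor>)" using u by (simp add: cell_def cell_index_def)
    then have "\<bar>\<lfloor>Re u / h\<rfloor> - fst \<nu>\<bar> \<le> 1" "\<bar>\<lfloor>Im u / h\<rfloor> - snd \<nu>\<bar> \<le> 1"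
      using \<kappa> by (auto simp: cell_block_def)
    from this[THEN *] show "u \<in> square t (cell_center h \<nu>)" by (simp add: square_def cell_center_def)
  qed
  have fin: "wmass w E < top" if "E \<subseteq> square t z" for E z
    using bounded_subset[OF bounded_square that] by (intro wmass_finite w)
  have low: "c * (pi * \<rho>\<^sup>2) powr q * W \<kappa> \<le> enn2real (wmass w (ball u \<rho>))"
    if "\<rho> \<ge> 0" "ball u \<rho> \<subseteq> square t z" "cell h \<kappa> \<subseteq> square t z" for u \<rho> z \<kappa>
  proof -
    have "W \<kappa> \<le> enn2real (wmass w (square t z))"
      unfolding W_def using that fin by (intro enn2real_mono wmass_mono) auto
    then have "c * (pi * \<rho>\<^sup>2) powr q * W \<kappa> \<le> c * measure lebesgue (ball u \<rho>) powr q * enn2real (wmass w (square t z))"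
      using c unfolding area[OF that(1)] by (intro mult_left_mono) auto
    also have "\<dots> \<le> enn2real (wmass w (ball u \<rho>))"
    proof -
      have "ennreal (c * measure lebesgue (ball u \<rho>) powr q * enn2real (wmass w (square t z))) \<le> wmass w (ball u \<rho>)"
        by (rule ineq[unfolded A_infty_ineq_def, rule_format]) (use that in auto)
      also have "\<dots> = ennreal (enn2real (wmass w (ball u \<rho>)))" using fin[OF that(2)] by simp
      finally show ?thesis by (subst (asm) ennreal_le_iff) auto
    qed
    finally show ?thesis .
  qed
  have ballcell: "ball (cell_center h \<nu>) (h / 2) \<subseteq> cell h \<nu>" for \<nu>
    by (rule ball_subset_cell[OF h(1)])
  have emW: "emeasure (weight_measure w) (cell h \<nu>) = ennreal (W \<nu>)" for \<nu>
    using fin[OF cellsub] by (simp add: emeasure_weight_measure[OF w] W_def)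
  have Wpos: "W \<nu> > 0" for \<nu>
  proof -
    have "emeasure lebesgue (ball (cell_center h \<nu>) (h / 2)) > 0"
      using h by (simp add: emeasure_ball unit_ball_vol_2)
    then have "emeasure lebesgue (cell h \<nu>) > 0"
      by (rule less_le_trans) (intro emeasure_mono ballcell, simp)
    then have "wmass w (cell h \<nu>) > 0"
      unfolding wmass_def by (intro AE_pos_integral_pos weight_measurable w pos) auto
    then show ?thesis using fin[OF cellsub, of \<nu>] by (simp add: W_def enn2real_positive_iff)
  qed
  \<comment> \<open>The share of w(Q) that the disc of radius h/2 inside a cell must carry; its
    inverse bounds the ratio of masses of adjacent cells.\<close>
  define b where "b = c * (pi * (h / 2)\<^sup>2) powr q"
  have b: "b > 0" unfolding b_def using c h by simp
  have adj: "W \<kappa> \<le> max 1 (1 / b) * W \<nu>" if \<kappa>: "\<kappa> \<in> cell_block 1 \<nu>" for \<kappa> \<nu>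
  proof -
    have "b * W \<kappa> \<le> enn2real (wmass w (ball (cell_center h \<nu>) (h / 2)))"
      unfolding b_def using h ballcell[of \<nu>] cellsub[of \<nu>] adjsub[OF \<kappa>]
      by (intro low[where z = "cell_center h \<nu>"]) auto
    also have "\<dots> \<le> W \<nu>"
      unfolding W_def using fin[OF cellsub] by (intro enn2real_mono wmass_mono ballcell) auto
    finally have "W \<kappa> \<le> 1 / b * W \<nu>" using b by (simp add: field_simps)
    also have "\<dots> \<le> max 1 (1 / b) * W \<nu>" using Wpos[of \<nu>] by (intro mult_right_mono) auto
    finally show ?thesis .
  qed
  \<comment> \<open>The exponent 2 q arises because the area of a disc is pi \<rho>^2.\<close>
  have bl: "ball_lower (weight_measure w) (c * pi powr q) (2 * q) h z (W (cell_index h z))" for z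
    unfolding ball_lower_def
  proof (intro allI impI)
    fix u \<rho> assume \<rho>: "0 < (\<rho>::real)" and sub: "ball u \<rho> \<subseteq> ball z h"
    define \<nu> where "\<nu> = cell_index h z"
    have "ball z h \<subseteq> square t (cell_center h \<nu>)"
    proof
      fix v assume "v \<in> ball z h"
      moreover have "cmod (z - cell_center h \<nu>) \<le> h" using h by (intro cell_center_dist_upper) (auto simp: cell_def \<nu>_def)
      ultimately have "cmod (v - cell_center h \<nu>) \<le> 2 * h"
        using norm_triangle_ineq[of "v - z" "z - cell_center h \<nu>"] by (simp add: dist_norm norm_minus_commute)
      then show "v \<in> square t (cell_center h \<nu>)" by (rule near)
    qed
    then have sq: "ball u \<rho> \<subseteq> square t (cell_center h \<nu>)" using sub by blast
    have "c * (pi * \<rho>\<^sup>2) powr q * W \<nu> \<le> enn2real (wmass w (ball u \<rho>))"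
      using \<rho> by (intro low[OF _ sq cellsub]) auto
    moreover have "c * (pi * \<rho>\<^sup>2) powr q * W \<nu> = c * pi powr q * \<rho> powr (2 * q) * W \<nu>"
    proof -
      have "(\<rho>\<^sup>2) powr q = (\<rho> powr 2) powr q" using \<rho> by simp
      also have "\<dots> = \<rho> powr (2 * q)" by (simp only: powr_powr)
      finally show ?thesis by (simp add: powr_mult)
    qed
    ultimately have "ennreal (c * pi powr q * \<rho> powr (2 * q) * W \<nu>) \<le> ennreal (enn2real (wmass w (ball u \<rho>)))"
      by (intro ennreal_leI) simp
    also have "\<dots> = emeasure (weight_measure w) (ball u \<rho>)"
      using fin[OF sq] by (simp add: emeasure_weight_measure[OF w])
    finally show "ennreal (c * pi powr q * \<rho> powr (2 * q) * W (cell_index h z)) \<le> emeasure (weight_measure w) (ball u \<rho>)"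
      by (simp add: \<nu>_def)
  qed
  have "fock_lattice \<alpha> p h (max 1 (1 / b)) (c * pi powr q) (2 * q) (weight_measure w) W"
    using \<alpha> p h q c by unfold_locales (auto simp: sets_weight_measure emW Wpos adj bl)
  then show ?thesis by blast
qed

section \<open>The main theorem\<close>

text \<open>The outcome with the lattice eliminated: mesh and cell masses no longer occur, only the
  measure wm.\<close>

definition lattice_equiv :: "real \<Rightarrow> real \<Rightarrow> complex measure \<Rightarrow> real \<Rightarrow> real \<Rightarrow> bool" where
  "lattice_equiv \<alpha> p wm r t \<longleftrightarrow> (\<exists>c>0. \<forall>\<mu>. sets \<mu> = sets borel \<longrightarrow>
     ((\<forall>f\<in>fock_set \<alpha> p wm. fock_mass \<alpha> p \<mu> f < top) \<and>
      (\<exists>K. summing_const r (fock_set \<alpha> p wm) (fock_norm \<alpha> p wm) (fock_norm \<alpha> p \<mu>) (\<lambda>f. f) K) \<longleftrightarrow>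
      integral_powr (t / p) (\<lambda>z. emeasure \<mu> (ball z 1) / emeasure wm (ball z 1)) < top) \<and>
     (integral_powr (t / p) (\<lambda>z. emeasure \<mu> (ball z 1) / emeasure wm (ball z 1)) < top \<longrightarrow>
       comparable c (summing_norm r (fock_set \<alpha> p wm) (fock_norm \<alpha> p wm) (fock_norm \<alpha> p \<mu>) (\<lambda>f. f))
         (enn2real (integral_powr (t / p) (\<lambda>z. emeasure \<mu> (ball z 1) / emeasure wm (ball z 1))) powr (1 / t))))"

context fock_lattice
begin

lemma lattice_equivI:
  assumes "1 \<le> r0" "r0 \<le> p" "r0 \<le> r" "r \<le> r1" "t > 0" "k > 0"
    and "\<And>(N :: (int \<times> int) set) a. finite N \<Longrightarrow> (\<And>\<nu>. \<nu> \<in> N \<Longrightarrow> 0 \<le> a \<nu>) \<Longrightarrow>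
      diag_dom p r0 N a ((\<Sum>\<nu>\<in>N. a \<nu> powr t) powr (1 / t) / k)"
    and "\<exists>C>0. lower_bound r1 t C"
  shows "lattice_equiv \<alpha> p wm r t"
proof -
  have mh: "lattice_average \<mu> = (\<lambda>z. emeasure \<mu> (ball z 1) / emeasure wm (ball z 1))" for \<mu>
    by (rule ext) (simp add: lattice_average_def)
  from summing_equivalence[OF assms] show ?thesis
    unfolding mh lattice_equiv_def .
qed

text \<open>Signs give sufficiency already at exponent 1, and the randomised test gives necessity at
  every exponent from 2 on, with the same power 2; hence one condition for all r.\<close>

lemma lattice_equiv_lt2:
  assumes "p < 2" "r \<ge> 1"
  shows "lattice_equiv \<alpha> p wm r 2"
  by (rule lattice_equivI[OF _ _ assms(2) _ _ Khintchine_lower_const_pos diag_dom_lt2[OF p assms(1)]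
        summing_lower_lt2[of "max r 2"]]) (use p assms in auto)

text \<open>Sufficiency comes from exponent 1 through signs, necessity from exponent p' through
  single kernels.\<close>

lemma lattice_equiv_ge2_small:
  assumes "2 \<le> p" "1 \<le> r" "r \<le> conj_exp p"
  shows "lattice_equiv \<alpha> p wm r (conj_exp p)"
  by (rule lattice_equivI[OF _ _ assms(2,3) _ Khintchine_lower_const_pos diag_dom_ge2[OF assms(1)]
        summing_lower_direct[OF order_refl]]) (use p conj_exp_gt1[OF p] in auto)

text \<open>Both halves are available at r itself: coordinate functionals because r <= p, single
  kernels because r >= p'.\<close>

lemma lattice_equiv_ge2_middle:
  assumes "conj_exp p \<le> r" "r \<le> p"
  shows "lattice_equiv \<alpha> p wm r r"
proof -
  have r: "r > 1" using conj_exp_gt1[OF p] assms by simp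
  have U: "diag_dom p r N a ((\<Sum>\<nu>\<in>N. a \<nu> powr r) powr (1 / r) / 1)"
    if "finite N" "\<And>\<nu>. \<nu> \<in> N \<Longrightarrow> 0 \<le> a \<nu>" for N :: "(int \<times> int) set" and a
    using diag_dom_coordinates[of r p N a] that r assms by simp
  show ?thesis
    by (rule lattice_equivI[OF _ assms(2) _ _ _ zero_less_one U summing_lower_direct[OF assms(1)]]) (use r in auto)
qed

text \<open>Sufficiency comes from exponent p through coordinate functionals, necessity at r from
  the randomised test, whose power is p for every r >= p.\<close>

lemma lattice_equiv_ge2_large:
  assumes "2 \<le> p" "p \<le> r"
  shows "lattice_equiv \<alpha> p wm r p"
proof -
  have U: "diag_dom p p N a ((\<Sum>\<nu>\<in>N. a \<nu> powr p) powr (1 / p) / 1)"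
    if "finite N" "\<And>\<nu>. \<nu> \<in> N \<Longrightarrow> 0 \<le> a \<nu>" for N :: "(int \<times> int) set" and a
    using diag_dom_coordinates[of p p N a] that p by simp
  show ?thesis
    by (rule lattice_equivI[OF _ _ assms(2) _ _ zero_less_one U summing_lower_ge2[OF assms(2,1)]]) (use p in auto)
qed

end

section \<open>Return to the spaces of the statement\<close>

definition Id_equiv :: "real \<Rightarrow> real \<Rightarrow> (complex \<Rightarrow> real) \<Rightarrow> real \<Rightarrow> real \<Rightarrow> bool" where
  "Id_equiv \<alpha> p w r t \<longleftrightarrow> (\<exists>c>0. \<forall>\<mu>. sets \<mu> = sets borel \<longrightarrow>
     (Id_summing r \<alpha> p w \<mu> \<longleftrightarrow> in_L (t / p) (mu_hat \<mu> w)) \<and>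
     (Id_summing r \<alpha> p w \<mu> \<longrightarrow>
       comparable c (pi_Id r \<alpha> p w \<mu>) (enn2real (integral_powr (t / p) (mu_hat \<mu> w)) powr (1 / t))))"

lemma integral_Lw_eq:
  assumes w: "weight w" and p: "p > 0" and f: "f holomorphic_on UNIV"
  shows "integral_Lw \<alpha> p w f = fock_mass \<alpha> p (weight_measure w) f"
proof -
  have "gauss_mod \<alpha> f \<in> borel_measurable borel"
    by (intro borel_measurable_continuous_onI continuous_on_gauss_mod f)
  then have "(\<lambda>u. ennreal (gauss_mod \<alpha> f u powr p)) \<in> borel_measurable borel" by measurable
  then have "(\<lambda>u. ennreal (gauss_mod \<alpha> f u powr p)) \<in> borel_measurable lebesgue"
    by (rule borel_measurable_finer) auto
  then have "fock_mass \<alpha> p (weight_measure w) f = (\<integral>\<^sup>+u. ennreal (w u) * ennreal (gauss_mod \<alpha> f u powr p) \<partial>lebesgue)"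
    unfolding fock_mass_def by (rule nn_integral_weight_measure[OF w])
  also have "\<dots> = integral_Lw \<alpha> p w f"
    unfolding integral_Lw_def using w p
    by (intro nn_integral_cong) (simp add: weight_def gauss_mod_powr[symmetric] ennreal_mult[symmetric] mult_ac)
  finally show ?thesis ..
qed

lemma Fock_space_eq:
  assumes w: "weight w" and p: "p > 0"
  shows "Fock_space \<alpha> p w = fock_set \<alpha> p (weight_measure w)"
proof -
  have "f \<in> borel_measurable lebesgue" if "f holomorphic_on UNIV" for f :: "complex \<Rightarrow> complex"
  proof -
    have "f \<in> borel_measurable borel"
      using that by (intro borel_measurable_continuous_onI holomorphic_on_imp_continuous_on)
    then show ?thesis by (rule borel_measurable_finer) auto
  qed
  then show ?thesis
    using integral_Lw_eq[OF w p] by (auto simp: Fock_space_def Lw_space_def fock_set_def)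
qed

lemma integral_Lmu_eq: "p > 0 \<Longrightarrow> integral_Lmu \<alpha> p \<mu> f = fock_mass \<alpha> p \<mu> f"
  unfolding integral_Lmu_def fock_mass_def by (simp only: gauss_mod_powr)

lemma Lmu_norm_eq: "p > 0 \<Longrightarrow> Lmu_norm \<alpha> p \<mu> = fock_norm \<alpha> p \<mu>"
  by (rule ext) (simp add: Lmu_norm_def fock_norm_def integral_Lmu_eq)

text \<open>The two expressions for the Fock norm are only known to agree on the space, while
  functionals live on all functions; the dual ball sees the norm on X alone.\<close>

lemma dual_ball_cong:
  assumes "\<And>f. f \<in> X \<Longrightarrow> nX f = nX' f"
  shows "dual_ball X nX = dual_ball X nX'"
  unfolding dual_ball_def using assms by auto

lemma summing_const_Id_eq:
  assumes w: "weight w" and p: "p > 0"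
  shows "summing_const r (Fock_space \<alpha> p w) (Lw_norm \<alpha> p w) (Lmu_norm \<alpha> p \<mu>) (\<lambda>f. f)
       = summing_const r (fock_set \<alpha> p (weight_measure w)) (fock_norm \<alpha> p (weight_measure w)) (fock_norm \<alpha> p \<mu>) (\<lambda>f. f)"
proof -
  have "dual_ball (fock_set \<alpha> p (weight_measure w)) (Lw_norm \<alpha> p w) = dual_ball (fock_set \<alpha> p (weight_measure w)) (fock_norm \<alpha> p (weight_measure w))"
    using integral_Lw_eq[OF w p] by (intro dual_ball_cong) (simp add: fock_set_def Lw_norm_def fock_norm_def)
  then show ?thesis
    unfolding summing_const_def Fock_space_eq[OF w p] Lmu_norm_eq[OF p] by simp
qed

text \<open>Additivity and homogeneity are trivial for the identity and entire functions are Borel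
  measurable, so what remains is finiteness of the target norm.\<close>

lemma linear_map_on_Id:
  assumes w: "weight w" and p: "p > 0" and mu: "sets \<mu> = sets borel"
  shows "linear_map_on (Fock_space \<alpha> p w) (Lmu_space \<alpha> p \<mu>) (\<lambda>f. f)
     \<longleftrightarrow> (\<forall>f\<in>fock_set \<alpha> p (weight_measure w). fock_mass \<alpha> p \<mu> f < top)"
proof -
  have "f \<in> borel_measurable \<mu>" if "f \<in> fock_set \<alpha> p (weight_measure w)" for f
  proof -
    have "f \<in> borel_measurable borel"
      using that unfolding fock_set_def by (intro borel_measurable_continuous_onI holomorphic_on_imp_continuous_on) auto
    then show ?thesis by (rule borel_measurable_finer) (simp add: mu)
  qed
  then show ?thesis
    unfolding linear_map_on_def Fock_space_eq[OF w p] by (auto simp: Lmu_space_def integral_Lmu_eq[OF p])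
qed

lemma Id_equivI:
  assumes w: "weight w" and p: "p > 0" and le: "lattice_equiv \<alpha> p (weight_measure w) r t"
  shows "Id_equiv \<alpha> p w r t"
proof -
  have mh: "mu_hat \<mu> w = (\<lambda>z. emeasure \<mu> (ball z 1) / emeasure (weight_measure w) (ball z 1))" for \<mu>
    by (rule ext) (simp add: mu_hat_def emeasure_weight_measure[OF w])
  have meas: "mu_hat \<mu> w \<in> borel_measurable lebesgue" if "sets \<mu> = sets borel" for \<mu>
  proof -
    have "(\<lambda>z. emeasure \<mu> (ball z 1)) \<in> borel_measurable borel"
      "(\<lambda>z. emeasure (weight_measure w) (ball z 1)) \<in> borel_measurable borel"
      using that by (auto intro!: measurable_emeasure_ball simp: sets_weight_measure)
    then have "mu_hat \<mu> w \<in> borel_measurable borel" unfolding mh by measurable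
    then show ?thesis by (rule borel_measurable_finer) auto
  qed
  have pi: "pi_Id r \<alpha> p w \<mu> = summing_norm r (fock_set \<alpha> p (weight_measure w)) (fock_norm \<alpha> p (weight_measure w)) (fock_norm \<alpha> p \<mu>) (\<lambda>f. f)" for \<mu>
    unfolding pi_Id_def summing_norm_def summing_const_Id_eq[OF w p] ..
  have Id: "Id_summing r \<alpha> p w \<mu> \<longleftrightarrow> (\<forall>f\<in>fock_set \<alpha> p (weight_measure w). fock_mass \<alpha> p \<mu> f < top) \<and>
      (\<exists>K. summing_const r (fock_set \<alpha> p (weight_measure w)) (fock_norm \<alpha> p (weight_measure w)) (fock_norm \<alpha> p \<mu>) (\<lambda>f. f) K)"
    if "sets \<mu> = sets borel" for \<mu>
    unfolding Id_summing_def summing_def summing_const_Id_eq[OF w p] linear_map_on_Id[OF w p that] ..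
  obtain c where c: "c > 0" and main: "\<And>\<mu>. sets \<mu> = sets borel \<Longrightarrow>
     (Id_summing r \<alpha> p w \<mu> \<longleftrightarrow> integral_powr (t / p) (mu_hat \<mu> w) < top) \<and>
     (integral_powr (t / p) (mu_hat \<mu> w) < top \<longrightarrow>
       comparable c (pi_Id r \<alpha> p w \<mu>) (enn2real (integral_powr (t / p) (mu_hat \<mu> w)) powr (1 / t)))"
    using le unfolding lattice_equiv_def mh[symmetric] pi[symmetric] by (auto simp: Id)
  show ?thesis
    unfolding Id_equiv_def in_L_def using c main meas by (intro exI[of _ c]) blast
qed

lemma comparable_mono:
  assumes "comparable c A B" "0 < c" "c \<le> d" "0 \<le> B"
  shows "comparable d A B"
proof -
  have "c * A \<ge> 0" using assms unfolding comparable_def by linarith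
  then have A: "A \<ge> 0" using assms(2) by (simp add: zero_le_mult_iff)
  have "inverse d * A \<le> inverse c * A" "c * A \<le> d * A"
    using assms A by (auto intro!: mult_right_mono le_imp_inverse_le)
  then show ?thesis using assms(1) unfolding comparable_def by linarith
qed

lemma comparable_chain:
  assumes A: "comparable c A J" and B: "comparable d B J" and c: "0 < c" and d: "0 < d" and J: "0 \<le> J"
  shows "comparable (c * d) A B"
proof -
  have 1: "A \<le> c * J" "J \<le> c * A" "B \<le> d * J" "J \<le> d * B"
    using A B c d unfolding comparable_def by (auto simp: field_simps)
  have "A \<le> c * (d * B)" using 1 c by (meson mult_left_mono less_imp_le order_trans)
  moreover have "B \<le> d * (c * A)" using 1 d by (meson mult_left_mono less_imp_le order_trans)
  ultimately show ?thesis using c d unfolding comparable_def by (simp add: field_simps)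
qed

text \<open>Both summing norms are comparable to the same integral because the two exponents share
  t; the integral is the intermediary between them.\<close>

lemma Id_equiv_pair:
  assumes r: "Id_equiv \<alpha> p w r t" and r': "Id_equiv \<alpha> p w r' t"
  shows "\<exists>c>0. \<forall>\<mu>. sets \<mu> = sets borel \<longrightarrow>
     (Id_summing r \<alpha> p w \<mu> \<longleftrightarrow> in_L (t / p) (mu_hat \<mu> w)) \<and>
     (Id_summing r \<alpha> p w \<mu> \<longrightarrow>
       comparable c (pi_Id r \<alpha> p w \<mu>) (pi_Id r' \<alpha> p w \<mu>) \<and>
       comparable c (pi_Id r' \<alpha> p w \<mu>) (enn2real (integral_powr (t / p) (mu_hat \<mu> w)) powr (1 / t)))"
proof -
  define J where "J \<mu> = enn2real (integral_powr (t / p) (mu_hat \<mu> w)) powr (1 / t)" for \<mu>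
  have J0: "J \<mu> \<ge> 0" for \<mu> by (simp add: J_def)
  obtain c where c: "c > 0" and cell_mass: "\<And>\<mu>. sets \<mu> = sets borel \<Longrightarrow>
     (Id_summing r \<alpha> p w \<mu> \<longleftrightarrow> in_L (t / p) (mu_hat \<mu> w)) \<and>
     (Id_summing r \<alpha> p w \<mu> \<longrightarrow> comparable c (pi_Id r \<alpha> p w \<mu>) (J \<mu>))"
    using r unfolding Id_equiv_def J_def by blast
  obtain d where d: "d > 0" and dm: "\<And>\<mu>. sets \<mu> = sets borel \<Longrightarrow>
     (Id_summing r' \<alpha> p w \<mu> \<longleftrightarrow> in_L (t / p) (mu_hat \<mu> w)) \<and>
     (Id_summing r' \<alpha> p w \<mu> \<longrightarrow> comparable d (pi_Id r' \<alpha> p w \<mu>) (J \<mu>))"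
    using r' unfolding Id_equiv_def J_def by blast
  define e where "e = max (c * d) d"
  have e: "e > 0" "c * d \<le> e" "d \<le> e" using d by (auto simp: e_def)
  show ?thesis
    unfolding J_def[symmetric]
  proof (intro exI[of _ e] conjI allI impI e(1))
    fix \<mu> :: "complex measure" assume mu: "sets \<mu> = sets borel"
    show iff: "Id_summing r \<alpha> p w \<mu> \<longleftrightarrow> in_L (t / p) (mu_hat \<mu> w)" using cell_mass[OF mu] by blast
    assume Id: "Id_summing r \<alpha> p w \<mu>"
    have A: "comparable c (pi_Id r \<alpha> p w \<mu>) (J \<mu>)" using cell_mass[OF mu] Id by blast
    have B: "comparable d (pi_Id r' \<alpha> p w \<mu>) (J \<mu>)" using dm[OF mu] iff Id by blast
    have "d * pi_Id r' \<alpha> p w \<mu> \<ge> 0" using B J0[of \<mu>] unfolding comparable_def by linarith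
    then have "pi_Id r' \<alpha> p w \<mu> \<ge> 0" using d by (simp add: zero_le_mult_iff)
    then show "comparable e (pi_Id r \<alpha> p w \<mu>) (pi_Id r' \<alpha> p w \<mu>)"
      using comparable_mono[OF comparable_chain[OF A B c d J0] _ e(2)] c d by simp
    show "comparable e (pi_Id r' \<alpha> p w \<mu>) (J \<mu>)" by (rule comparable_mono[OF B d e(3) J0])
  qed
qed

text \<open>The exponent q is 1 for the class with index 1 and otherwise the index s of the class
  containing w, which is unrelated to the exponent p of the Fock space.\<close>

lemma A_restricted_lattice:
  assumes \<alpha>: "\<alpha> > 0" and p: "p > 1" and w: "w \<in> A_restricted_infty"
  shows "weight w \<and> (\<exists>h M c0 \<theta> W. fock_lattice \<alpha> p h M c0 \<theta> (weight_measure w) W)"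
proof -
  have "\<exists>q>0. weight w \<and> (AE z in lebesgue. 0 < w z) \<and> (\<exists>t>0. \<exists>c>0. A_infty_ineq w t c q)"
  proof -
    consider "w \<in> A_restricted_1" | s where "s > 1" "w \<in> A_restricted_gt1 s"
      using w unfolding A_restricted_infty_def by auto
    then show ?thesis
    proof cases
      case 1
      then show ?thesis using A_restricted_1_ineq[of w] zero_less_one by blast
    next
      case (2 s)
      then have "s > 0" by simp
      then show ?thesis using A_restricted_gt1_ineq[OF 2] by blast
    qed
  qed
  then obtain q t c where "q > 0" "weight w" "AE z in lebesgue. 0 < w z" "t > 0" "c > 0" "A_infty_ineq w t c q"
    by blast
  then show ?thesis using weight_lattice[OF \<alpha> p] by blast
qed

theorem theorem1p2:
  fixes \<alpha> :: real
  assumes "\<alpha> > 0"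
  shows
    "(\<forall>p w. 1 < p \<and> p < 2 \<and> w \<in> A_restricted_gt1 p \<longrightarrow>
       (\<forall>r\<ge>1. \<exists>c>0. \<forall>\<mu>. sets \<mu> = sets borel \<longrightarrow>
          (Id_summing r \<alpha> p w \<mu> \<longleftrightarrow> in_L (2 / p) (mu_hat \<mu> w)) \<and>
          (Id_summing r \<alpha> p w \<mu> \<longrightarrow>
             comparable c (pi_Id r \<alpha> p w \<mu>) (pi_Id 2 \<alpha> p w \<mu>) \<and>
             comparable c (pi_Id 2 \<alpha> p w \<mu>)
               (enn2real (integral_powr (2 / p) (mu_hat \<mu> w)) powr (1 / 2)))))
     \<and>
     (\<forall>p w. 2 \<le> p \<and> w \<in> A_restricted_infty \<longrightarrow>
       (\<forall>r. 1 \<le> r \<and> r \<le> conj_exp p \<longrightarrow> (\<exists>c>0. \<forall>\<mu>. sets \<mu> = sets borel \<longrightarrow>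
          (Id_summing r \<alpha> p w \<mu> \<longleftrightarrow> in_L (conj_exp p / p) (mu_hat \<mu> w)) \<and>
          (Id_summing r \<alpha> p w \<mu> \<longrightarrow>
             comparable c (pi_Id r \<alpha> p w \<mu>) (pi_Id 1 \<alpha> p w \<mu>) \<and>
             comparable c (pi_Id 1 \<alpha> p w \<mu>)
               (enn2real (integral_powr (conj_exp p / p) (mu_hat \<mu> w)) powr (1 / conj_exp p)))))
       \<and>
       (\<forall>r. conj_exp p \<le> r \<and> r \<le> p \<longrightarrow> (\<exists>c>0. \<forall>\<mu>. sets \<mu> = sets borel \<longrightarrow>
          (Id_summing r \<alpha> p w \<mu> \<longleftrightarrow> in_L (r / p) (mu_hat \<mu> w)) \<and>
          (Id_summing r \<alpha> p w \<mu> \<longrightarrow>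
             comparable c (pi_Id r \<alpha> p w \<mu>)
               (enn2real (integral_powr (r / p) (mu_hat \<mu> w)) powr (1 / r)))))
       \<and>
       (\<forall>r\<ge>p. \<exists>c>0. \<forall>\<mu>. sets \<mu> = sets borel \<longrightarrow>
          (Id_summing r \<alpha> p w \<mu> \<longleftrightarrow> in_L 1 (mu_hat \<mu> w)) \<and>
          (Id_summing r \<alpha> p w \<mu> \<longrightarrow>
             comparable c (pi_Id r \<alpha> p w \<mu>) (pi_Id p \<alpha> p w \<mu>) \<and>
             comparable c (pi_Id p \<alpha> p w \<mu>)
               (enn2real (integral_powr 1 (mu_hat \<mu> w)) powr (1 / p)))))"
proof -
  have part1: "Id_equiv \<alpha> p w r 2" if "1 < p" "p < 2" "w \<in> A_restricted_gt1 p" "1 \<le> r" for p w r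
  proof -
    have "w \<in> A_restricted_infty" using that by (auto simp: A_restricted_infty_def)
    from A_restricted_lattice[OF assms that(1) this] obtain h M c0 \<theta> W
      where w: "weight w" and lat: "fock_lattice \<alpha> p h M c0 \<theta> (weight_measure w) W" by blast
    show ?thesis
      using that by (intro Id_equivI w fock_lattice.lattice_equiv_lt2[OF lat]) auto
  qed
  have part2: "(1 \<le> r \<and> r \<le> conj_exp p \<longrightarrow> Id_equiv \<alpha> p w r (conj_exp p)) \<and>
      (conj_exp p \<le> r \<and> r \<le> p \<longrightarrow> Id_equiv \<alpha> p w r r) \<and> (p \<le> r \<longrightarrow> Id_equiv \<alpha> p w r p)"
    if "2 \<le> p" "w \<in> A_restricted_infty" for p w r
  proof -
    have p1: "p > 1" using that by simp
    from A_restricted_lattice[OF assms p1 that(2)] obtain h M c0 \<theta> W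
      where w: "weight w" and lat: "fock_lattice \<alpha> p h M c0 \<theta> (weight_measure w) W" by blast
    show ?thesis
      using that p1
      by (intro conjI impI Id_equivI w fock_lattice.lattice_equiv_ge2_small[OF lat]
          fock_lattice.lattice_equiv_ge2_middle[OF lat] fock_lattice.lattice_equiv_ge2_large[OF lat]) auto
  qed
  show ?thesis
  proof (intro conjI allI impI; (elim conjE)?)
    fix p r :: real and w
    assume *: "1 < p" "p < 2" "w \<in> A_restricted_gt1 p" "1 \<le> r"
    show "\<exists>c>0. \<forall>\<mu>. sets \<mu> = sets borel \<longrightarrow>
          (Id_summing r \<alpha> p w \<mu> \<longleftrightarrow> in_L (2 / p) (mu_hat \<mu> w)) \<and>
          (Id_summing r \<alpha> p w \<mu> \<longrightarrow>
             comparable c (pi_Id r \<alpha> p w \<mu>) (pi_Id 2 \<alpha> p w \<mu>) \<and>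
             comparable c (pi_Id 2 \<alpha> p w \<mu>)
               (enn2real (integral_powr (2 / p) (mu_hat \<mu> w)) powr (1 / 2)))"
      using * by (intro Id_equiv_pair part1) auto
  next
    fix p r :: real and w
    assume *: "2 \<le> p" "w \<in> A_restricted_infty" "1 \<le> r" "r \<le> conj_exp p"
    then have "Id_equiv \<alpha> p w r (conj_exp p)" "Id_equiv \<alpha> p w 1 (conj_exp p)"
      using part2[OF *(1,2)] conj_exp_gt1[of p] by auto
    then show "\<exists>c>0. \<forall>\<mu>. sets \<mu> = sets borel \<longrightarrow>
          (Id_summing r \<alpha> p w \<mu> \<longleftrightarrow> in_L (conj_exp p / p) (mu_hat \<mu> w)) \<and>
          (Id_summing r \<alpha> p w \<mu> \<longrightarrow>
             comparable c (pi_Id r \<alpha> p w \<mu>) (pi_Id 1 \<alpha> p w \<mu>) \<and>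
             comparable c (pi_Id 1 \<alpha> p w \<mu>)
               (enn2real (integral_powr (conj_exp p / p) (mu_hat \<mu> w)) powr (1 / conj_exp p)))"
      by (rule Id_equiv_pair)
  next
    fix p r :: real and w
    assume *: "2 \<le> p" "w \<in> A_restricted_infty" "conj_exp p \<le> r" "r \<le> p"
    then have "Id_equiv \<alpha> p w r r" using part2[OF *(1,2)] by auto
    then show "\<exists>c>0. \<forall>\<mu>. sets \<mu> = sets borel \<longrightarrow>
          (Id_summing r \<alpha> p w \<mu> \<longleftrightarrow> in_L (r / p) (mu_hat \<mu> w)) \<and>
          (Id_summing r \<alpha> p w \<mu> \<longrightarrow>
             comparable c (pi_Id r \<alpha> p w \<mu>)
               (enn2real (integral_powr (r / p) (mu_hat \<mu> w)) powr (1 / r)))"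
      unfolding Id_equiv_def .
  next
    fix p r :: real and w
    assume *: "2 \<le> p" "w \<in> A_restricted_infty" "p \<le> r"
    then have "Id_equiv \<alpha> p w r p" "Id_equiv \<alpha> p w p p"
      using part2[OF *(1,2)] by auto
    \<comment> \<open>The exponent t / p is here p / p, which simplifies to 1.\<close>
    from Id_equiv_pair[OF this] * show "\<exists>c>0. \<forall>\<mu>. sets \<mu> = sets borel \<longrightarrow>
          (Id_summing r \<alpha> p w \<mu> \<longleftrightarrow> in_L 1 (mu_hat \<mu> w)) \<and>
          (Id_summing r \<alpha> p w \<mu> \<longrightarrow>
             comparable c (pi_Id r \<alpha> p w \<mu>) (pi_Id p \<alpha> p w \<mu>) \<and>
             comparable c (pi_Id p \<alpha> p w \<mu>)
               (enn2real (integral_powr 1 (mu_hat \<mu> w)) powr (1 / p)))"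
      by simp
  qed
qed

end
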